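(* For any $T>0$ and any $(\rho_0,u_0,S_0)\in L^2(0,\pi)\times L^2(0,\pi)\times L^2_m(0,\pi)$ there exists a control $f_1\in L^2(0,T;L^2(0,\pi))$, acting everywhere in the density equation, such that the corresponding solution $(\rho,u,S)$ of $$\begin{cases}\partial_t\rho+\rho_s\partial_x u=f_1 & \text{in }(0,T)\times(0,\pi),\\ \partial_t u+a\gamma\rho_s^{\gamma-2}\partial_x\rho-\frac1{\rho_s}\partial_x S=0 & \text{in }(0,T)\times(0,\pi),\\ \partial_t S+\frac1\kappa S-\frac\mu\kappa\partial_x u=0 & \text{in }(0,T)\times(0,\pi),\\ u(t,0)=u(t,\pi)=0 & t\in(0,T),\\ \rho(0)=\rho_0,\ u(0)=u_0,\ S(0)=S_0 & \text{in }(0,\pi)\end{cases}$$ belongs to $C([0,T];L^2(0,\pi)\times L^2(0,\pi)\times L^2_m(0,\pi))$ and satisfies $\rho(T,x)=u(T,x)=S(T,x)=0$ for all $x\in(0,\pi)$.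
   Context: The constants satisfy $a>0$, $\gamma\ge1$, $\rho_s>0$, $\mu>0$, $\kappa>0$. Function spaces are complex-valued, and $L^2_m(0,\pi)=\{f\in L^2(0,\pi):\int_0^\pi f\,dx=0\}$. Put $b=a\gamma\rho_s^{\gamma-2}$. Solutions are understood as mild solutions $z=(\rho,u,S)^\top$ of $\dot z=\mathcal{A}z+(f_1,0,0)^\top$, $z(0)=(\rho_0,u_0,S_0)^\top$, where $\mathcal{A}(\rho,u,S)^\top=(-\rho_s u',\,-b\rho'+\frac1{\rho_s}S',\,\frac\mu\kappa u'-\frac1\kappa S)^\top$ with domain $\{(\rho,u,S)\in(L^2(0,\pi))^3: u\in H^1_0(0,\pi),\ -b\rho+\frac1{\rho_s}S\in H^1(0,\pi)\}$ ($\mathcal{A}$ generates a strongly continuous semigroup on $(L^2(0,\pi))^3$). Equalities at time $T$ are equalities in $L^2(0,\pi)$. *)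

theory Defs
  imports "HOL-Analysis.Analysis"
begin

section \<open>The space of square integrable complex functions on (0, pi)\<close>

abbreviation I0pi :: "real measure" where
  "I0pi \<equiv> lebesgue_on {0<..<pi}"

definition square_integrable :: "(real \<Rightarrow> complex) \<Rightarrow> bool" where
  "square_integrable f \<longleftrightarrow>
     f \<in> borel_measurable I0pi \<and> integrable I0pi (\<lambda>x. (norm (f x))\<^sup>2)"

definition L2_rel :: "(real \<Rightarrow> complex) \<Rightarrow> (real \<Rightarrow> complex) \<Rightarrow> bool" where
  "L2_rel f g \<longleftrightarrow> square_integrable f \<and> square_integrable g \<and> (AE x in I0pi. f x = g x)"

lemma square_integrableD [measurable_dest]:
  "square_integrable f \<Longrightarrow> f \<in> borel_measurable I0pi"
  by (simp add: square_integrable_def)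

lemma finite_measure_I0pi: "finite_measure I0pi"
  by (rule finite_measureI) (simp add: emeasure_restrict_space)

lemma square_integrable_bounded:
  assumes "f \<in> borel_measurable I0pi" "\<And>x. norm (f x) \<le> B"
  shows "square_integrable f"
  unfolding square_integrable_def
proof (intro conjI finite_measure.integrable_const_bound[OF finite_measure_I0pi])
  show "AE x in I0pi. norm ((norm (f x))\<^sup>2) \<le> B\<^sup>2"
    using assms(2) by (auto intro!: AE_I2 power_mono)
qed (use assms(1) in measurable)

lemma square_integrable_zero: "square_integrable (\<lambda>x. 0)"
  by (rule square_integrable_bounded[where B=0]) auto

lemma square_integrable_add:
  assumes "square_integrable f" "square_integrable g"
  shows "square_integrable (\<lambda>x. f x + g x)"
proof -
  note [measurable] = assms[THEN square_integrableD]
  have "integrable I0pi (\<lambda>x. (norm (f x + g x))\<^sup>2)"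
  proof (rule Bochner_Integration.integrable_bound)
    show "integrable I0pi (\<lambda>x. 2 * (norm (f x))\<^sup>2 + 2 * (norm (g x))\<^sup>2)"
      using assms by (auto simp: square_integrable_def)
    show "AE x in I0pi. norm ((norm (f x + g x))\<^sup>2)
            \<le> norm (2 * (norm (f x))\<^sup>2 + 2 * (norm (g x))\<^sup>2)"
    proof (rule AE_I2)
      fix x
      have "(norm (f x + g x))\<^sup>2 \<le> (norm (f x) + norm (g x))\<^sup>2"
        by (intro power_mono norm_triangle_ineq) auto
      also have "\<dots> \<le> 2 * (norm (f x))\<^sup>2 + 2 * (norm (g x))\<^sup>2"
        using sum_squares_bound[of "norm (f x)" "norm (g x)"]
        by (simp add: power2_sum)
      finally show "norm ((norm (f x + g x))\<^sup>2)
            \<le> norm (2 * (norm (f x))\<^sup>2 + 2 * (norm (g x))\<^sup>2)" by simp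
    qed
  qed measurable
  then show ?thesis
    unfolding square_integrable_def by simp
qed

lemma square_integrable_cmult:
  assumes "square_integrable f"
  shows "square_integrable (\<lambda>x. c * f x)"
  using assms unfolding square_integrable_def
  by (auto simp: norm_mult power_mult_distrib)

lemma square_integrable_scaleR:
  assumes "square_integrable f"
  shows "square_integrable (\<lambda>x. r *\<^sub>R f x)"
  using square_integrable_cmult[OF assms, of "of_real r"] by (simp add: scaleR_conv_of_real)

lemma square_integrable_uminus:
  assumes "square_integrable f"
  shows "square_integrable (\<lambda>x. - f x)"
  using square_integrable_cmult[OF assms, of "-1"] by simp

lemma square_integrable_diff:
  assumes "square_integrable f" "square_integrable g"
  shows "square_integrable (\<lambda>x. f x - g x)"
  using square_integrable_add[OF assms(1) square_integrable_uminus[OF assms(2)]] by simp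

lemma square_integrable_inner:
  assumes "square_integrable f" "square_integrable g"
  shows "integrable I0pi (\<lambda>x. f x \<bullet> g x)"
proof (rule Bochner_Integration.integrable_bound)
  note [measurable] = assms[THEN square_integrableD]
  show "integrable I0pi (\<lambda>x. (norm (f x))\<^sup>2 + (norm (g x))\<^sup>2)"
    using assms by (auto simp: square_integrable_def)
  show "AE x in I0pi. norm (f x \<bullet> g x) \<le> norm ((norm (f x))\<^sup>2 + (norm (g x))\<^sup>2)"
  proof (rule AE_I2)
    fix x
    have "\<bar>f x \<bullet> g x\<bar> \<le> norm (f x) * norm (g x)"
      by (rule Cauchy_Schwarz_ineq2)
    also have "\<dots> \<le> (norm (f x))\<^sup>2 + (norm (g x))\<^sup>2"
      using sum_squares_bound[of "norm (f x)" "norm (g x)"]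
        mult_nonneg_nonneg[OF norm_ge_zero[of "f x"] norm_ge_zero[of "g x"]]
      by linarith
    finally show "norm (f x \<bullet> g x) \<le> norm ((norm (f x))\<^sup>2 + (norm (g x))\<^sup>2)" by simp
  qed
qed (use assms[THEN square_integrableD] in measurable)

quotient_type L2 = "real \<Rightarrow> complex" / partial: L2_rel
proof (rule part_equivpI)
  show "\<exists>f. L2_rel f f"
    using square_integrable_zero by (auto simp: L2_rel_def)
  show "symp L2_rel"
    by (auto intro!: sympI simp: L2_rel_def)
  show "transp L2_rel"
    by (auto intro!: transpI simp: L2_rel_def)
qed

instantiation L2 :: real_inner
begin

lift_definition zero_L2 :: L2 is "\<lambda>x. 0"
  by (simp add: L2_rel_def square_integrable_zero)

lift_definition plus_L2 :: "L2 \<Rightarrow> L2 \<Rightarrow> L2" is "\<lambda>f g x. f x + g x"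
  by (auto simp: L2_rel_def intro: square_integrable_add)

lift_definition uminus_L2 :: "L2 \<Rightarrow> L2" is "\<lambda>f x. - f x"
  by (auto simp: L2_rel_def intro: square_integrable_uminus)

lift_definition minus_L2 :: "L2 \<Rightarrow> L2 \<Rightarrow> L2" is "\<lambda>f g x. f x - g x"
  by (auto simp: L2_rel_def intro: square_integrable_diff)

lift_definition scaleR_L2 :: "real \<Rightarrow> L2 \<Rightarrow> L2" is "\<lambda>r f x. r *\<^sub>R f x"
  by (auto simp: L2_rel_def intro: square_integrable_scaleR)

text \<open>The real part of the complex inner product; it induces the same norm.\<close>
lift_definition inner_L2 :: "L2 \<Rightarrow> L2 \<Rightarrow> real" is "\<lambda>f g. \<integral>x. f x \<bullet> g x \<partial>I0pi"
  by (rule integral_cong_AE) (auto simp: L2_rel_def)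

definition norm_L2 :: "L2 \<Rightarrow> real" where "norm_L2 f = sqrt (f \<bullet> f)"
definition dist_L2 :: "L2 \<Rightarrow> L2 \<Rightarrow> real" where "dist_L2 f g = norm (f - g)"
definition sgn_L2 :: "L2 \<Rightarrow> L2" where "sgn_L2 f = inverse (norm f) *\<^sub>R f"
definition uniformity_L2 :: "(L2 \<times> L2) filter" where
  "uniformity_L2 = (INF e\<in>{0<..}. principal {(x, y). dist x y < e})"
definition open_L2 :: "L2 set \<Rightarrow> bool" where
  "open_L2 U \<longleftrightarrow> (\<forall>x\<in>U. eventually (\<lambda>(x', y). x' = x \<longrightarrow> y \<in> U) uniformity)"

instance
proof
  fix f g h :: L2 and r s :: real
  show "f + g + h = f + (g + h)"
    by transfer (auto simp: L2_rel_def add.assoc intro: square_integrable_add)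
  show "f + g = g + f"
    by transfer (auto simp: L2_rel_def add.commute intro: square_integrable_add)
  show "0 + f = f"
    by transfer (auto simp: L2_rel_def)
  show "- f + f = 0"
    by transfer (auto simp: L2_rel_def square_integrable_zero)
  show "f - g = f + - g"
    by transfer (auto simp: L2_rel_def intro: square_integrable_diff)
  show "r *\<^sub>R (f + g) = r *\<^sub>R f + r *\<^sub>R g"
    by transfer
      (auto simp: L2_rel_def scaleR_add_right intro!: square_integrable_add square_integrable_scaleR)
  show "(r + s) *\<^sub>R f = r *\<^sub>R f + s *\<^sub>R f"
    by transfer
      (auto simp: L2_rel_def scaleR_add_left intro!: square_integrable_add square_integrable_scaleR)
  show "r *\<^sub>R s *\<^sub>R f = (r * s) *\<^sub>R f"
    by transfer (auto simp: L2_rel_def intro: square_integrable_scaleR)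
  show "1 *\<^sub>R f = f"
    by transfer (auto simp: L2_rel_def)
  show "f \<bullet> g = g \<bullet> f"
    by transfer (simp add: inner_commute)
  show "(f + g) \<bullet> h = f \<bullet> h + g \<bullet> h"
    by transfer (simp add: L2_rel_def inner_add_left square_integrable_inner)
  show "r *\<^sub>R f \<bullet> g = r * (f \<bullet> g)"
    by transfer simp
  show "0 \<le> f \<bullet> f"
    by transfer (simp add: integral_nonneg_AE)
  show "f \<bullet> f = 0 \<longleftrightarrow> f = 0"
  proof transfer
    fix f assume "L2_rel f f"
    then have f: "square_integrable f" by (simp add: L2_rel_def)
    have "(\<integral>x. f x \<bullet> f x \<partial>I0pi) = 0 \<longleftrightarrow> (AE x in I0pi. f x \<bullet> f x = 0)"
      by (rule integral_nonneg_eq_0_iff_AE) (auto intro: square_integrable_inner f)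
    then show "(\<integral>x. f x \<bullet> f x \<partial>I0pi) = 0 \<longleftrightarrow> L2_rel f (\<lambda>x. 0)"
      using f by (simp add: L2_rel_def square_integrable_zero)
  qed
qed (simp_all add: norm_L2_def dist_L2_def sgn_L2_def uniformity_L2_def open_L2_def)

end

lemma dense_imp_second_countable:
  assumes "countable (C :: 'a::metric_space set)" "closure C = UNIV"
  shows "\<exists>B::'a set set. countable B \<and> open = generate_topology B"
proof -
  define B where "B = (\<lambda>(c, q). ball c (of_rat q)) ` (C \<times> (UNIV :: rat set))"
  have "countable B"
    unfolding B_def using assms(1) by (intro countable_image countable_SIGMA) auto
  moreover have "topological_basis B"
  proof (rule topological_basisI)
    show "open X" if "X \<in> B" for X using that by (auto simp: B_def)
    fix U :: "'a set" and x assume "open U" "x \<in> U"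
    then obtain e where e: "e > 0" "ball x e \<subseteq> U" by (meson openE)
    obtain q where q: "0 < real_of_rat q" "real_of_rat q < e / 2"
      using of_rat_dense[of 0 "e/2"] e by auto
    have "\<forall>\<epsilon>>0. \<exists>y\<in>C. dist y x < \<epsilon>"
      using assms(2) by (simp flip: closure_approachable)
    then obtain c where c: "c \<in> C" "dist c x < of_rat q"
      using q(1) by blast
    have "ball c (of_rat q) \<subseteq> ball x e"
    proof
      fix y assume "y \<in> ball c (of_rat q)"
      then show "y \<in> ball x e"
        using dist_triangle[of x y c] c q by (simp add: dist_commute)
    qed
    then show "\<exists>V\<in>B. x \<in> V \<and> V \<subseteq> U"
      using c e by (intro bexI[of _ "ball c (of_rat q)"]) (auto simp: B_def)
  qed
  ultimately show ?thesis
    by (blast dest: topological_basis_imp_subbasis)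
qed

lemma norm_abs_L2:
  assumes "square_integrable f"
  shows "norm (abs_L2 f) = sqrt (\<integral>x. (norm (f x))\<^sup>2 \<partial>I0pi)"
  using assms unfolding norm_L2_def
  by (simp add: inner_L2.abs_eq L2_rel_def power2_norm_eq_inner)

lemma L2_cases:
  obtains f where "square_integrable f" "F = abs_L2 f"
  by (induction F rule: L2.abs_induct) (auto simp: L2_rel_def)

lemma abs_L2_diff:
  assumes "square_integrable f" "square_integrable g"
  shows "abs_L2 f - abs_L2 g = abs_L2 (\<lambda>x. f x - g x)"
  using assms by (simp add: minus_L2.abs_eq L2_rel_def)

lemma abs_L2_add:
  assumes "square_integrable f" "square_integrable g"
  shows "abs_L2 f + abs_L2 g = abs_L2 (\<lambda>x. f x + g x)"
  using assms by (simp add: plus_L2.abs_eq L2_rel_def)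

lemma abs_L2_cong:
  assumes "square_integrable f" "square_integrable g" "AE x in I0pi. f x = g x"
  shows "abs_L2 f = abs_L2 g"
  using assms by (intro Quotient_rel_abs[OF Quotient_L2]) (simp add: L2_rel_def)

lemma abs_L2_limit:
  assumes "square_integrable g" "\<And>n. square_integrable (F n)"
    and "(\<lambda>n. \<integral>x. (norm (F n x - g x))\<^sup>2 \<partial>I0pi) \<longlonglongrightarrow> 0"
  shows "(\<lambda>n. abs_L2 (F n)) \<longlonglongrightarrow> abs_L2 g"
proof -
  have "(\<lambda>n. norm (abs_L2 (F n) - abs_L2 g)) \<longlonglongrightarrow> sqrt 0"
    using tendsto_real_sqrt[OF assms(3)] assms(1,2)
    by (simp add: abs_L2_diff norm_abs_L2 square_integrable_diff)
  then show ?thesis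
    unfolding real_sqrt_zero tendsto_norm_zero_iff LIM_zero_iff .
qed

instance L2 :: banach
proof
  fix X :: "nat \<Rightarrow> L2" assume X: "Cauchy X"
  have "\<exists>N. \<forall>m\<ge>N. \<forall>n\<ge>N. dist (X m) (X n) < (1/2)^k" for k :: nat
    using metric_CauchyD[OF X, of "(1/2)^k"] by simp
  then obtain N where N: "\<And>k m n. m \<ge> N k \<Longrightarrow> n \<ge> N k \<Longrightarrow> dist (X m) (X n) < (1/2)^k"
    by metis
  define r where "r k = (\<Sum>i\<le>k. N i) + k" for k :: nat
  have "strict_mono r"
    by (rule strict_mono_Suc_iff[THEN iffD2]) (auto simp: r_def)
  have rN: "r m \<ge> N k" if "m \<ge> k" for m k
  proof -
    have "N k \<le> (\<Sum>i\<le>m. N i)" using that by (intro member_le_sum) auto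
    then show ?thesis by (simp add: r_def)
  qed
  have "\<exists>f. square_integrable f \<and> X (r k) = abs_L2 f" for k
    by (metis L2_cases)
  then obtain F where F: "\<And>k. square_integrable (F k)" "\<And>k. X (r k) = abs_L2 (F k)"
    by metis
  note [measurable] = F(1)[THEN square_integrableD]
  have int: "integrable I0pi (\<lambda>x. (norm (F m x - F n x))\<^sup>2)" for m n
    using square_integrable_diff[OF F(1) F(1)] by (simp add: square_integrable_def)
  have le: "(\<integral>x. (norm (F m x - F n x))\<^sup>2 \<partial>I0pi) \<le> ((1/2)^k)\<^sup>2" if "m \<ge> k" "n \<ge> k" for m n k
  proof -
    have "sqrt (\<integral>x. (norm (F m x - F n x))\<^sup>2 \<partial>I0pi) = dist (X (r m)) (X (r n))"
      by (simp add: dist_norm F abs_L2_diff norm_abs_L2 square_integrable_diff)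
    also have "\<dots> \<le> (1/2)^k" using N[OF rN[OF that(1)] rN[OF that(2)]] by simp
    finally show ?thesis using real_sqrt_le_iff sqrt_le_D by blast
  qed
  let ?d = "\<lambda>k x. norm (F (Suc k) x - F k x)"
  have nn: "(\<integral>\<^sup>+x. ennreal (?d k x) \<partial>I0pi) \<le> ennreal ((pi + 1) * (1/2)^k)" for k
  proof -
    interpret finite_measure I0pi by (rule finite_measure_I0pi)
    have "(\<integral>\<^sup>+x. ennreal (?d k x) \<partial>I0pi) \<le> (\<integral>\<^sup>+x. ennreal ((1/2)^k + 2^k * (?d k x)\<^sup>2) \<partial>I0pi)"
    proof (intro nn_integral_mono ennreal_leI)
      fix x
      define t :: real where "t = (1/2)^k"
      have t: "t > 0" "2^k = 1/t" by (auto simp: t_def power_one_over)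
      have "2 * (?d k x * t) \<le> (?d k x)\<^sup>2 + t\<^sup>2" using sum_squares_bound[of "?d k x" t] by simp
      moreover have "0 \<le> ?d k x * t" using t(1) by simp
      ultimately have "?d k x * t \<le> (?d k x)\<^sup>2 + t\<^sup>2" by linarith
      then show "?d k x \<le> (1/2)^k + 2^k * (?d k x)\<^sup>2"
        unfolding t t_def[symmetric] using t(1) by (simp add: field_simps power2_eq_square)
    qed
    also have "\<dots> = ennreal (\<integral>x. (1/2)^k + 2^k * (?d k x)\<^sup>2 \<partial>I0pi)"
      by (intro nn_integral_eq_integral Bochner_Integration.integrable_add integrable_const
          integrable_mult_right int) auto
    also have "(\<integral>x. (1/2)^k + 2^k * (?d k x)\<^sup>2 \<partial>I0pi)
        = (1/2)^k * pi + 2^k * (\<integral>x. (?d k x)\<^sup>2 \<partial>I0pi)"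
      using int[of "Suc k" k] by (simp add: measure_restrict_space)
    also have "\<dots> \<le> (1/2)^k * pi + 2^k * ((1/2)^k)\<^sup>2"
      by (intro add_left_mono mult_left_mono le) auto
    also have "\<dots> = (pi + 1) * (1/2)^k"
      by (simp add: power2_eq_square power_one_over distrib_right field_simps flip: add_divide_distrib)
    finally show ?thesis by (simp add: ennreal_leI)
  qed
  have "(\<integral>\<^sup>+x. (\<Sum>k. ennreal (?d k x)) \<partial>I0pi) = (\<Sum>k. \<integral>\<^sup>+x. ennreal (?d k x) \<partial>I0pi)"
    by (rule nn_integral_suminf) measurable
  also have "\<dots> \<le> (\<Sum>k. ennreal ((pi + 1) * (1/2)^k))"
    by (intro suminf_le nn) auto
  also have "\<dots> < \<infinity>"
    by (subst suminf_ennreal2) (auto intro!: summable_mult summable_geometric)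
  finally have "AE x in I0pi. (\<Sum>k. ennreal (?d k x)) \<noteq> \<infinity>"
    by (intro nn_integral_noteq_infinite) auto
  then have conv: "AE x in I0pi. convergent (\<lambda>k. F k x)"
  proof eventually_elim
    case (elim x)
    then have "summable (\<lambda>k. ?d k x)"
      by (intro summable_suminf_not_top) auto
    then have "summable (\<lambda>k. F (Suc k) x - F k x)" by (rule summable_norm_cancel)
    then have "convergent (\<lambda>n. F n x - F 0 x)"
      unfolding summable_iff_convergent sum_lessThan_telescope[where f="\<lambda>k. F k x"] .
    then have "convergent (\<lambda>n. (F n x - F 0 x) + F 0 x)"
      by (intro convergent_add convergent_const)
    then show ?case by simp
  qed
  define g where "g x = lim (\<lambda>k. F k x)" for x
  have g[measurable]: "g \<in> borel_measurable I0pi"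
    unfolding g_def by (rule borel_measurable_lim_metric) measurable
  have conv: "AE x in I0pi. (\<lambda>k. F k x) \<longlonglongrightarrow> g x"
    using conv by eventually_elim (simp add: g_def convergent_LIMSEQ_iff)
  have gF: "(\<integral>\<^sup>+x. ennreal ((norm (F n x - g x))\<^sup>2) \<partial>I0pi) \<le> ennreal (((1/2)^n)\<^sup>2)" for n
  proof -
    have "(\<integral>\<^sup>+x. ennreal ((norm (F n x - g x))\<^sup>2) \<partial>I0pi)
        = (\<integral>\<^sup>+x. liminf (\<lambda>m. ennreal ((norm (F n x - F m x))\<^sup>2)) \<partial>I0pi)"
    proof (rule nn_integral_cong_AE, use conv in eventually_elim)
      case (elim x)
      have "(\<lambda>m. ennreal ((norm (F n x - F m x))\<^sup>2)) \<longlonglongrightarrow> ennreal ((norm (F n x - g x))\<^sup>2)"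
        by (intro tendsto_intros elim)
      from lim_imp_Liminf[OF _ this] show ?case by simp
    qed
    also have "\<dots> \<le> liminf (\<lambda>m. \<integral>\<^sup>+x. ennreal ((norm (F n x - F m x))\<^sup>2) \<partial>I0pi)"
      by (rule nn_integral_liminf) measurable
    also have "\<dots> \<le> liminf (\<lambda>m::nat. ennreal (((1/2)^n)\<^sup>2))"
    proof (rule Liminf_mono, rule eventually_sequentiallyI)
      fix m assume "n \<le> m"
      then show "(\<integral>\<^sup>+x. ennreal ((norm (F n x - F m x))\<^sup>2) \<partial>I0pi) \<le> ennreal (((1/2)^n)\<^sup>2)"
        using le[of n n m] int[of n m] by (subst nn_integral_eq_integral) (auto intro: ennreal_leI)
    qed
    also have "\<dots> = ennreal (((1/2)^n)\<^sup>2)" by (simp add: Liminf_const)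
    finally show ?thesis .
  qed
  have sqFg: "square_integrable (\<lambda>x. F n x - g x)" for n
    unfolding square_integrable_def
    by (auto intro!: integrableI_bounded le_less_trans[OF gF])
  have sqg: "square_integrable g"
    using square_integrable_diff[OF F(1) sqFg, of 0 0] by simp
  have "(\<lambda>n. X (r n)) \<longlonglongrightarrow> abs_L2 g"
    unfolding F(2)
  proof (rule abs_L2_limit[OF sqg F(1)])
    have "(\<integral>x. (norm (F n x - g x))\<^sup>2 \<partial>I0pi) \<le> (1/4)^n" for n
    proof -
      have "ennreal (\<integral>x. (norm (F n x - g x))\<^sup>2 \<partial>I0pi)
          = (\<integral>\<^sup>+x. ennreal ((norm (F n x - g x))\<^sup>2) \<partial>I0pi)"
        using sqFg[of n] by (subst nn_integral_eq_integral) (auto simp: square_integrable_def)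
      also note gF
      also have "((1/2)^n)\<^sup>2 = ((1/4)^n :: real)"
        by (simp add: power2_eq_square flip: power_mult_distrib)
      finally show ?thesis by simp
    qed
    then show "(\<lambda>n. \<integral>x. (norm (F n x - g x))\<^sup>2 \<partial>I0pi) \<longlonglongrightarrow> 0"
      by (intro tendsto_sandwich[OF _ _ tendsto_const LIMSEQ_power_zero[of "1/4::real"]])
        (auto intro!: always_eventually integral_nonneg_AE)
  qed
  then have "X \<longlonglongrightarrow> abs_L2 g"
    using Cauchy_converges_subseq[OF X \<open>strict_mono r\<close>] by (simp add: o_def)
  then show "convergent X" by (rule convergentI)
qed

lemma abs_L2_dominated_limit:
  assumes f: "\<And>n. f n \<in> borel_measurable I0pi" and g: "g \<in> borel_measurable I0pi"
    and h: "square_integrable h"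
    and lim: "\<And>x. x \<in> {0<..<pi} \<Longrightarrow> (\<lambda>n. f n x) \<longlonglongrightarrow> g x"
    and bound: "\<And>n x. x \<in> {0<..<pi} \<Longrightarrow> norm (f n x) \<le> norm (h x)"
  shows "(\<lambda>n. abs_L2 (f n)) \<longlonglongrightarrow> abs_L2 g"
proof -
  note [measurable] = f g square_integrableD[OF h]
  have ih: "integrable I0pi (\<lambda>x. (norm (h x))\<^sup>2)" using h by (simp add: square_integrable_def)
  have gh: "norm (g x) \<le> norm (h x)" if "x \<in> {0<..<pi}" for x
    using tendsto_norm[OF lim[OF that]] bound[OF that] by (intro LIMSEQ_le_const2) auto
  have sf: "square_integrable (f n)" for n
    unfolding square_integrable_def
    by (intro conjI Bochner_Integration.integrable_bound[OF ih]) (auto intro!: AE_I2 power_mono bound)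
  have sg: "square_integrable g"
    unfolding square_integrable_def
    by (intro conjI Bochner_Integration.integrable_bound[OF ih]) (auto intro!: AE_I2 power_mono gh)
  have "(\<lambda>n. \<integral>x. (norm (f n x - g x))\<^sup>2 \<partial>I0pi) \<longlonglongrightarrow> (\<integral>x. 0 \<partial>I0pi)"
  proof (rule integral_dominated_convergence[where w="\<lambda>x. 4 * (norm (h x))\<^sup>2"])
    show "AE x in I0pi. (\<lambda>n. (norm (f n x - g x))\<^sup>2) \<longlonglongrightarrow> 0"
    proof (rule AE_I2)
      fix x assume "x \<in> space I0pi"
      then have "(\<lambda>n. (norm (f n x - g x))\<^sup>2) \<longlonglongrightarrow> (norm (g x - g x))\<^sup>2"
        by (intro tendsto_intros lim) auto
      then show "(\<lambda>n. (norm (f n x - g x))\<^sup>2) \<longlonglongrightarrow> 0" by simp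
    qed
    show "AE x in I0pi. norm ((norm (f n x - g x))\<^sup>2) \<le> 4 * (norm (h x))\<^sup>2" for n
    proof (rule AE_I2)
      fix x assume "x \<in> space I0pi"
      then have x: "x \<in> {0<..<pi}" by simp
      have "norm (f n x - g x) \<le> 2 * norm (h x)"
        using norm_triangle_ineq4[of "f n x" "g x"] bound[OF x, of n] gh[OF x] by simp
      then have "(norm (f n x - g x))\<^sup>2 \<le> (2 * norm (h x))\<^sup>2" by (rule power_mono) simp
      then show "norm ((norm (f n x - g x))\<^sup>2) \<le> 4 * (norm (h x))\<^sup>2"
        by (simp add: power_mult_distrib)
    qed
  qed (use ih in auto)
  then show ?thesis by (intro abs_L2_limit sf sg) simp
qed

lemma L2_countable_dense: "\<exists>C :: L2 set. countable C \<and> closure C = UNIV"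
proof -
  obtain B :: "real set set" where B: "countable B" "topological_basis B"
    using ex_countable_basis by auto
  obtain Q :: "complex set" where Q: "countable Q" "\<And>X. open X \<Longrightarrow> X \<noteq> {} \<Longrightarrow> \<exists>q\<in>Q. q \<in> X"
    by (erule countable_dense_setE)
  define V where "V = Union ` {F. finite F \<and> F \<subseteq> insert {} B}"
  define ic :: "complex \<Rightarrow> real set \<Rightarrow> L2" where "ic c A = abs_L2 (\<lambda>x. c * indicator A x)" for c A
  define C where "C = (\<lambda>xs. sum_list (map (\<lambda>(q, A). ic q A) xs)) ` lists (Q \<times> V)"
  have "countable C"
    unfolding C_def V_def using B(1) Q(1)
    by (intro countable_image countable_lists countable_SIGMA countable_Collect_finite_subset
        countable_insert)
  define K where "K = closure C"
  have open_V: "open A" if "A \<in> V" for A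
    using that topological_basis_open[OF B(2)] by (auto simp: V_def)
  have sq: "square_integrable (\<lambda>x. c * indicator A x)" if "A \<in> sets lebesgue" for A c
    by (rule square_integrable_bounded[where B="norm c"])
      (use that in \<open>auto intro!: measurable_restrict_space1 simp: norm_mult split: split_indicator\<close>)
  have meas_open: "A \<in> sets lebesgue" if "open A" for A :: "real set"
    using that by auto
  have K_lim: "l \<in> K" if "x \<longlonglongrightarrow> l" "\<And>n. x n \<in> K" for x :: "nat \<Rightarrow> L2" and l
    using closed_sequentially[OF closed_closure that(2)[unfolded K_def] that(1)] by (simp add: K_def)
  have C_add: "x + y \<in> C" if xy: "x \<in> C" "y \<in> C" for x y
  proof -
    obtain xs ys where "xs \<in> lists (Q \<times> V)" "ys \<in> lists (Q \<times> V)"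
        "x = sum_list (map (\<lambda>(q, A). ic q A) xs)" "y = sum_list (map (\<lambda>(q, A). ic q A) ys)"
      using xy unfolding C_def by blast
    then show ?thesis unfolding C_def by (intro image_eqI[of _ _ "xs @ ys"]) auto
  qed
  have K_add: "x + y \<in> K" if xy: "x \<in> K" "y \<in> K" for x y
  proof -
    obtain xs ys where "\<And>n. xs n \<in> C" "xs \<longlonglongrightarrow> x" "\<And>n. ys n \<in> C" "ys \<longlonglongrightarrow> y"
      using xy unfolding K_def closure_sequential by metis
    then have "(\<lambda>n. xs n + ys n) \<longlonglongrightarrow> x + y" "\<And>n. xs n + ys n \<in> K"
      using C_add closure_subset[of C] by (auto intro: tendsto_add simp: K_def)
    then show ?thesis by (rule K_lim)
  qed
  have K_0: "0 \<in> K"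
    using closure_subset[of C] unfolding K_def C_def by (force intro: image_eqI[of _ _ "[]"])
  have K_V: "ic c A \<in> K" if "A \<in> V" for c A
  proof -
    have "\<exists>q\<in>Q. q \<in> ball c (1 / real (Suc n))" for n
      by (intro Q(2)) auto
    then obtain q where q: "\<And>n. q n \<in> Q" "\<And>n. dist c (q n) < 1 / real (Suc n)"
      unfolding mem_ball by metis
    have qc: "q \<longlonglongrightarrow> c"
    proof (rule metric_LIMSEQ_I)
      fix e :: real assume "0 < e"
      then obtain N where N: "1 / real (Suc N) < e" using nat_approx_posE by blast
      have "dist (q n) c < e" if "n \<ge> N" for n
      proof -
        have "1 / real (Suc n) \<le> 1 / real (Suc N)" using that by (simp add: frac_le)
        then show ?thesis using q(2)[of n] N by (simp add: dist_commute)
      qed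
      then show "\<exists>N. \<forall>n\<ge>N. dist (q n) c < e" by blast
    qed
    have "ic (q n) A \<in> C" for n
      using q(1)[of n] that unfolding C_def by (intro image_eqI[of _ _ "[(q n, A)]"]) auto
    then have mem: "ic (q n) A \<in> K" for n using closure_subset[of C] by (auto simp: K_def)
    have "(\<lambda>n. ic (q n) A) \<longlonglongrightarrow> ic c A"
      unfolding ic_def
    proof (rule abs_L2_dominated_limit[where h="\<lambda>x. of_real (norm c + 1)"])
      show "square_integrable (\<lambda>x. of_real (norm c + 1))"
        by (rule square_integrable_bounded[where B="norm c + 1"]) auto
      show "(\<lambda>n. q n * indicator A x) \<longlonglongrightarrow> c * indicator A x" for x
        by (intro tendsto_intros qc)
      show "norm (q n * indicator A x) \<le> norm (of_real (norm c + 1) :: complex)" for n x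
      proof -
        have "norm (q n) \<le> norm c + dist c (q n)"
          by (metis dist_norm dist_commute norm_triangle_sub)
        also have "\<dots> \<le> norm c + 1"
          using less_le_trans[OF q(2)[of n], of 1] by simp
        finally show ?thesis by (auto simp: norm_mult split: split_indicator)
      qed
    qed (use sq[OF meas_open[OF open_V[OF that]]] square_integrableD in auto)
    then show ?thesis by (rule K_lim[OF _ mem])
  qed
  have K_open: "ic c U \<in> K" if U: "open U" for c U
  proof -
    obtain B' where B': "B' \<subseteq> B" "\<Union>B' = U"
      using B(2) U unfolding topological_basis_def by blast
    have "countable (insert {} B')" using B' B(1) countable_subset by auto
    then obtain b :: "nat \<Rightarrow> real set" where b: "insert {} B' = range b"
      by (metis insert_not_empty uncountable_def)
    define W where "W n = \<Union>(b ` {..<n})" for n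
    have WV: "W n \<in> V" for n
      unfolding V_def W_def using B' b by (intro imageI) blast
    have "(\<lambda>n. ic c (W n)) \<longlonglongrightarrow> ic c U"
      unfolding ic_def
    proof (rule abs_L2_dominated_limit[where h="\<lambda>x. c"])
      show "square_integrable (\<lambda>x. c)"
        by (rule square_integrable_bounded[where B="norm c"]) auto
      show "(\<lambda>n. c * indicator (W n) x) \<longlonglongrightarrow> c * indicator U x" for x
      proof (intro tendsto_intros)
        have "incseq W" by (fastforce simp: W_def incseq_def)
        then have "(\<lambda>n. indicator (W n) x :: complex) \<longlonglongrightarrow> indicator (\<Union>n. W n) x"
          by (rule LIMSEQ_indicator_incseq)
        moreover have "(\<Union>n. W n) = U"
        proof -
          have "(\<Union>n. W n) = \<Union>(range b)" unfolding W_def by blast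
          also have "\<dots> = U" unfolding b[symmetric] using B' by simp
          finally show ?thesis .
        qed
        ultimately show "(\<lambda>n. indicator (W n) x :: complex) \<longlonglongrightarrow> indicator U x" by simp
      qed
      show "norm (c * indicator (W n) x) \<le> norm c" for n x
        by (auto simp: norm_mult split: split_indicator)
    qed (use sq[OF meas_open[OF open_V[OF WV]]] sq[OF meas_open[OF U]]
          square_integrableD in auto)
    then show ?thesis by (rule K_lim[OF _ K_V[OF WV]])
  qed
  have K_meas: "ic c A \<in> K" if A: "A \<in> sets lebesgue" for c A
  proof -
    have "\<exists>T. open T \<and> A \<subseteq> T \<and> T - A \<in> lmeasurable \<and> measure lebesgue (T - A) < 1 / real (Suc n)" for n
    proof -
      obtain T where T: "open T" "A \<subseteq> T" "T - A \<in> lmeasurable"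
          "emeasure lebesgue (T - A) < ennreal (1 / real (Suc n))"
        using sets_lebesgue_outer_open[OF A, of "1 / real (Suc n)"] by auto
      then show ?thesis by (auto simp: emeasure_eq_measure2 ennreal_less_iff intro!: exI[of _ T])
    qed
    then obtain T where T: "\<And>n. open (T n)" "\<And>n. A \<subseteq> T n" "\<And>n. T n - A \<in> lmeasurable"
        "\<And>n. measure lebesgue (T n - A) < 1 / real (Suc n)"
      by metis
    have "(\<lambda>n. ic c (T n)) \<longlonglongrightarrow> ic c A"
      unfolding ic_def
    proof (rule abs_L2_limit)
      have "(\<integral>x. (norm (c * indicator (T n) x - c * indicator A x))\<^sup>2 \<partial>I0pi)
          \<le> (norm c)\<^sup>2 * (1 / real (Suc n))" for n
      proof -
        have "(\<integral>x. (norm (c * indicator (T n) x - c * indicator A x))\<^sup>2 \<partial>I0pi)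
            = (\<integral>x. (norm c)\<^sup>2 * indicator (T n - A) x \<partial>I0pi)"
          using T(2)[of n]
          by (intro Bochner_Integration.integral_cong) (auto split: split_indicator)
        also have "\<dots> = (norm c)\<^sup>2 * (\<integral>x. indicator (T n - A) x \<partial>I0pi)"
          by simp
        also have "(\<integral>x. indicator (T n - A) x \<partial>I0pi) = measure lebesgue ((T n - A) \<inter> {0<..<pi})"
          by (simp add: measure_restrict_space)
        also have "\<dots> \<le> measure lebesgue (T n - A)"
          using T(3) by (intro measure_mono_fmeasurable) auto
        also have "\<dots> \<le> 1 / real (Suc n)" using T(4)[of n] by simp
        finally show ?thesis by (simp add: mult_left_mono)
      qed
      then have "\<forall>n. norm (\<integral>x. (norm (c * indicator (T n) x - c * indicator A x))\<^sup>2 \<partial>I0pi)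
          \<le> (norm c)\<^sup>2 * (1 / real (Suc n))"
        unfolding real_norm_def by (subst abs_of_nonneg) (intro integral_nonneg_AE AE_I2 zero_le_power2, blast)
      moreover have "(\<lambda>n. (norm c)\<^sup>2 * (1 / real (Suc n))) \<longlonglongrightarrow> 0"
        using tendsto_mult_right_zero[OF LIMSEQ_Suc[OF lim_1_over_n]] by simp
      ultimately show "(\<lambda>n. \<integral>x. (norm (c * indicator (T n) x - c * indicator A x))\<^sup>2 \<partial>I0pi)
          \<longlonglongrightarrow> 0"
        by (rule Lim_null_comparison[OF always_eventually])
    qed (use sq A meas_open T(1) in auto)
    then show ?thesis by (rule K_lim[OF _ K_open[OF T(1)]])
  qed
  have K_sum: "square_integrable (\<lambda>x. \<Sum>y\<in>Y. f y * indicator (D y) x) \<and>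
      abs_L2 (\<lambda>x. \<Sum>y\<in>Y. f y * indicator (D y) x) \<in> K"
    if "finite Y" "\<And>y. D y \<in> sets lebesgue" for Y :: "complex set" and D f
    using that(1)
  proof induction
    case empty
    then show ?case using K_0 by (simp add: square_integrable_zero zero_L2_def)
  next
    case (insert y Y)
    let ?g = "\<lambda>x. \<Sum>y\<in>Y. f y * indicator (D y) x" and ?h = "\<lambda>x. f y * indicator (D y) x"
    have h: "square_integrable ?h" by (rule sq[OF that(2)])
    have "abs_L2 ?h + abs_L2 ?g \<in> K"
      using K_add[OF K_meas[OF that(2)[of y], of "f y"]] insert.IH unfolding ic_def by blast
    moreover have "abs_L2 ?h + abs_L2 ?g = abs_L2 (\<lambda>x. ?h x + ?g x)"
      by (rule abs_L2_add[OF h conjunct1[OF insert.IH]])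
    ultimately show ?case
      using square_integrable_add[OF h conjunct1[OF insert.IH]]
      unfolding sum.insert[OF insert.hyps] by metis
  qed
  have "F \<in> K" for F
  proof (cases F rule: L2_cases)
    case (1 f)
    note [measurable] = square_integrableD[OF 1(1)]
    obtain s where s: "\<And>i. simple_function I0pi (s i)"
        "\<And>x. x \<in> space I0pi \<Longrightarrow> (\<lambda>i. s i x) \<longlonglongrightarrow> f x"
        "\<And>i x. x \<in> space I0pi \<Longrightarrow> norm (s i x) \<le> 2 * norm (f x)"
      using borel_measurable_implies_sequence_metric[OF square_integrableD[OF 1(1)], of 0]
      unfolding dist_norm diff_0_right by metis
    define D where "D i y = s i -` {y} \<inter> space I0pi" for i y
    define s' where "s' i x = (\<Sum>y\<in>s i ` space I0pi. y * indicator (D i y) x)" for i x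
    have fin: "finite (s i ` space I0pi)" for i using simple_functionD(1)[OF s(1)] .
    have D: "D i y \<in> sets lebesgue" for i y
      using simple_functionD(2)[OF s(1)[of i], of "{y}"] by (auto simp: D_def sets_restrict_space_iff)
    have s': "s' i x = s i x" if "x \<in> space I0pi" for i x
    proof -
      have "s' i x = (\<Sum>y\<in>s i ` space I0pi. if y = s i x then y else 0)"
        unfolding s'_def using that by (intro sum.cong) (auto simp: D_def split: split_indicator)
      also have "\<dots> = s i x" using fin that by (simp add: sum.delta)
      finally show ?thesis .
    qed
    have K: "square_integrable (s' i)" "abs_L2 (s' i) \<in> K" for i
      using K_sum[OF fin[of i] D[of i], of "\<lambda>y. y"] unfolding s'_def by auto
    have "(\<lambda>i. abs_L2 (s' i)) \<longlonglongrightarrow> abs_L2 f"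
    proof (rule abs_L2_dominated_limit[where h="\<lambda>x. 2 * f x"])
      show "square_integrable (\<lambda>x. 2 * f x)" by (rule square_integrable_cmult[OF 1(1)])
      show "(\<lambda>n. s' n x) \<longlonglongrightarrow> f x" if "x \<in> {0<..<pi}" for x
        using s(2)[of x] that by (simp add: s')
      show "norm (s' n x) \<le> norm (2 * f x)" if "x \<in> {0<..<pi}" for n x
        using s(3)[of x n] that by (simp add: s' norm_mult)
    qed (use K(1) square_integrableD in auto)
    then show ?thesis unfolding 1(2) by (rule K_lim[OF _ K(2)])
  qed
  then have "closure C = UNIV" unfolding K_def by blast
  with \<open>countable C\<close> show ?thesis by blast
qed

instance L2 :: second_countable_topology
proof
  obtain C :: "L2 set" where "countable C" "closure C = UNIV"
    using L2_countable_dense by blast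
  then show "\<exists>B::L2 set set. countable B \<and> open = generate_topology B"
    by (rule dense_imp_second_countable)
qed

text \<open>The mean-zero subspace \<open>L\<^sup>2\<^sub>m(0, pi)\<close>.\<close>

lift_definition L2_integral :: "L2 \<Rightarrow> complex" is "\<lambda>f. \<integral>x. f x \<partial>I0pi"
  by (rule integral_cong_AE) (auto simp: L2_rel_def)

definition L2m :: "L2 set" where
  "L2m = {f. L2_integral f = 0}"


section \<open>Sobolev spaces on (0, pi)\<close>

text \<open>Following Brezis (Functional Analysis, Sobolev Spaces and Partial Differential Equations,
  Chapter 8), test functions are the continuously differentiable functions with compact support
  in the open interval; smooth test functions yield the same spaces.\<close>

definition test_function :: "(real \<Rightarrow> complex) \<Rightarrow> bool" where
  "test_function \<phi> \<longleftrightarrow> \<phi> C1_differentiable_on UNIV \<and>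
     (\<exists>K. compact K \<and> K \<subseteq> {0<..<pi} \<and> (\<forall>x. x \<notin> K \<longrightarrow> \<phi> x = 0))"

lemma test_function_measurable:
  assumes "test_function \<phi>"
  shows "\<phi> \<in> borel_measurable I0pi"
    and "(\<lambda>x. vector_derivative \<phi> (at x)) \<in> borel_measurable I0pi"
proof -
  have C1: "\<phi> C1_differentiable_on UNIV"
    using assms by (simp add: test_function_def)
  then have "continuous_on UNIV (\<lambda>x. vector_derivative \<phi> (at x))"
    by (simp add: C1_differentiable_on_eq)
  then have "(\<lambda>x. vector_derivative \<phi> (at x)) \<in> borel_measurable borel"
    by (rule borel_measurable_continuous_onI)
  then show "(\<lambda>x. vector_derivative \<phi> (at x)) \<in> borel_measurable I0pi"
    by (intro measurable_restrict_space1 measurable_completion) simp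
  have "\<phi> \<in> borel_measurable borel"
    using C1_differentiable_imp_continuous_on[OF C1] by (rule borel_measurable_continuous_onI)
  then show "\<phi> \<in> borel_measurable I0pi"
    by (intro measurable_restrict_space1 measurable_completion) simp
qed

lift_definition has_weak_deriv :: "L2 \<Rightarrow> L2 \<Rightarrow> bool" is
  "\<lambda>f g. \<forall>\<phi>. test_function \<phi> \<longrightarrow>
     (\<integral>x. f x * vector_derivative \<phi> (at x) \<partial>I0pi) = - (\<integral>x. g x * \<phi> x \<partial>I0pi)"
proof -
  fix f f' g g'
  assume ff: "L2_rel f f'" and gg: "L2_rel g g'"
  have cong: "(\<integral>x. h x * k x \<partial>I0pi) = (\<integral>x. h' x * k x \<partial>I0pi)"
    if "L2_rel h h'" "k \<in> borel_measurable I0pi" for h h' k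
  proof (rule integral_cong_AE)
    show "AE x in I0pi. h x * k x = h' x * k x"
      using that(1) by (auto simp: L2_rel_def)
  qed (use that in \<open>auto simp: L2_rel_def square_integrable_def\<close>)
  have "(\<integral>x. f x * vector_derivative \<phi> (at x) \<partial>I0pi) = (\<integral>x. f' x * vector_derivative \<phi> (at x) \<partial>I0pi)"
       "(\<integral>x. g x * \<phi> x \<partial>I0pi) = (\<integral>x. g' x * \<phi> x \<partial>I0pi)"
    if "test_function \<phi>" for \<phi>
    using cong[OF ff test_function_measurable(2)[OF that]]
      cong[OF gg test_function_measurable(1)[OF that]] by blast+
  then show "(\<forall>\<phi>. test_function \<phi> \<longrightarrow>
        (\<integral>x. f x * vector_derivative \<phi> (at x) \<partial>I0pi) = - (\<integral>x. g x * \<phi> x \<partial>I0pi)) \<longleftrightarrow>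
      (\<forall>\<phi>. test_function \<phi> \<longrightarrow>
        (\<integral>x. f' x * vector_derivative \<phi> (at x) \<partial>I0pi) = - (\<integral>x. g' x * \<phi> x \<partial>I0pi))"
    by simp
qed

definition H1 :: "L2 set" where
  "H1 = {f. \<exists>g. has_weak_deriv f g}"

definition weak_deriv :: "L2 \<Rightarrow> L2" where
  "weak_deriv f = (THE g. has_weak_deriv f g)"

text \<open>The closure of the test functions in the norm of \<open>H1\<close>.\<close>
definition H10 :: "L2 set" where
  "H10 = {u \<in> H1. \<exists>\<phi>. (\<forall>n. test_function (\<phi> n)) \<and>
     (\<lambda>n. abs_L2 (\<phi> n)) \<longlonglongrightarrow> u \<and>
     (\<lambda>n. abs_L2 (\<lambda>x. vector_derivative (\<phi> n) (at x))) \<longlonglongrightarrow> weak_deriv u}"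


section \<open>Strongly continuous semigroups and mild solutions\<close>

definition C0_semigroup :: "(real \<Rightarrow> 'a::banach \<Rightarrow> 'a) \<Rightarrow> bool" where
  "C0_semigroup S \<longleftrightarrow>
     (\<forall>t\<ge>0. bounded_linear (S t)) \<and>
     (\<forall>z. S 0 z = z) \<and>
     (\<forall>s\<ge>0. \<forall>t\<ge>0. \<forall>z. S (s + t) z = S s (S t z)) \<and>
     (\<forall>z. ((\<lambda>t. S t z) \<longlongrightarrow> z) (at_right 0))"

text \<open>The operator \<open>A\<close> with domain \<open>D\<close> is the infinitesimal generator of \<open>S\<close>;
  values of \<open>A\<close> outside \<open>D\<close> are irrelevant.\<close>
definition is_generator :: "'a set \<Rightarrow> ('a \<Rightarrow> 'a) \<Rightarrow> (real \<Rightarrow> 'a::banach \<Rightarrow> 'a) \<Rightarrow> bool" where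
  "is_generator D A S \<longleftrightarrow>
     D = {z. \<exists>y. ((\<lambda>h. (S h z - z) /\<^sub>R h) \<longlongrightarrow> y) (at_right 0)} \<and>
     (\<forall>z\<in>D. ((\<lambda>h. (S h z - z) /\<^sub>R h) \<longlongrightarrow> A z) (at_right 0))"

text \<open>Variation of constants for \<open>z' = A z + F\<close>, \<open>z 0 = z0\<close> on \<open>[0, T]\<close>, as a Bochner integral.
  The semigroup is determined by its generator, so that the quantified \<open>S\<close> is the only
  possible one and \<open>z\<close> is unique on \<open>[0, T]\<close>. Scalars are real throughout: for a
  complex-linear generator the semigroup is automatically complex-linear.\<close>
definition mild_solution ::
  "'a set \<Rightarrow> ('a \<Rightarrow> 'a) \<Rightarrow> real \<Rightarrow> 'a \<Rightarrow> (real \<Rightarrow> 'a) \<Rightarrow>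
    (real \<Rightarrow> 'a::{banach, second_countable_topology}) \<Rightarrow> bool" where
  "mild_solution D A T z0 F z \<longleftrightarrow>
     (\<exists>S. C0_semigroup S \<and> is_generator D A S \<and>
       (\<forall>t\<in>{0..T}.
          set_integrable lebesgue {0..t} (\<lambda>s. S (t - s) (F s)) \<and>
          z t = S t z0 + (LINT s:{0..t}|lebesgue. S (t - s) (F s))))"

text \<open>\<open>L\<^sup>2(0, T; L\<^sup>2(0, pi))\<close>; strong and Borel measurability agree since \<open>L2\<close> is separable.\<close>
definition L2_control :: "real \<Rightarrow> (real \<Rightarrow> L2) set" where
  "L2_control T = {f. f \<in> borel_measurable (lebesgue_on {0<..<T}) \<and>
     integrable (lebesgue_on {0<..<T}) (\<lambda>t. (norm (f t))\<^sup>2)}"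


section \<open>The operator of the linearized system\<close>

definition flux :: "real \<Rightarrow> real \<Rightarrow> real \<Rightarrow> L2 \<Rightarrow> L2 \<Rightarrow> L2" where
  "flux a \<gamma> \<rho>s \<rho> S = - ((a * \<gamma> * \<rho>s powr (\<gamma> - 2)) *\<^sub>R \<rho>) + (1 / \<rho>s) *\<^sub>R S"

definition op_dom :: "real \<Rightarrow> real \<Rightarrow> real \<Rightarrow> (L2 \<times> L2 \<times> L2) set" where
  "op_dom a \<gamma> \<rho>s = {(\<rho>, u, S). u \<in> H10 \<and> flux a \<gamma> \<rho>s \<rho> S \<in> H1}"

text \<open>On the domain \<open>\<rho>\<close> and \<open>S\<close> need not be weakly differentiable separately, hence the second
  component differentiates their combination.\<close>
definition op_A ::
  "real \<Rightarrow> real \<Rightarrow> real \<Rightarrow> real \<Rightarrow> real \<Rightarrow> L2 \<times> L2 \<times> L2 \<Rightarrow> L2 \<times> L2 \<times> L2" where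
  "op_A a \<gamma> \<rho>s \<mu> \<kappa> = (\<lambda>(\<rho>, u, S).
     (- (\<rho>s *\<^sub>R weak_deriv u),
      weak_deriv (flux a \<gamma> \<rho>s \<rho> S),
      (\<mu> / \<kappa>) *\<^sub>R weak_deriv u - (1 / \<kappa>) *\<^sub>R S))"

end

theory Submission
  imports Defs
begin

text \<open>
  In an energy norm the operator is skew-adjoint up to the dissipative term \<open>-S/\<kappa>\<close>; its resolvent is
  obtained by orthogonal projection onto the (rescaled) graph of the derivative on \<open>H\<^sup>1\<^sub>0\<close>, and the Yosida
  approximations yield the semigroup.

  For the control, let \<open>(\<rho>, u, S)\<close> be the free trajectory and \<open>\<eta>\<close> a cut-off in time that equals 1 at 0 and 0
  at \<open>T\<close>, both to second order. The stress \<open>\<eta> S\<close> forces the velocity \<open>\<eta> u + (\<kappa>/\<mu>) \<eta>' V S\<close>, where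
  \<open>V\<close> is integration from 0; it satisfies the boundary conditions because \<open>S\<close> has mean zero. The velocity equation
  then determines the density up to a constant, by one more integration, and the density equation
  is solved by taking its defect as the control. The defect depends boundedly on the free trajectory
  because the derivatives of \<open>u\<close> and of the flux in it cancel or are integrated. Initial data outside the
  domain are reached by density.
\<close>

section \<open>The Banach algebra of bounded operators\<close>

text \<open>The control comes from the ansatz
  \<open>w = \<eta> x + \<eta>' N1 x + \<eta>'' N2 x\<close> for a free trajectory \<open>x\<close>,
  with bounded operators \<open>N1\<close> and \<open>N2\<close>. Then \<open>w' - A w\<close> is a
  combination of \<open>\<eta>'\<close>, \<open>\<eta>''\<close> and \<open>\<eta>'''\<close> with
  the coefficients \<open>x - A N1 x + N1 A x\<close>, \<open>N1 x - A N2 x + N2 A x\<close> and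
  \<open>N2 x\<close>. Only the density equation is controlled, so the velocity and stress
  components of all three must vanish. Solved from the stress component upwards, these requirements
  dictate \<open>N1\<close> and \<open>N2\<close>; the chain stops after two corrections because
  \<open>N2 x\<close> has nothing but a density component. The obstacle is regularity: on the domain
  neither \<rho> nor the stress need be differentiable by itself, and a mild trajectory need not be
  differentiable at all. Hence the coefficients must be rewritten as operators defined on the whole
  space, and the equation for \<open>w\<close> is verified in integrated form. The mean of the
  stress is out of reach of the control; it stays zero because the mean of the free stress decays
  like \<open>exp (- t / \<kappa>)\<close> from its initial value.\<close>

lemma not_open_singleton_normed:
  fixes x v :: "'a::real_normed_vector"
  assumes "v \<noteq> 0"
  shows "\<not> open {x}"
proof
  assume "open {x}"
  then obtain e where e: "e > 0" "ball x e \<subseteq> {x}" by (meson openE insertI1)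
  define y where "y = x + (e / (2 * norm v)) *\<^sub>R v"
  have "y \<in> ball x e" using e assms by (simp add: y_def dist_norm)
  moreover have "y \<noteq> x" using e assms by (simp add: y_def)
  ultimately show False using e by blast
qed

text \<open>The sort \<open>perfect_space\<close> rules out the zero space, on which the operator
  algebra would have 1 = 0. The state space is a product of copies of \<open>L2\<close>, so the
  property has to pass to products: an isolated point of the product would have an isolated first
  coordinate.\<close>

instance prod :: (perfect_space, topological_space) perfect_space
proof
  fix x :: "'a \<times> 'b"
  show "\<not> open {x}"
  proof
    assume "open {x}"
    obtain A B where "open A" "open B" "x \<in> A \<times> B" "A \<times> B \<subseteq> {x}"
      by (rule open_prod_elim[OF \<open>open {x}\<close> singletonI])
    then have "A = {fst x}" by auto
    then show False using \<open>open A\<close> not_open_singleton by metis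
  qed
qed

text \<open>Domain and codomain are identified, so that composition becomes a multiplication on a
  single type; this makes \<open>exp\<close> and its power series calculus available for
  operators.\<close>

typedef (overloaded) 'a endo = "UNIV :: ('a::real_normed_vector \<Rightarrow>\<^sub>L 'a) set"
  morphisms blinfun_of_endo Endo by simp

setup_lifting type_definition_endo

instantiation endo :: ("{banach, perfect_space}") real_normed_algebra_1
begin

lift_definition zero_endo :: "'a endo" is 0 .
lift_definition one_endo :: "'a endo" is id_blinfun .
lift_definition plus_endo :: "'a endo \<Rightarrow> 'a endo \<Rightarrow> 'a endo" is "(+)" .
lift_definition minus_endo :: "'a endo \<Rightarrow> 'a endo \<Rightarrow> 'a endo" is "(-)" .
lift_definition uminus_endo :: "'a endo \<Rightarrow> 'a endo" is uminus .
lift_definition times_endo :: "'a endo \<Rightarrow> 'a endo \<Rightarrow> 'a endo" is "(o\<^sub>L)" .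
lift_definition scaleR_endo :: "real \<Rightarrow> 'a endo \<Rightarrow> 'a endo" is "(*\<^sub>R)" .
lift_definition norm_endo :: "'a endo \<Rightarrow> real" is norm .
definition dist_endo :: "'a endo \<Rightarrow> 'a endo \<Rightarrow> real" where "dist_endo x y = norm (x - y)"
definition sgn_endo :: "'a endo \<Rightarrow> 'a endo" where "sgn_endo x = inverse (norm x) *\<^sub>R x"
definition uniformity_endo :: "('a endo \<times> 'a endo) filter" where
  "uniformity_endo = (INF e\<in>{0<..}. principal {(x, y). dist x y < e})"
definition open_endo :: "'a endo set \<Rightarrow> bool" where
  "open_endo U \<longleftrightarrow> (\<forall>x\<in>U. eventually (\<lambda>(x', y). x' = x \<longrightarrow> y \<in> U) uniformity)"

instance
proof
  fix x y z :: "'a endo" and a b :: real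
  show "(x * y) * z = x * (y * z)" by transfer (rule blinfun_eqI, simp)
  show "(x + y) * z = x * z + y * z" by transfer (rule blinfun_eqI, simp add: blinfun.bilinear_simps)
  show "x * (y + z) = x * y + x * z" by transfer (rule blinfun_eqI, simp add: blinfun.bilinear_simps)
  show "(a *\<^sub>R x) * y = a *\<^sub>R (x * y)" by transfer (rule blinfun_eqI, simp add: blinfun.bilinear_simps)
  show "x * (a *\<^sub>R y) = a *\<^sub>R (x * y)" by transfer (rule blinfun_eqI, simp add: blinfun.bilinear_simps)
  show "1 * x = x" by transfer (rule blinfun_eqI, simp)
  show "x * 1 = x" by transfer (rule blinfun_eqI, simp)
  show "(0::'a endo) \<noteq> 1"
    by transfer (metis norm_blinfun_id norm_zero zero_neq_one)
  show "norm (x + y) \<le> norm x + norm y" by transfer (rule norm_triangle_ineq)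
  show "norm (a *\<^sub>R x) = \<bar>a\<bar> * norm x" by transfer simp
  show "norm x = 0 \<longleftrightarrow> x = 0" by transfer simp
  show "norm (x * y) \<le> norm x * norm y" by transfer (rule norm_blinfun_compose)
  show "norm (1::'a endo) = 1" by transfer simp
  show "x + y + z = x + (y + z)" "x + y = y + x" "0 + x = x" "- x + x = 0" "x - y = x + - y"
       "a *\<^sub>R (x + y) = a *\<^sub>R x + a *\<^sub>R y" "(a + b) *\<^sub>R x = a *\<^sub>R x + b *\<^sub>R x"
       "a *\<^sub>R b *\<^sub>R x = (a * b) *\<^sub>R x" "1 *\<^sub>R x = x"
    by (transfer, simp add: algebra_simps; fail)+
qed (simp_all add: dist_endo_def sgn_endo_def uniformity_endo_def open_endo_def)

end

instance endo :: ("{banach, perfect_space}") banach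
proof
  fix X :: "nat \<Rightarrow> 'a endo" assume X: "Cauchy X"
  have dist: "dist (Endo f) (Endo g) = dist f g" for f g :: "'a \<Rightarrow>\<^sub>L 'a"
    by (simp add: dist_norm norm_endo.abs_eq minus_endo.abs_eq)
  define Y where "Y n = blinfun_of_endo (X n)" for n
  have XY: "X = (\<lambda>n. Endo (Y n))" by (simp add: Y_def blinfun_of_endo_inverse)
  have "Cauchy Y" using X by (simp add: XY Cauchy_def dist)
  then obtain L where "Y \<longlonglongrightarrow> L" by (meson Cauchy_convergent convergent_def)
  then have "X \<longlonglongrightarrow> Endo L" by (simp add: XY lim_sequentially dist)
  then show "convergent X" by (rule convergentI)
qed

lift_definition endo_apply :: "'a::{banach, perfect_space} endo \<Rightarrow> 'a \<Rightarrow> 'a" is blinfun_apply .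

lemma endo_apply_simps [simp]:
  "endo_apply 1 x = x" "endo_apply (f * g) x = endo_apply f (endo_apply g x)"
  "endo_apply (f + g) x = endo_apply f x + endo_apply g x"
  "endo_apply (f - g) x = endo_apply f x - endo_apply g x"
  "endo_apply (r *\<^sub>R f) x = r *\<^sub>R endo_apply f x"
  by (transfer, simp add: blinfun.bilinear_simps)+

lemma bounded_bilinear_endo_apply: "bounded_bilinear endo_apply"
proof
  show "\<exists>K. \<forall>f x. norm (endo_apply f x) \<le> norm f * norm x * K"
    by (rule exI[of _ 1], transfer) (simp add: norm_blinfun)
qed (transfer, simp add: blinfun.bilinear_simps)+

lemma norm_endo_apply: "norm (endo_apply f x) \<le> norm f * norm x"
  by transfer (rule norm_blinfun)

lemma endo_eqI: "(\<And>x. endo_apply f x = endo_apply g x) \<Longrightarrow> f = g"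
  by transfer (rule blinfun_eqI)

lemma norm_endo_bound: "0 \<le> b \<Longrightarrow> (\<And>x. norm (endo_apply f x) \<le> b * norm x) \<Longrightarrow> norm f \<le> b"
  by transfer (rule norm_blinfun_bound)

lemma endo_apply_power: "endo_apply (f ^ n) x = (endo_apply f ^^ n) x"
  by (induction n arbitrary: x) auto

lemma endo_of_bounded_linear:
  assumes "bounded_linear f"
  obtains F where "endo_apply F = f"
  using assms by (metis Endo_inverse UNIV_I bounded_linear_Blinfun_apply endo_apply.rep_eq)

section \<open>Exponentials of bounded operators\<close>

lemma exp_commute:
  fixes x y :: "'a::{real_normed_algebra_1, banach}"
  assumes "x * y = y * x"
  shows "exp x * y = y * exp x"
proof -
  have "x ^ n * y = y * x ^ n" for n using assms power_commuting_commutes by metis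
  then show ?thesis
    by (simp add: exp_def suminf_mult[symmetric] suminf_mult2 summable_exp_generic)
qed

text \<open>The constant M is charged once per term of the series, not once per factor of the power.
  Using the bound on \<open>norm x\<close> alone would give \<open>exp (M * r)\<close>, which is too
  large for the Yosida approximations when M exceeds 1.\<close>

lemma norm_exp_power_bounded:
  fixes x :: "'a::{real_normed_algebra_1, banach}"
  assumes "\<And>n. norm (x ^ n) \<le> M * r ^ n"
  shows "norm (exp x) \<le> M * exp r"
proof -
  have s: "summable (\<lambda>n. M * (r ^ n /\<^sub>R fact n))"
    by (intro summable_mult summable_exp_generic)
  have "norm (exp x) \<le> (\<Sum>n. M * (r ^ n /\<^sub>R fact n))"
    unfolding exp_def
  proof (rule norm_suminf_le[OF _ s])
    fix n
    show "norm (x ^ n /\<^sub>R fact n) \<le> M * (r ^ n /\<^sub>R fact n)"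
      using mult_left_mono[OF assms[of n], of "inverse (fact n)"] by (simp add: mult_ac)
  qed
  also have "\<dots> = M * exp r"
    unfolding exp_def by (intro suminf_mult summable_exp_generic)
  finally show ?thesis .
qed

text \<open>The two exponentials are joined by the path \<open>exp ((t - s) Y) exp (s X)\<close>,
  whose derivative is the path times \<open>X - Y\<close>; the mean value inequality does the rest.
  The difference enters only through its action on x, which matters because Yosida approximations
  converge pointwise on the domain while their norms may grow.\<close>

lemma exp_endo_diff_bound:
  fixes X Y :: "'a::{banach, perfect_space} endo"
  assumes comm: "X * Y = Y * X" and "0 \<le> t" "0 \<le> M"
    and X: "\<And>s. 0 \<le> s \<Longrightarrow> norm (exp (s *\<^sub>R X)) \<le> M"
    and Y: "\<And>s. 0 \<le> s \<Longrightarrow> norm (exp (s *\<^sub>R Y)) \<le> M"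
  shows "norm (endo_apply (exp (t *\<^sub>R X)) x - endo_apply (exp (t *\<^sub>R Y)) x)
    \<le> M\<^sup>2 * norm (endo_apply X x - endo_apply Y x) * t"
proof -
  interpret app: bounded_bilinear "endo_apply :: 'a endo \<Rightarrow> _"
    by (rule bounded_bilinear_endo_apply)
  \<comment> \<open>In this form the derivative is immediate; \<open>eq\<close> rewrites it as a
    product of two factors that the hypotheses bound.\<close>
  define g where "g s = exp (t *\<^sub>R Y) * exp (s *\<^sub>R (X - Y))" for s
  have eq: "g s = exp ((t - s) *\<^sub>R Y) * exp (s *\<^sub>R X)" for s
    unfolding g_def by (subst (1 2) exp_add_commuting[symmetric]) (simp_all add: algebra_simps comm)
  have d: "(g has_vector_derivative g s * (X - Y)) (at s within {0..t})" for s
    unfolding g_def mult.assoc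
    by (intro has_vector_derivative_mult_right exp_scaleR_has_vector_derivative_right)
  have d': "((\<lambda>s. endo_apply (g s) x) has_derivative (\<lambda>h. h *\<^sub>R endo_apply (g s * (X - Y)) x))
      (at s within {0..t})" for s
    using bounded_linear.has_vector_derivative[OF app.bounded_linear_left[of x] d[of s]]
    unfolding has_vector_derivative_def .
  have "norm (endo_apply (g t) x - endo_apply (g 0) x)
      \<le> (M\<^sup>2 * norm (endo_apply (X - Y) x)) * norm (t - 0)"
  proof (rule differentiable_bound[OF convex_real_interval(5) d'])
    fix s assume s: "s \<in> {0..t}"
    have "norm (g s) \<le> M\<^sup>2"
      unfolding eq power2_eq_square
      using s by (intro order_trans[OF norm_mult_ineq] mult_mono X Y) (auto simp: \<open>0 \<le> M\<close>)
    then have b: "norm (endo_apply (g s * (X - Y)) x) \<le> M\<^sup>2 * norm (endo_apply (X - Y) x)"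
      by (simp del: endo_apply_simps(4))
        (rule order_trans[OF norm_endo_apply], rule mult_right_mono, auto)
    show "onorm (\<lambda>h. h *\<^sub>R endo_apply (g s * (X - Y)) x) \<le> M\<^sup>2 * norm (endo_apply (X - Y) x)"
      by (rule onorm_le) (use mult_left_mono[OF b] in \<open>simp add: mult.commute\<close>)
  qed (use \<open>0 \<le> t\<close> in auto)
  moreover have "g t = exp (t *\<^sub>R X)" by (simp add: eq)
  moreover have "g 0 = exp (t *\<^sub>R Y)" by (simp add: g_def)
  ultimately show ?thesis using \<open>0 \<le> t\<close> by simp
qed

text \<open>An e/3 argument for an equi-Lipschitz family; inside the proof \<open>C'\<close>
  replaces C by a positive constant that can be divided by.\<close>

lemma tendsto_from_dense:
  fixes F :: "'i \<Rightarrow> 'a::real_normed_vector \<Rightarrow> 'b::real_normed_vector"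
  assumes dense: "closure D = UNIV"
    and F: "\<forall>\<^sub>F i in l. \<forall>x y. norm (F i x - F i y) \<le> C * norm (x - y)"
    and G: "\<And>x y. norm (G x - G y) \<le> C * norm (x - y)"
    and lim: "\<And>x. x \<in> D \<Longrightarrow> ((\<lambda>i. F i x) \<longlongrightarrow> G x) l"
  shows "((\<lambda>i. F i x) \<longlongrightarrow> G x) l"
proof (rule tendstoI)
  fix e :: real assume e: "e > 0"
  define C' where "C' = max C 1"
  have C': "C' > 0" "C \<le> C'" by (auto simp: C'_def)
  have "x \<in> closure D" using dense by simp
  then obtain y where y: "y \<in> D" "dist y x < e / (3 * C')"
    using e C' unfolding closure_approachable by (metis divide_pos_pos mult_pos_pos zero_less_numeral)
  have n: "C * norm (x - y) \<le> e / 3"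
  proof -
    have "C * norm (x - y) \<le> C' * norm (x - y)" using C' by (intro mult_right_mono) auto
    also have "\<dots> \<le> C' * (e / (3 * C'))"
      using y C' by (intro mult_left_mono) (auto simp: dist_norm norm_minus_commute)
    finally show ?thesis using C' by simp
  qed
  have "\<forall>\<^sub>F i in l. dist (F i y) (G y) < e / 3"
    using lim[OF y(1)] e by (intro tendstoD) auto
  then show "\<forall>\<^sub>F i in l. dist (F i x) (G x) < e"
    using F
  proof eventually_elim
    case (elim i)
    have "dist (F i x) (G x) \<le> norm (F i x - F i y) + norm (G x - G y) + dist (F i y) (G y)"
      unfolding dist_norm by (smt (verit, best) norm_minus_commute norm_triangle_sub
          norm_triangle_ineq diff_add_cancel norm_triangle_ineq4 norm_diff_triangle_ineq)
    moreover have "norm (F i x - F i y) \<le> e/3" "norm (G x - G y) \<le> e/3"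
      using elim(2)[rule_format, of x y] G[of x y] n by linarith+
    ultimately show ?case using elim(1) by linarith
  qed
qed

section \<open>The generation theorem\<close>

text \<open>The hypotheses of the Hille-Yosida theorem in the form of Feller, Miyadera and Phillips:
  as M may exceed 1, the bound is required for all powers of the resolvent.\<close>

locale resolvent_family =
  fixes D :: "'a::{banach, perfect_space} set" and A :: "'a \<Rightarrow> 'a" and R :: "real \<Rightarrow> 'a \<Rightarrow> 'a" and M :: real
  assumes R_linear: "\<alpha> > 0 \<Longrightarrow> bounded_linear (R \<alpha>)"
    and R_in: "\<alpha> > 0 \<Longrightarrow> R \<alpha> x \<in> D"
    and R_right: "\<alpha> > 0 \<Longrightarrow> \<alpha> *\<^sub>R R \<alpha> x - A (R \<alpha> x) = x"
    and R_left: "\<alpha> > 0 \<Longrightarrow> x \<in> D \<Longrightarrow> R \<alpha> (\<alpha> *\<^sub>R x - A x) = x"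
    and R_bound: "\<alpha> > 0 \<Longrightarrow> norm ((R \<alpha> ^^ n) x) \<le> M / \<alpha> ^ n * norm x"
    and D_dense: "closure D = UNIV"
    and M_nonneg: "0 \<le> M"
begin

lemma R_add: "\<alpha> > 0 \<Longrightarrow> R \<alpha> (x + y) = R \<alpha> x + R \<alpha> y"
  and R_diff: "\<alpha> > 0 \<Longrightarrow> R \<alpha> (x - y) = R \<alpha> x - R \<alpha> y"
  and R_scale: "\<alpha> > 0 \<Longrightarrow> R \<alpha> (c *\<^sub>R x) = c *\<^sub>R R \<alpha> x"
  using R_linear by (auto intro: linear_add linear_diff linear_scale bounded_linear.linear)

lemma R_commute:
  assumes "\<alpha> > 0" "\<nu> > 0"
  shows "R \<alpha> (R \<nu> x) = R \<nu> (R \<alpha> x)"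
proof -
  \<comment> \<open>The resolvent identity. Read in both orders it equates the same multiple of the
    two products, and the factor cancels unless \<alpha> = \<nu>.\<close>
  have *: "R \<alpha> x + (\<alpha> - \<nu>) *\<^sub>R R \<alpha> (R \<nu> x) = R \<nu> x" if "\<alpha> > 0" "\<nu> > 0" for \<alpha> \<nu>
  proof -
    have "\<alpha> *\<^sub>R R \<nu> x - A (R \<nu> x) = x + (\<alpha> - \<nu>) *\<^sub>R R \<nu> x"
      using R_right[OF that(2), of x] by (simp add: algebra_simps)
    then show ?thesis
      using R_left[OF that(1) R_in[OF that(2), of x]] that by (simp add: R_add R_scale)
  qed
  show ?thesis
  proof (cases "\<alpha> = \<nu>")
    case False
    have "(\<alpha> - \<nu>) *\<^sub>R R \<alpha> (R \<nu> x) = (\<alpha> - \<nu>) *\<^sub>R R \<nu> (R \<alpha> x)"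
      using *[OF assms] *[OF assms(2,1)]
      by (metis add_diff_cancel_left' minus_diff_eq scaleR_minus_left)
    then show ?thesis using False by simp
  qed simp
qed

text \<open>With \<open>l = Suc n\<close> the error at x in D is \<open>R l (A x)\<close>, of order
  1/l; the operators \<open>l R l\<close> are bounded by M, so density extends the limit to all x.
  Besides the Yosida approximations this later serves to regularize initial data.\<close>

lemma R_tendsto_id: "(\<lambda>n. real (Suc n) *\<^sub>R R (real (Suc n)) x) \<longlonglongrightarrow> x"
proof (rule tendsto_from_dense[OF D_dense, where C="max M 1"])
  show "\<forall>\<^sub>F n in sequentially. \<forall>x y.
      norm (real (Suc n) *\<^sub>R R (real (Suc n)) x - real (Suc n) *\<^sub>R R (real (Suc n)) y) \<le> max M 1 * norm (x - y)"
  proof (intro always_eventually allI)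
    fix n x y
    have "norm (R (real (Suc n)) (x - y)) \<le> M / real (Suc n) * norm (x - y)"
      using R_bound[of "real (Suc n)" 1 "x - y"] by simp
    then have "real (Suc n) * norm (R (real (Suc n)) (x - y)) \<le> M * norm (x - y)"
      by (simp add: field_simps)
    also have "\<dots> \<le> max M 1 * norm (x - y)" by (intro mult_right_mono) auto
    finally show "norm (real (Suc n) *\<^sub>R R (real (Suc n)) x - real (Suc n) *\<^sub>R R (real (Suc n)) y)
        \<le> max M 1 * norm (x - y)"
      by (simp add: R_diff flip: scaleR_diff_right)
  qed
  show "norm (x - y) \<le> max M 1 * norm (x - y)" for x y :: 'a
    using mult_right_mono[of 1 "max M 1" "norm (x - y)"] by simp
  fix x assume x: "x \<in> D"
  have "(\<lambda>n. real (Suc n) *\<^sub>R R (real (Suc n)) x - x) \<longlonglongrightarrow> 0"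
  proof (rule Lim_null_comparison[OF always_eventually])
    show "\<forall>n. norm (real (Suc n) *\<^sub>R R (real (Suc n)) x - x) \<le> M * norm (A x) * inverse (real (Suc n))"
    proof
      fix n
      have "real (Suc n) *\<^sub>R R (real (Suc n)) x - x = R (real (Suc n)) (A x)"
        using R_left[of "real (Suc n)" x] x by (simp add: R_diff R_scale algebra_simps del: of_nat_Suc)
      then show "norm (real (Suc n) *\<^sub>R R (real (Suc n)) x - x) \<le> M * norm (A x) * inverse (real (Suc n))"
        using R_bound[of "real (Suc n)" 1 "A x"] by (simp add: field_simps)
    qed
    show "(\<lambda>n. M * norm (A x) * inverse (real (Suc n))) \<longlonglongrightarrow> 0"
      using tendsto_mult_right_zero[OF LIMSEQ_inverse_real_of_nat] .
  qed
  then show "(\<lambda>n. real (Suc n) *\<^sub>R R (real (Suc n)) x) \<longlonglongrightarrow> x" by (simp only: LIM_zero_iff)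
qed

section \<open>Yosida approximations\<close>

definition res :: "real \<Rightarrow> 'a endo" where
  "res \<alpha> = (SOME F. endo_apply F = R \<alpha>)"

lemma res_apply: "\<alpha> > 0 \<Longrightarrow> endo_apply (res \<alpha>) = R \<alpha>"
  unfolding res_def by (rule someI_ex) (metis R_linear endo_of_bounded_linear)

lemma res_commute: "\<alpha> > 0 \<Longrightarrow> \<nu> > 0 \<Longrightarrow> res \<alpha> * res \<nu> = res \<nu> * res \<alpha>"
  by (rule endo_eqI) (simp add: res_apply R_commute)

lemma norm_res_power: "\<alpha> > 0 \<Longrightarrow> norm (res \<alpha> ^ n) \<le> M / \<alpha> ^ n"
  using R_bound by (intro norm_endo_bound) (auto simp: M_nonneg endo_apply_power res_apply)

text \<open>The bounded operator \<open>l A (R l)\<close> at \<open>l = Suc n\<close>, rewritten by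
  means of \<open>A (R l) = l R l - 1\<close>; the successor keeps l positive.\<close>

definition yosida :: "nat \<Rightarrow> 'a endo" where
  "yosida n = (real (Suc n))\<^sup>2 *\<^sub>R res (real (Suc n)) - real (Suc n) *\<^sub>R 1"

lemma yosida_commute: "yosida m * yosida n = yosida n * yosida m"
  using res_commute[of "real (Suc m)" "real (Suc n)"] by (simp add: yosida_def algebra_simps)

lemma yosida_res_commute: "\<alpha> > 0 \<Longrightarrow> yosida m * res \<alpha> = res \<alpha> * yosida m"
  using res_commute[of "real (Suc m)" \<alpha>] by (simp add: yosida_def algebra_simps)

lemma yosida_apply: "x \<in> D \<Longrightarrow> endo_apply (yosida n) x = real (Suc n) *\<^sub>R R (real (Suc n)) (A x)"
  using R_left[of "real (Suc n)" x]
  by (simp add: yosida_def res_apply R_diff R_scale power2_eq_square algebra_simps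
      del: of_nat_Suc flip: scaleR_scaleR)

lemma yosida_tendsto: "x \<in> D \<Longrightarrow> (\<lambda>n. endo_apply (yosida n) x) \<longlonglongrightarrow> A x"
  by (simp only: yosida_apply R_tendsto_id)

text \<open>Splitting off the scalar \<open>- t * l\<close> leaves the exponential of
  \<open>t * l\<^sup>2\<close> times the resolvent, of norm at most \<open>M * exp (t * l)\<close>
  by the bound on resolvent powers. The exponential factors cancel, so the estimate is uniform in n
  and t.\<close>

lemma norm_exp_yosida:
  assumes "0 \<le> t"
  shows "norm (exp (t *\<^sub>R yosida n)) \<le> M"
proof -
  define l where "l = real (Suc n)"
  have l: "l > 0" by (simp add: l_def)
  have "t *\<^sub>R yosida n = (t * l\<^sup>2) *\<^sub>R res l + of_real (- (t * l))"
    by (simp add: yosida_def l_def of_real_def algebra_simps)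
  moreover have "exp ((t * l\<^sup>2) *\<^sub>R res l + of_real (- (t * l)))
      = exp ((t * l\<^sup>2) *\<^sub>R res l) * exp (of_real (- (t * l)))"
    by (rule exp_add_commuting) (simp add: of_real_def)
  ultimately have "exp (t *\<^sub>R yosida n) = exp ((t * l\<^sup>2) *\<^sub>R res l) * of_real (exp (- (t * l)))"
    by (simp only: exp_of_real)
  then have "norm (exp (t *\<^sub>R yosida n)) \<le> norm (exp ((t * l\<^sup>2) *\<^sub>R res l)) * exp (- (t * l))"
    using norm_mult_ineq[of "exp ((t * l\<^sup>2) *\<^sub>R res l)" "of_real (exp (- (t * l)))"] by simp
  also have "norm (exp ((t * l\<^sup>2) *\<^sub>R res l)) \<le> M * exp (t * l)"
  proof (rule norm_exp_power_bounded)
    fix k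
    have "norm (((t * l\<^sup>2) *\<^sub>R res l) ^ k) = (t * l\<^sup>2) ^ k * norm (res l ^ k)"
      using assms by (simp add: scaleR_power)
    also have "\<dots> \<le> (t * l\<^sup>2) ^ k * (M / l ^ k)"
      using assms by (intro mult_left_mono norm_res_power l) auto
    also have "\<dots> = M * (t * l) ^ k"
      using l by (simp add: power2_eq_square power_mult_distrib)
    finally show "norm (((t * l\<^sup>2) *\<^sub>R res l) ^ k) \<le> M * (t * l) ^ k" .
  qed
  finally show ?thesis by (simp add: mult_right_mono mult.assoc flip: exp_add)
qed

definition approx :: "nat \<Rightarrow> real \<Rightarrow> 'a \<Rightarrow> 'a" where
  "approx n t = endo_apply (exp (t *\<^sub>R yosida n))"

lemma approx_linear: "bounded_linear (approx n t)"
  unfolding approx_def by (rule bounded_bilinear.bounded_linear_right[OF bounded_bilinear_endo_apply])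

lemma approx_diff: "approx n t x - approx n t y = approx n t (x - y)"
  using linear_diff[OF bounded_linear.linear[OF approx_linear]] by simp

lemma norm_approx: "0 \<le> t \<Longrightarrow> norm (approx n t x) \<le> M * norm x"
  unfolding approx_def
  by (rule order_trans[OF norm_endo_apply], rule mult_right_mono[OF norm_exp_yosida]) auto

lemma approx_add: "approx n (s + t) x = approx n s (approx n t x)"
  unfolding approx_def by (simp add: scaleR_add_left exp_add_commuting flip: endo_apply_simps(2))

lemma approx_Cauchy: "uniformly_Cauchy_on {0..b} (\<lambda>n t. approx n t x)"
  unfolding uniformly_Cauchy_on_def
proof (intro allI impI)
  fix e :: real assume e: "e > 0"
  \<comment> \<open>The added 1 makes C positive in all cases. The error is split as e/4 + e/2 +
    e/4: the outer parts replace x by a nearby y in D, the middle one is the distance of two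
    approximations at y.\<close>
  define C where "C = M\<^sup>2 * max b 0 + 1"
  have C: "C > 0" by (simp add: C_def add_nonneg_pos)
  have "x \<in> closure D" using D_dense by simp
  then obtain y where y: "y \<in> D" "dist y x < e / (4 * (M + 1))"
    using e M_nonneg unfolding closure_approachable
    by (metis add_nonneg_pos divide_pos_pos mult_pos_pos zero_less_numeral zero_less_one)
  have My: "M * norm (x - y) \<le> e / 4"
  proof -
    have "M * norm (x - y) \<le> (M + 1) * (e / (4 * (M + 1)))"
      using y M_nonneg by (intro mult_mono) (auto simp: dist_norm norm_minus_commute)
    also have "(M + 1) * (e / (4 * (M + 1))) = e / 4"
      using M_nonneg by (auto simp: divide_simps)
    finally show ?thesis .
  qed
  have "Cauchy (\<lambda>n. endo_apply (yosida n) y)"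
    using yosida_tendsto[OF y(1)] by (rule LIMSEQ_imp_Cauchy)
  then obtain N where N: "\<And>m n. m \<ge> N \<Longrightarrow> n \<ge> N \<Longrightarrow>
      dist (endo_apply (yosida m) y) (endo_apply (yosida n) y) < e / (2 * C)"
    using e C unfolding Cauchy_def by (meson divide_pos_pos mult_pos_pos zero_less_numeral)
  show "\<exists>N. \<forall>t\<in>{0..b}. \<forall>m\<ge>N. \<forall>n\<ge>N. dist (approx m t x) (approx n t x) < e"
  proof (intro exI ballI allI impI)
    fix t m n assume t: "t \<in> {0..b}" and mn: "m \<ge> N" "n \<ge> N"
    have "norm (approx m t y - approx n t y)
        \<le> M\<^sup>2 * norm (endo_apply (yosida m) y - endo_apply (yosida n) y) * t"
      unfolding approx_def
      using t by (intro exp_endo_diff_bound yosida_commute norm_exp_yosida M_nonneg) auto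
    also have "\<dots> = (M\<^sup>2 * t) * norm (endo_apply (yosida m) y - endo_apply (yosida n) y)" by simp
    also have "\<dots> \<le> C * norm (endo_apply (yosida m) y - endo_apply (yosida n) y)"
    proof (rule mult_right_mono)
      have "M\<^sup>2 * t \<le> M\<^sup>2 * max b 0" using t by (intro mult_left_mono) auto
      then show "M\<^sup>2 * t \<le> C" by (simp add: C_def)
    qed simp
    also have "\<dots> < C * (e / (2 * C))"
      using N[OF mn] C by (intro mult_strict_left_mono) (auto simp: dist_norm)
    also have "\<dots> = e / 2" using C by simp
    finally have 1: "norm (approx m t y - approx n t y) < e / 2" .
    have 2: "norm (approx k t x - approx k t y) \<le> e / 4" for k
      using norm_approx[of t k "x - y"] t My by (simp add: approx_diff)
    have "approx m t x - approx n t x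
        = (approx m t x - approx m t y) + (approx m t y - approx n t y) - (approx n t x - approx n t y)"
      by simp
    then have "norm (approx m t x - approx n t x) \<le> norm (approx m t x - approx m t y)
        + norm (approx m t y - approx n t y) + norm (approx n t x - approx n t y)"
      by (metis (no_types) norm_triangle_ineq4 norm_triangle_ineq add_mono_thms_linordered_semiring(3) order_trans)
    then show "dist (approx m t x) (approx n t x) < e"
      using 1 2[of m] 2[of n] by (simp add: dist_norm)
  qed
qed

section \<open>The limit semigroup and its generator\<close>

definition semi :: "real \<Rightarrow> 'a \<Rightarrow> 'a" where
  "semi t x = lim (\<lambda>n. approx n t x)"

lemma approx_uniform_limit:
  "uniform_limit {0..b} (\<lambda>n t. approx n t x) (\<lambda>t. semi t x) sequentially"
proof -
  have "uniformly_convergent_on {0..b} (\<lambda>n t. approx n t x)"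
    by (rule Cauchy_uniformly_convergent[OF approx_Cauchy])
  then show ?thesis unfolding semi_def uniformly_convergent_uniform_limit_iff .
qed

lemma approx_tendsto: "0 \<le> t \<Longrightarrow> (\<lambda>n. approx n t x) \<longlonglongrightarrow> semi t x"
  by (rule tendsto_uniform_limitI[OF approx_uniform_limit[where b=t]]) simp

lemma norm_semi: "0 \<le> t \<Longrightarrow> norm (semi t x) \<le> M * norm x"
  using norm_approx by (intro LIMSEQ_le_const2[OF tendsto_norm[OF approx_tendsto]]) auto

lemma semi_linear: "0 \<le> t \<Longrightarrow> bounded_linear (semi t)"
proof (rule bounded_linear_intro[where K=M])
  assume t: "0 \<le> t"
  note lin = bounded_linear.linear[OF approx_linear]
  show "semi t (x + y) = semi t x + semi t y" for x y
    using tendsto_add[OF approx_tendsto[OF t, of x] approx_tendsto[OF t, of y]]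
      approx_tendsto[OF t, of "x + y"]
    by (simp add: linear_add[OF lin] LIMSEQ_unique)
  show "semi t (r *\<^sub>R x) = r *\<^sub>R semi t x" for r x
    using tendsto_scaleR[OF tendsto_const approx_tendsto[OF t, of x]]
      approx_tendsto[OF t, of "r *\<^sub>R x"]
    by (simp add: linear_scale[OF lin] LIMSEQ_unique)
  show "norm (semi t x) \<le> norm x * M" for x using norm_semi[OF t] by (simp add: mult.commute)
qed

lemma semi_diff: "0 \<le> t \<Longrightarrow> semi t x - semi t y = semi t (x - y)"
  using linear_diff[OF bounded_linear.linear[OF semi_linear]] by simp

lemma semi_0: "semi 0 x = x"
  by (simp add: semi_def approx_def)

lemma semi_add:
  assumes "0 \<le> s" "0 \<le> t"
  shows "semi (s + t) x = semi s (semi t x)"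
proof (rule LIMSEQ_unique[OF approx_tendsto])
  have "(\<lambda>n. approx n s (approx n t x) - approx n s (semi t x)) \<longlonglongrightarrow> 0"
  proof (rule Lim_null_comparison[OF always_eventually])
    show "\<forall>n. norm (approx n s (approx n t x) - approx n s (semi t x)) \<le> M * norm (approx n t x - semi t x)"
      using norm_approx[OF assms(1)] by (simp add: approx_diff)
    show "(\<lambda>n. M * norm (approx n t x - semi t x)) \<longlonglongrightarrow> 0"
      using approx_tendsto[OF assms(2), of x]
      by (intro tendsto_mult_right_zero tendsto_norm_zero) (simp add: LIM_zero_iff)
  qed
  from tendsto_add[OF this approx_tendsto[OF assms(1), of "semi t x"]]
  show "(\<lambda>n. approx n (s + t) x) \<longlonglongrightarrow> semi s (semi t x)" by (simp add: approx_add)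
qed (use assms in simp)

lemma semi_continuous: "continuous_on {0..} (\<lambda>t. semi t x)"
proof -
  have c: "continuous_on {0..b} (\<lambda>t. semi t x)" for b
  proof (rule uniform_limit_theorem[OF _ approx_uniform_limit])
    have "continuous_on {0..b} (\<lambda>t. exp (t *\<^sub>R yosida n))" for n
      by (rule continuous_at_imp_continuous_on)
        (blast intro: has_vector_derivative_continuous exp_scaleR_has_vector_derivative_right)
    then show "\<forall>\<^sub>F n in sequentially. continuous_on {0..b} (\<lambda>t. approx n t x)"
      unfolding approx_def
      by (intro always_eventually allI bounded_linear.continuous_on[OF
            bounded_bilinear.bounded_linear_left[OF bounded_bilinear_endo_apply]])
  qed simp
  show ?thesis
    unfolding continuous_on_eq_continuous_within
  proof
    fix t :: real assume t: "t \<in> {0..}"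
    have "continuous (at t within {0..t + 1}) (\<lambda>t. semi t x)"
      using c[of "t + 1"] t by (simp add: continuous_on_eq_continuous_within)
    moreover have "at t within {0..t + 1} = at t within {0..}"
      by (rule at_within_nhd[of _ "{..<t + 1}"]) auto
    ultimately show "continuous (at t within {0..}) (\<lambda>t. semi t x)" by simp
  qed
qed

text \<open>The derivatives of the approximations converge uniformly on \<open>{0..t+1}\<close>, so
  the limit may be differentiated termwise. The interval reaches beyond t in order that
  differentiability at t within it agrees with that within the half-line.\<close>

lemma semi_derivative:
  assumes x: "x \<in> D" and t: "0 \<le> t"
  shows "((\<lambda>t. semi t x) has_vector_derivative semi t (A x)) (at t within {0..})"
proof -
  have "\<exists>g. \<forall>s\<in>{0..t+1}. (\<lambda>n. approx n s x) \<longlonglongrightarrow> g s \<and>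
      (g has_derivative (\<lambda>h. h *\<^sub>R semi s (A x))) (at s within {0..t+1})"
  proof (rule has_derivative_sequence)
    show "((\<lambda>s. approx n s x) has_derivative (\<lambda>h. h *\<^sub>R approx n s (endo_apply (yosida n) x)))
        (at s within {0..t+1})" for n s
      using bounded_linear.has_vector_derivative[OF
          bounded_bilinear.bounded_linear_left[OF bounded_bilinear_endo_apply]
          exp_scaleR_has_vector_derivative_right[of "yosida n" s], of x]
      unfolding has_vector_derivative_def approx_def by simp
    show "(\<lambda>n. approx n 0 x) \<longlonglongrightarrow> x" by (simp add: approx_def)
    fix e :: real assume e: "e > 0"
    have "\<forall>\<^sub>F n in sequentially. \<forall>s\<in>{0..t+1}. dist (approx n s (A x)) (semi s (A x)) < e / 2"
      using approx_uniform_limit e by (intro uniform_limitD) auto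
    moreover have "\<forall>\<^sub>F n in sequentially. dist (endo_apply (yosida n) x) (A x) < e / (2 * (M + 1))"
      using yosida_tendsto[OF x] e M_nonneg by (intro tendstoD) auto
    ultimately show "\<forall>\<^sub>F n in sequentially. \<forall>s\<in>{0..t+1}. \<forall>h.
        norm (h *\<^sub>R approx n s (endo_apply (yosida n) x) - h *\<^sub>R semi s (A x)) \<le> e * norm h"
    proof eventually_elim
      case (elim n)
      show ?case
      proof (intro ballI allI)
        fix s h :: real assume s: "s \<in> {0..t+1}"
        have "norm (approx n s (endo_apply (yosida n) x - A x)) \<le> M * norm (endo_apply (yosida n) x - A x)"
          using s by (intro norm_approx) auto
        also have "\<dots> \<le> (M + 1) * (e / (2 * (M + 1)))"
          using elim(2) M_nonneg by (intro mult_mono) (auto simp: dist_norm)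
        also have "(M + 1) * (e / (2 * (M + 1))) = e / 2"
          using M_nonneg by (auto simp: divide_simps)
        finally have "norm (approx n s (endo_apply (yosida n) x) - approx n s (A x)) \<le> e / 2"
          by (simp add: approx_diff)
        moreover have "norm (approx n s (A x) - semi s (A x)) < e / 2"
          using elim(1) s by (simp add: dist_norm)
        ultimately have "norm (approx n s (endo_apply (yosida n) x) - semi s (A x)) \<le> e"
          using norm_triangle_ineq[of "approx n s (endo_apply (yosida n) x) - approx n s (A x)"
              "approx n s (A x) - semi s (A x)"] by simp
        then show "norm (h *\<^sub>R approx n s (endo_apply (yosida n) x) - h *\<^sub>R semi s (A x)) \<le> e * norm h"
          by (simp add: mult.commute[of e] mult_left_mono flip: scaleR_diff_right)
      qed
    qed
  qed (use t in auto)
  then obtain g where g: "\<And>s. s \<in> {0..t+1} \<Longrightarrow> (\<lambda>n. approx n s x) \<longlonglongrightarrow> g s"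
    "(g has_vector_derivative semi t (A x)) (at t within {0..t+1})"
    using t unfolding has_vector_derivative_def by force
  have "g s = semi s x" if "s \<in> {0..t+1}" for s
    using LIMSEQ_unique[OF g(1)[OF that] approx_tendsto] that by auto
  then have "((\<lambda>t. semi t x) has_vector_derivative semi t (A x)) (at t within {0..t+1})"
    using has_vector_derivative_transform[OF _ _ g(2)] t by auto
  moreover have "at t within {0..t + 1} = at t within {0..}"
    by (rule at_within_nhd[of _ "{..<t + 1}"]) auto
  ultimately show ?thesis by simp
qed

lemma semi_R:
  assumes "\<alpha> > 0" "0 \<le> t"
  shows "semi t (R \<alpha> x) = R \<alpha> (semi t x)"
proof (rule LIMSEQ_unique[OF approx_tendsto[OF assms(2)]])
  have "approx n t (R \<alpha> x) = R \<alpha> (approx n t x)" for n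
    using exp_commute[of "t *\<^sub>R yosida n" "res \<alpha>"] yosida_res_commute[OF assms(1), of n]
    by (simp add: approx_def flip: res_apply[OF assms(1)] endo_apply_simps(2))
  then show "(\<lambda>n. approx n t (R \<alpha> x)) \<longlonglongrightarrow> R \<alpha> (semi t x)"
    using bounded_linear.tendsto[OF R_linear[OF assms(1)] approx_tendsto[OF assms(2), of x]] by simp
qed

text \<open>D is the range of \<open>R 1\<close>, and the semigroup commutes with
  \<open>R 1\<close>; writing \<open>x = R 1 y\<close> reduces both claims to this.\<close>

lemma semi_invariant:
  assumes x: "x \<in> D" and t: "0 \<le> t"
  shows "semi t x \<in> D" "A (semi t x) = semi t (A x)"
proof -
  define y where "y = 1 *\<^sub>R x - A x"
  have xy: "x = R 1 y" using R_left[of 1 x] x by (simp add: y_def)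
  have s: "semi t x = R 1 (semi t y)" using t by (simp add: xy semi_R)
  show "semi t x \<in> D" unfolding s by (rule R_in) simp
  have "A (semi t x) = R 1 (semi t y) - semi t y"
    using R_right[of 1 "semi t y"] by (simp add: s algebra_simps)
  also have "\<dots> = semi t (x - y)" using s by (simp add: semi_diff t flip: s)
  finally show "A (semi t x) = semi t (A x)" by (simp add: y_def)
qed

lemma C0_semigroup_semi: "C0_semigroup semi"
  unfolding C0_semigroup_def
proof (intro conjI allI impI)
  fix x
  have "((\<lambda>t. semi t x) \<longlongrightarrow> semi 0 x) (at 0 within {0..})"
    using semi_continuous by (auto simp: continuous_on_def)
  then show "((\<lambda>t. semi t x) \<longlongrightarrow> x) (at_right 0)"
    unfolding semi_0 by (rule tendsto_within_subset) auto
qed (simp_all add: semi_linear semi_0 semi_add)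

lemma semi_right_derivative:
  assumes "x \<in> D"
  shows "((\<lambda>h. (semi h x - x) /\<^sub>R h) \<longlongrightarrow> A x) (at_right 0)"
proof -
  have "((\<lambda>t. semi t x) has_vector_derivative A x) (at 0 within {0<..})"
    using semi_derivative[OF assms, of 0] by (auto simp: semi_0 intro: has_vector_derivative_within_subset)
  then have "((\<lambda>h. inverse \<bar>h\<bar> *\<^sub>R (semi h x - x - h *\<^sub>R A x)) \<longlongrightarrow> 0) (at_right 0)"
    by (simp add: has_vector_derivative_def has_derivative_within semi_0 diff_diff_eq inverse_eq_divide)
  moreover have "\<forall>\<^sub>F h in at_right 0. inverse \<bar>h\<bar> *\<^sub>R (semi h x - x - h *\<^sub>R A x) = (semi h x - x) /\<^sub>R h - A x"
    by (rule eventually_at_right_less[THEN eventually_mono]) (simp add: algebra_simps)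
  ultimately have "((\<lambda>h. (semi h x - x) /\<^sub>R h - A x) \<longlongrightarrow> 0) (at_right 0)"
    by (rule Lim_transform_eventually)
  then show ?thesis by (simp only: LIM_zero_iff)
qed

text \<open>The point is that the generator has no larger domain than D: if the difference quotients
  at x converge to y, applying \<open>R 1\<close> gives \<open>A (R 1 x) = R 1 y\<close>, hence
  \<open>x = R 1 (x - y)\<close>.\<close>

lemma is_generator_semi: "is_generator D A semi"
  unfolding is_generator_def
proof (intro conjI ballI semi_right_derivative set_eqI iffI)
  fix x assume "x \<in> {z. \<exists>y. ((\<lambda>h. (semi h z - z) /\<^sub>R h) \<longlongrightarrow> y) (at_right 0)}"
  then obtain y where y: "((\<lambda>h. (semi h x - x) /\<^sub>R h) \<longlongrightarrow> y) (at_right 0)" by blast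
  have "((\<lambda>h. R 1 ((semi h x - x) /\<^sub>R h)) \<longlongrightarrow> R 1 y) (at_right 0)"
    by (rule bounded_linear.tendsto[OF R_linear y]) simp
  moreover have "\<forall>\<^sub>F h in at_right 0. R 1 ((semi h x - x) /\<^sub>R h) = (semi h (R 1 x) - R 1 x) /\<^sub>R h"
    by (rule eventually_at_right_less[THEN eventually_mono]) (simp add: R_diff R_scale semi_R)
  ultimately have "((\<lambda>h. (semi h (R 1 x) - R 1 x) /\<^sub>R h) \<longlongrightarrow> R 1 y) (at_right 0)"
    by (rule Lim_transform_eventually)
  from tendsto_unique[OF _ semi_right_derivative[OF R_in] this] have "A (R 1 x) = R 1 y"
    by simp
  then have "x = R 1 (x - y)" using R_right[of 1 x] by (simp add: R_diff algebra_simps)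
  then show "x \<in> D" using R_in[of 1 "x - y"] by simp
qed (use semi_right_derivative in auto)

end

section \<open>Variation of constants\<close>

lemma has_vector_derivative_iff_quotient:
  "(f has_vector_derivative d) (at x within S) \<longleftrightarrow>
    ((\<lambda>y. (f y - f x) /\<^sub>R (y - x)) \<longlongrightarrow> d) (at x within S)"
proof -
  have "(f has_vector_derivative d) (at x within S) \<longleftrightarrow>
      ((\<lambda>y. (1 / norm (y - x)) *\<^sub>R (f y - (f x + (y - x) *\<^sub>R d))) \<longlongrightarrow> 0) (at x within S)"
    by (simp add: has_vector_derivative_def has_derivative_within bounded_linear_scaleR_left)
  also have "\<dots> \<longleftrightarrow> ((\<lambda>y. (f y - f x) /\<^sub>R (y - x) - d) \<longlongrightarrow> 0) (at x within S)"
    unfolding tendsto_norm_zero_iff[symmetric, of "\<lambda>y. (1 / norm (y - x)) *\<^sub>R (f y - (f x + (y - x) *\<^sub>R d))"]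
      tendsto_norm_zero_iff[symmetric, of "\<lambda>y. (f y - f x) /\<^sub>R (y - x) - d"]
  proof (rule filterlim_cong[OF refl refl])
    show "\<forall>\<^sub>F y in at x within S. norm ((1 / norm (y - x)) *\<^sub>R (f y - (f x + (y - x) *\<^sub>R d)))
        = norm ((f y - f x) /\<^sub>R (y - x) - d)"
    proof (rule eventually_at_filter[THEN iffD2], intro always_eventually allI impI)
      fix y assume "y \<noteq> x"
      then have "(f y - f x) /\<^sub>R (y - x) - d
          = inverse (y - x) *\<^sub>R (f y - f x) - inverse (y - x) *\<^sub>R ((y - x) *\<^sub>R d)"
        by simp
      also have "\<dots> = inverse (y - x) *\<^sub>R (f y - (f x + (y - x) *\<^sub>R d))"
        by (simp only: diff_diff_eq flip: scaleR_diff_right)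
      finally have "(f y - f x) /\<^sub>R (y - x) - d = inverse (y - x) *\<^sub>R (f y - (f x + (y - x) *\<^sub>R d))" .
      then show "norm ((1 / norm (y - x)) *\<^sub>R (f y - (f x + (y - x) *\<^sub>R d)))
          = norm ((f y - f x) /\<^sub>R (y - x) - d)"
        by (simp add: inverse_eq_divide)
    qed
  qed
  finally show ?thesis by (simp only: LIM_zero_iff)
qed

context resolvent_family
begin

text \<open>Strong continuity and a bound uniform in time give joint continuity: time is varied at
  the fixed vector x, and the error \<open>f i - x\<close> is amplified at most by M.\<close>

lemma semi_tendsto:
  assumes f: "(f \<longlongrightarrow> x) F" and g: "(g \<longlongrightarrow> r) F" and r: "0 \<le> r" and pos: "\<forall>\<^sub>F i in F. 0 \<le> g i"
  shows "((\<lambda>i. semi (g i) (f i)) \<longlongrightarrow> semi r x) F"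
proof -
  have "((\<lambda>i. semi (g i) x) \<longlongrightarrow> semi r x) F"
    using continuous_on_tendsto_compose[OF semi_continuous g] r pos by simp
  moreover have "((\<lambda>i. semi (g i) (f i - x)) \<longlongrightarrow> 0) F"
  proof (rule Lim_null_comparison)
    show "\<forall>\<^sub>F i in F. norm (semi (g i) (f i - x)) \<le> M * norm (f i - x)"
      using pos by eventually_elim (rule norm_semi)
    show "((\<lambda>i. M * norm (f i - x)) \<longlongrightarrow> 0) F"
      using f by (intro tendsto_mult_right_zero tendsto_norm_zero) (simp add: LIM_zero_iff)
  qed
  ultimately have "((\<lambda>i. semi (g i) (f i - x) + semi (g i) x) \<longlongrightarrow> 0 + semi r x) F"
    by (intro tendsto_add)
  moreover have "\<forall>\<^sub>F i in F. semi (g i) (f i - x) + semi (g i) x = semi (g i) (f i)"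
    using pos by eventually_elim (simp flip: semi_diff)
  ultimately show ?thesis using Lim_transform_eventually by fastforce
qed

lemma semi_continuous_on:
  assumes "continuous_on X f" "continuous_on X g" "\<And>s. s \<in> X \<Longrightarrow> 0 \<le> g s"
  shows "continuous_on X (\<lambda>s. semi (g s) (f s))"
  unfolding continuous_on_def
proof
  fix s assume s: "s \<in> X"
  show "((\<lambda>s. semi (g s) (f s)) \<longlongrightarrow> semi (g s) (f s)) (at s within X)"
    using assms s
    by (intro semi_tendsto) (auto simp: continuous_on_def eventually_at_filter)
qed

text \<open>A product rule for the two occurrences of s. In one part of the difference quotient the
  semigroup acts on the quotient of w, in the other w is frozen at s; the latter contributes
  \<open>- semi (t - s) (A (w s))\<close>, which cancels the unbounded term coming from the
  former.\<close>

lemma duhamel_derivative: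
  assumes s: "s \<in> {0..t}" and w: "w s \<in> D"
    and w': "(w has_vector_derivative A (w s) + f) (at s within {0..t})"
  shows "((\<lambda>s. semi (t - s) (w s)) has_vector_derivative semi (t - s) f) (at s within {0..t})"
proof -
  have "((\<lambda>y. semi (t - y) ((w y - w s) /\<^sub>R (y - s))) \<longlongrightarrow> semi (t - s) (A (w s) + f)) (at s within {0..t})"
    using w' s unfolding has_vector_derivative_iff_quotient
    by (intro semi_tendsto tendsto_intros) (auto simp: eventually_at_filter)
  moreover have "((\<lambda>y. (semi (t - y) (w s) - semi (t - s) (w s)) /\<^sub>R (y - s)) \<longlongrightarrow> - semi (t - s) (A (w s)))
      (at s within {0..t})"
  proof -
    have "((\<lambda>y. t - y) has_vector_derivative -1) (at s within {0..t})"
      by (auto intro!: derivative_eq_intros)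
    moreover have "((\<lambda>r. semi r (w s)) has_vector_derivative semi (t - s) (A (w s)))
        (at (t - s) within (\<lambda>y. t - y) ` {0..t})"
      by (rule has_vector_derivative_within_subset[OF semi_derivative[OF w]]) (use s in auto)
    ultimately have "((\<lambda>r. semi r (w s)) \<circ> (\<lambda>y. t - y) has_vector_derivative
        -1 *\<^sub>R semi (t - s) (A (w s))) (at s within {0..t})"
      by (rule vector_diff_chain_within)
    then show ?thesis by (simp add: o_def has_vector_derivative_iff_quotient)
  qed
  ultimately have "((\<lambda>y. semi (t - y) ((w y - w s) /\<^sub>R (y - s)) +
      (semi (t - y) (w s) - semi (t - s) (w s)) /\<^sub>R (y - s)) \<longlongrightarrow>
      semi (t - s) (A (w s) + f) + - semi (t - s) (A (w s))) (at s within {0..t})"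
    by (rule tendsto_add)
  moreover have "semi (t - s) (A (w s) + f) + - semi (t - s) (A (w s)) = semi (t - s) f"
    using s by (simp add: semi_diff)
  moreover have "\<forall>\<^sub>F y in at s within {0..t}. semi (t - y) ((w y - w s) /\<^sub>R (y - s)) +
      (semi (t - y) (w s) - semi (t - s) (w s)) /\<^sub>R (y - s) = (semi (t - y) (w y) - semi (t - s) (w s)) /\<^sub>R (y - s)"
  proof (rule eventually_at_filter[THEN iffD2], intro always_eventually allI impI)
    fix y assume "y \<in> {0..t}"
    then have "semi (t - y) ((w y - w s) /\<^sub>R (y - s)) = (semi (t - y) (w y) - semi (t - y) (w s)) /\<^sub>R (y - s)"
      by (simp add: semi_diff linear_scale[OF bounded_linear.linear[OF semi_linear]])
    then show "semi (t - y) ((w y - w s) /\<^sub>R (y - s)) + (semi (t - y) (w s) - semi (t - s) (w s)) /\<^sub>R (y - s)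
        = (semi (t - y) (w y) - semi (t - s) (w s)) /\<^sub>R (y - s)"
      by (simp flip: scaleR_add_right)
  qed
  ultimately show ?thesis
    unfolding has_vector_derivative_iff_quotient using Lim_transform_eventually by fastforce
qed

end

lemma set_integrable_continuous_lebesgue:
  fixes f :: "real \<Rightarrow> 'a::{banach, second_countable_topology}"
  assumes "continuous_on {a..b} f"
  shows "set_integrable lebesgue {a..b} f"
proof -
  have "set_integrable lborel {a..b} f"
    unfolding set_integrable_def by (rule borel_integrable_compact[OF compact_Icc assms])
  then show ?thesis
    unfolding set_integrable_def
    by (subst integrable_completion) (simp_all add: borel_measurable_integrable)
qed

text \<open>The fundamental theorem in the library needs a Euclidean codomain, hence the passage to inner products.\<close>

lemma set_lebesgue_integral_FTC:
  fixes f F :: "real \<Rightarrow> 'a::{real_inner, banach, second_countable_topology}"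
  assumes "a \<le> b" and f: "continuous_on {a..b} f"
    and F: "\<And>x. x \<in> {a..b} \<Longrightarrow> (F has_vector_derivative f x) (at x within {a..b})"
  shows "(LINT x:{a..b}|lebesgue. f x) = F b - F a"
proof -
  have int: "integrable lebesgue (\<lambda>x. indicator {a..b} x *\<^sub>R f x)"
    using set_integrable_continuous_lebesgue[OF f] by (simp add: set_integrable_def)
  have "y \<bullet> (LINT x:{a..b}|lebesgue. f x) = y \<bullet> (F b - F a)" for y
  proof -
    have c: "continuous_on {a..b} (\<lambda>x. y \<bullet> f x)" by (intro continuous_intros f)
    have "y \<bullet> (LINT x:{a..b}|lebesgue. f x) = (LINT x|lebesgue. indicator {a..b} x *\<^sub>R (y \<bullet> f x))"
      unfolding set_lebesgue_integral_def using int by (simp flip: integral_inner_right)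
    also have "\<dots> = (LINT x|lborel. indicator {a..b} x *\<^sub>R (y \<bullet> f x))"
      by (rule integral_completion) (use borel_integrable_compact[OF compact_Icc c] in auto)
    also have "\<dots> = y \<bullet> F b - y \<bullet> F a"
      using \<open>a \<le> b\<close> c F
      by (intro integral_FTC_atLeastAtMost bounded_linear.has_vector_derivative[OF bounded_linear_inner_right]) auto
    finally show ?thesis by (simp add: inner_diff_right)
  qed
  then show ?thesis by (meson inner_eq_zero_iff inner_diff_right right_minus_eq vector_eq_rdot vector_eq_ldot)
qed

text \<open>Integrate the derivative of \<open>semi (t - s) (w s)\<close> over s from 0 to
  t.\<close>

lemma duhamel_formula:
  fixes D :: "'a::{real_inner, banach, perfect_space, second_countable_topology} set"
  assumes "resolvent_family D A R M" and "0 \<le> t"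
    and w: "\<And>s. s \<in> {0..t} \<Longrightarrow> w s \<in> D"
    and w': "\<And>s. s \<in> {0..t} \<Longrightarrow> (w has_vector_derivative A (w s) + f s) (at s within {0..t})"
    and f: "continuous_on {0..t} f"
  shows "w t = resolvent_family.semi R t (w 0)
    + (LINT s:{0..t}|lebesgue. resolvent_family.semi R (t - s) (f s))"
proof -
  interpret resolvent_family D A R M by fact
  have "(LINT s:{0..t}|lebesgue. semi (t - s) (f s)) = semi (t - t) (w t) - semi (t - 0) (w 0)"
    by (rule set_lebesgue_integral_FTC[OF \<open>0 \<le> t\<close>])
      (auto intro!: semi_continuous_on continuous_intros f duhamel_derivative w w')
  then show ?thesis by (simp add: semi_0)
qed

text \<open>Carries the formula from regular initial data to arbitrary ones: the integrands converge
  pointwise and are dominated by the constant \<open>M * B\<close>.\<close>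

lemma duhamel_formula_limit:
  fixes D :: "'a::{real_inner, banach, perfect_space, second_countable_topology} set"
  assumes "resolvent_family D A R M" and "0 \<le> t"
    and f: "\<And>n. continuous_on {0..t} (f n)" "continuous_on {0..t} g"
    and lim: "\<And>s. s \<in> {0..t} \<Longrightarrow> (\<lambda>n. f n s) \<longlonglongrightarrow> g s"
    and bound: "\<And>n s. s \<in> {0..t} \<Longrightarrow> norm (f n s) \<le> B"
    and w: "\<And>n. w n = resolvent_family.semi R t (z n)
        + (LINT s:{0..t}|lebesgue. resolvent_family.semi R (t - s) (f n s))"
    and lim': "w \<longlonglongrightarrow> w'" "z \<longlonglongrightarrow> z'"
  shows "w' = resolvent_family.semi R t z'
    + (LINT s:{0..t}|lebesgue. resolvent_family.semi R (t - s) (g s))"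
proof -
  interpret resolvent_family D A R M by fact
  have int: "integrable lebesgue (\<lambda>s. indicator {0..t} s *\<^sub>R semi (t - s) (h s))"
    if "continuous_on {0..t} h" for h
    using that unfolding set_integrable_def[symmetric]
    by (intro set_integrable_continuous_lebesgue semi_continuous_on continuous_intros) auto
  have "(\<lambda>n. LINT s:{0..t}|lebesgue. semi (t - s) (f n s)) \<longlonglongrightarrow> (LINT s:{0..t}|lebesgue. semi (t - s) (g s))"
    unfolding set_lebesgue_integral_def
  proof (rule integral_dominated_convergence[where w="\<lambda>s. indicator {0..t} s *\<^sub>R (M * B)"])
    show "integrable lebesgue (\<lambda>s. indicator {0..t} s *\<^sub>R (M * B))"
      using set_integrable_continuous_lebesgue[of 0 t "\<lambda>_. M * B"] by (simp add: set_integrable_def)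
    show "AE s in lebesgue. (\<lambda>n. indicator {0..t} s *\<^sub>R semi (t - s) (f n s)) \<longlonglongrightarrow> indicator {0..t} s *\<^sub>R semi (t - s) (g s)"
      by (intro AE_I2) (auto split: split_indicator intro!: lim semi_tendsto)
    show "AE s in lebesgue. norm (indicator {0..t} s *\<^sub>R semi (t - s) (f n s)) \<le> indicator {0..t} s *\<^sub>R (M * B)" for n
    proof (intro AE_I2)
      fix s
      show "norm (indicator {0..t} s *\<^sub>R semi (t - s) (f n s)) \<le> indicator {0..t} s *\<^sub>R (M * B)"
        using norm_semi[of "t - s" "f n s"] mult_left_mono[OF bound[of s n] M_nonneg]
        by (auto split: split_indicator)
    qed
  qed (use int f in \<open>auto intro: borel_measurable_integrable\<close>)
  then have "w \<longlonglongrightarrow> semi t z' + (LINT s:{0..t}|lebesgue. semi (t - s) (g s))"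
    unfolding w using \<open>0 \<le> t\<close> by (intro tendsto_add semi_tendsto lim' tendsto_const) auto
  with lim'(1) show ?thesis by (rule LIMSEQ_unique)
qed

section \<open>Test functions and weak derivatives\<close>

abbreviation ddx :: "(real \<Rightarrow> complex) \<Rightarrow> real \<Rightarrow> complex" where
  "ddx \<phi> \<equiv> (\<lambda>x. vector_derivative \<phi> (at x))"

lemma inner_abs_L2:
  "square_integrable f \<Longrightarrow> square_integrable g \<Longrightarrow> abs_L2 f \<bullet> abs_L2 g = (\<integral>x. f x \<bullet> g x \<partial>I0pi)"
  by (simp add: inner_L2.abs_eq L2_rel_def)

lemma abs_L2_scaleR: "square_integrable f \<Longrightarrow> r *\<^sub>R abs_L2 f = abs_L2 (\<lambda>x. r *\<^sub>R f x)"
  by (simp add: scaleR_L2.abs_eq L2_rel_def)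

lemma abs_L2_zero: "abs_L2 (\<lambda>x. 0) = 0"
  by (simp add: zero_L2_def)

lemma square_integrable_mult:
  assumes "square_integrable f" "square_integrable g"
  shows "integrable I0pi (\<lambda>x. f x * g x)"
proof (rule Bochner_Integration.integrable_bound)
  note [measurable] = assms[THEN square_integrableD]
  show "integrable I0pi (\<lambda>x. (norm (f x))\<^sup>2 + (norm (g x))\<^sup>2)"
    using assms by (auto simp: square_integrable_def)
  show "AE x in I0pi. norm (f x * g x) \<le> norm ((norm (f x))\<^sup>2 + (norm (g x))\<^sup>2)"
  proof (rule AE_I2)
    fix x
    show "norm (f x * g x) \<le> norm ((norm (f x))\<^sup>2 + (norm (g x))\<^sup>2)"
      using sum_squares_bound[of "norm (f x)" "norm (g x)"]
        mult_nonneg_nonneg[OF norm_ge_zero[of "f x"] norm_ge_zero[of "g x"]]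
      unfolding norm_mult real_norm_def by linarith
  qed
qed (use assms[THEN square_integrableD] in measurable)

lemma continuous_measurable_I0pi:
  fixes f :: "real \<Rightarrow> 'a::{metric_space, second_countable_topology, real_normed_vector}"
  assumes "continuous_on UNIV f"
  shows "f \<in> borel_measurable I0pi"
  using borel_measurable_continuous_onI[OF assms]
  by (intro measurable_restrict_space1 measurable_completion) simp

lemma test_functionI:
  assumes "\<And>x. (\<phi> has_vector_derivative \<phi>' x) (at x)" "continuous_on UNIV \<phi>'"
    and "0 < a" "b < pi" "\<And>x. x \<notin> {a..b} \<Longrightarrow> \<phi> x = 0"
  shows "test_function \<phi>" "ddx \<phi> = \<phi>'"
proof -
  show "test_function \<phi>"
    unfolding test_function_def C1_differentiable_on_def
    using assms by (intro conjI exI[of _ \<phi>'] exI[of _ "{a..b}"]) auto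
  show "ddx \<phi> = \<phi>'" using assms(1) by (intro ext vector_derivative_at)
qed

lemma test_functionE:
  assumes "test_function \<phi>"
  obtains a b where "0 < a" "a \<le> b" "b < pi" "\<And>x. x \<notin> {a..b} \<Longrightarrow> \<phi> x = 0"
    "\<And>x. x \<notin> {a..b} \<Longrightarrow> ddx \<phi> x = 0"
    "\<And>x. (\<phi> has_vector_derivative ddx \<phi> x) (at x)" "continuous_on UNIV (ddx \<phi>)" "continuous_on UNIV \<phi>"
proof -
  have C1: "\<phi> C1_differentiable_on UNIV"
    using assms by (simp add: test_function_def)
  obtain K where K: "compact K" "K \<subseteq> {0<..<pi}" "\<And>x. x \<notin> K \<Longrightarrow> \<phi> x = 0"
    using assms by (auto simp: test_function_def)
  have "\<exists>a b. 0 < a \<and> a \<le> b \<and> b < pi \<and> K \<subseteq> {a..b}"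
  proof (cases "K = {}")
    case True
    \<comment> \<open>For the zero function the conclusion still asks for a nonempty interval;
      \<open>{1..1}\<close> lies inside because pi exceeds 3.\<close>
    then show ?thesis by (intro exI[of _ 1] exI[of _ 1]) (use pi_gt3 in auto)
  next
    case False
    obtain a where a: "a \<in> K" "\<And>x. x \<in> K \<Longrightarrow> a \<le> x" using compact_attains_inf[OF K(1) False] by blast
    obtain b where b: "b \<in> K" "\<And>x. x \<in> K \<Longrightarrow> x \<le> b" using compact_attains_sup[OF K(1) False] by blast
    show ?thesis by (intro exI[of _ a] exI[of _ b]) (use a b K(2) in auto)
  qed
  then obtain a b where ab: "0 < a" "a \<le> b" "b < pi" "K \<subseteq> {a..b}" by blast
  have z: "\<phi> x = 0" if "x \<notin> {a..b}" for x using K(3) ab(4) that by blast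
  have d: "(\<phi> has_vector_derivative ddx \<phi> x) (at x)" for x
    using C1 by (simp add: C1_differentiable_on_eq vector_derivative_works)
  have "ddx \<phi> x = 0" if "x \<notin> {a..b}" for x
  proof (rule vector_derivative_at)
    have "open (- {a..b})" by (simp add: open_Compl)
    then show "(\<phi> has_vector_derivative 0) (at x)"
      by (rule has_vector_derivative_transform_within_open[OF has_vector_derivative_const]) (use that z in auto)
  qed
  then show thesis
    using that[OF ab(1-3) z] d C1 C1_differentiable_imp_continuous_on[OF C1]
    by (simp add: C1_differentiable_on_eq)
qed

lemma square_integrable_continuous_support:
  assumes "continuous_on UNIV f" "\<And>x. x \<notin> {a..b} \<Longrightarrow> f x = 0"
  shows "square_integrable f"
proof -
  have "bounded (f ` {a..b})"
    using compact_continuous_image[OF continuous_on_subset[OF assms(1)] compact_Icc] compact_imp_bounded by auto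
  then obtain B where B: "\<And>x. x \<in> {a..b} \<Longrightarrow> norm (f x) \<le> B"
    by (meson bounded_iff imageI)
  show ?thesis
  proof (rule square_integrable_bounded[where B="max B 0"])
    show "norm (f x) \<le> max B 0" for x using B[of x] assms(2)[of x] by (cases "x \<in> {a..b}") auto
  qed (rule continuous_measurable_I0pi[OF assms(1)])
qed

lemma test_function_square_integrable:
  assumes "test_function \<phi>"
  shows "square_integrable \<phi>" "square_integrable (ddx \<phi>)"
  using test_functionE[OF assms] square_integrable_continuous_support by metis+

lemma test_function_cmult:
  assumes "test_function \<phi>"
  shows "test_function (\<lambda>x. c * \<phi> x)" "ddx (\<lambda>x. c * \<phi> x) = (\<lambda>x. c * ddx \<phi> x)"
proof -
  obtain a b where ab: "0 < a" "b < pi" "\<And>x. x \<notin> {a..b} \<Longrightarrow> \<phi> x = 0"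
    "\<And>x. (\<phi> has_vector_derivative ddx \<phi> x) (at x)" "continuous_on UNIV (ddx \<phi>)"
    using test_functionE[OF assms] by metis
  have "((\<lambda>x. c * \<phi> x) has_vector_derivative c * ddx \<phi> x) (at x)" for x
    using ab(4) by (rule has_vector_derivative_mult_right)
  note d = this
  have "continuous_on UNIV (\<lambda>x. c * ddx \<phi> x)" by (intro continuous_intros ab(5))
  from test_functionI[OF d this ab(1,2)] show "test_function (\<lambda>x. c * \<phi> x)" "ddx (\<lambda>x. c * \<phi> x) = (\<lambda>x. c * ddx \<phi> x)"
    using ab(3) by auto
qed

lemma test_function_cnj:
  assumes "test_function \<phi>"
  shows "test_function (\<lambda>x. cnj (\<phi> x))" "ddx (\<lambda>x. cnj (\<phi> x)) = (\<lambda>x. cnj (ddx \<phi> x))"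
proof -
  obtain a b where ab: "0 < a" "b < pi" "\<And>x. x \<notin> {a..b} \<Longrightarrow> \<phi> x = 0"
    "\<And>x. (\<phi> has_vector_derivative ddx \<phi> x) (at x)" "continuous_on UNIV (ddx \<phi>)"
    using test_functionE[OF assms] by metis
  have "((\<lambda>x. cnj (\<phi> x)) has_vector_derivative cnj (ddx \<phi> x)) (at x)" for x
    using ab(4) by (rule bounded_linear.has_vector_derivative[OF bounded_linear_cnj])
  note d = this
  have "continuous_on UNIV (\<lambda>x. cnj (ddx \<phi> x))" by (intro continuous_intros ab(5))
  from test_functionI[OF d this ab(1,2)] show "test_function (\<lambda>x. cnj (\<phi> x))" "ddx (\<lambda>x. cnj (\<phi> x)) = (\<lambda>x. cnj (ddx \<phi> x))"
    using ab(3) by auto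
qed

lemma test_function_add:
  assumes "test_function \<phi>" "test_function \<psi>"
  shows "test_function (\<lambda>x. \<phi> x + \<psi> x)" "ddx (\<lambda>x. \<phi> x + \<psi> x) = (\<lambda>x. ddx \<phi> x + ddx \<psi> x)"
proof -
  obtain a b where ab: "0 < a" "b < pi" "\<And>x. x \<notin> {a..b} \<Longrightarrow> \<phi> x = 0"
    "\<And>x. (\<phi> has_vector_derivative ddx \<phi> x) (at x)" "continuous_on UNIV (ddx \<phi>)"
    using test_functionE[OF assms(1)] by metis
  obtain c d where cd: "0 < c" "d < pi" "\<And>x. x \<notin> {c..d} \<Longrightarrow> \<psi> x = 0"
    "\<And>x. (\<psi> has_vector_derivative ddx \<psi> x) (at x)" "continuous_on UNIV (ddx \<psi>)"
    using test_functionE[OF assms(2)] by metis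
  have "((\<lambda>x. \<phi> x + \<psi> x) has_vector_derivative ddx \<phi> x + ddx \<psi> x) (at x)" for x
    using ab(4) cd(4) by (rule has_vector_derivative_add)
  note d = this
  have "continuous_on UNIV (\<lambda>x. ddx \<phi> x + ddx \<psi> x)" by (intro continuous_intros ab(5) cd(5))
  moreover have "\<phi> x + \<psi> x = 0" if "x \<notin> {min a c..max b d}" for x
    using ab(3)[of x] cd(3)[of x] that by (auto simp: min_le_iff_disj le_max_iff_disj)
  ultimately show "test_function (\<lambda>x. \<phi> x + \<psi> x)" "ddx (\<lambda>x. \<phi> x + \<psi> x) = (\<lambda>x. ddx \<phi> x + ddx \<psi> x)"
    using test_functionI[OF d, of "min a c" "max b d"] ab(1,2) cd(1,2) by auto
qed

lemma integral_I0pi_support: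
  fixes f :: "real \<Rightarrow> 'a::euclidean_space"
  assumes f: "continuous_on UNIV f" and "0 < a" "b < pi" "\<And>x. x \<notin> {a..b} \<Longrightarrow> f x = 0"
  shows "(\<integral>x. f x \<partial>I0pi) = integral\<^sup>L lborel (\<lambda>x. indicator {a..b} x *\<^sub>R f x)"
proof -
  have "(\<integral>x. f x \<partial>I0pi) = (\<integral>x. indicator {0<..<pi} x *\<^sub>R f x \<partial>lebesgue)"
    by (rule integral_restrict_space) auto
  also have "\<dots> = (\<integral>x. indicator {a..b} x *\<^sub>R f x \<partial>lebesgue)"
    by (intro Bochner_Integration.integral_cong) (use assms in \<open>auto split: split_indicator\<close>)
  also have "\<dots> = (\<integral>x. indicator {a..b} x *\<^sub>R f x \<partial>lborel)"
    using borel_measurable_continuous_onI[OF f] by (intro integral_completion) auto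
  finally show ?thesis .
qed

lemma integral_derivative_compact_support:
  fixes f :: "real \<Rightarrow> 'a::euclidean_space"
  assumes "\<And>x. (f has_vector_derivative f' x) (at x)" "continuous_on UNIV f'"
    and "0 < a" "a \<le> b" "b < pi" "\<And>x. x \<notin> {a..b} \<Longrightarrow> f x = 0" "\<And>x. x \<notin> {a..b} \<Longrightarrow> f' x = 0"
  shows "(\<integral>x. f' x \<partial>I0pi) = 0"
proof -
  \<comment> \<open>The hypotheses give zeros of f only off \<open>{a..b}\<close>, so the
    fundamental theorem is applied on a larger interval, at whose ends f is known to vanish.\<close>
  define c d where "c = a / 2" "d = (b + pi) / 2"
  have cd: "0 < c" "c < a" "b < d" "d < pi" "c \<le> d" using assms(3-5) by (auto simp: c_d_def)
  have "(\<integral>x. f' x \<partial>I0pi) = integral\<^sup>L lborel (\<lambda>x. indicator {c..d} x *\<^sub>R f' x)"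
    using cd assms by (intro integral_I0pi_support) auto
  also have "\<dots> = f d - f c"
    using cd assms by (intro integral_FTC_atLeastAtMost)
      (auto intro: has_vector_derivative_at_within continuous_on_subset)
  also have "\<dots> = 0" using cd assms(6)[of c] assms(6)[of d] by simp
  finally show ?thesis .
qed

text \<open>Conjugates and multiples by \<open>\<i>\<close> of test functions are test functions, so the complex bilinear pairing
  can be replaced by the real inner product.\<close>

lemma has_weak_deriv_iff_inner:
  "has_weak_deriv f g \<longleftrightarrow>
    (\<forall>\<phi>. test_function \<phi> \<longrightarrow> f \<bullet> abs_L2 (ddx \<phi>) = - (g \<bullet> abs_L2 \<phi>))"
proof -
  obtain F where F: "square_integrable F" "f = abs_L2 F" by (rule L2_cases)
  obtain G where G: "square_integrable G" "g = abs_L2 G" by (rule L2_cases)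
  have Re: "abs_L2 F \<bullet> abs_L2 (\<lambda>x. cnj (h x)) = Re (\<integral>x. F x * h x \<partial>I0pi)"
    and cnj: "square_integrable (\<lambda>x. cnj (h x))"
    if "square_integrable F" "square_integrable h" for F h
  proof -
    show "square_integrable (\<lambda>x. cnj (h x))"
      using that(2) unfolding square_integrable_def
      by (auto intro: borel_measurable_continuous_on[OF continuous_on_cnj[OF continuous_on_id]])
    then have "abs_L2 F \<bullet> abs_L2 (\<lambda>x. cnj (h x)) = (\<integral>x. F x \<bullet> cnj (h x) \<partial>I0pi)"
      using that by (intro inner_abs_L2)
    also have "\<dots> = (\<integral>x. Re (F x * h x) \<partial>I0pi)"
      by (simp add: inner_complex_def)
    also have "\<dots> = Re (\<integral>x. F x * h x \<partial>I0pi)"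
      by (rule integral_Re[OF square_integrable_mult[OF that]])
    finally show "abs_L2 F \<bullet> abs_L2 (\<lambda>x. cnj (h x)) = Re (\<integral>x. F x * h x \<partial>I0pi)" .
  qed
  have *: "has_weak_deriv f g \<longleftrightarrow> (\<forall>\<phi>. test_function \<phi> \<longrightarrow>
     (\<integral>x. F x * ddx \<phi> x \<partial>I0pi) = - (\<integral>x. G x * \<phi> x \<partial>I0pi))"
    unfolding F(2) G(2) using F(1) G(1) by (subst has_weak_deriv.abs_eq) (auto simp: L2_rel_def)
  show ?thesis
  proof
    assume "has_weak_deriv f g"
    show "\<forall>\<phi>. test_function \<phi> \<longrightarrow> f \<bullet> abs_L2 (ddx \<phi>) = - (g \<bullet> abs_L2 \<phi>)"
    proof (intro allI impI)
      fix \<phi> assume \<phi>: "test_function \<phi>"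
      define \<psi> where "\<psi> x = cnj (\<phi> x)" for x
      have \<psi>: "test_function \<psi>" "ddx \<psi> = (\<lambda>x. cnj (ddx \<phi> x))"
        using test_function_cnj[OF \<phi>] by (auto simp: \<psi>_def[abs_def])
      have "f \<bullet> abs_L2 (\<lambda>x. cnj (ddx \<psi> x)) = - (g \<bullet> abs_L2 (\<lambda>x. cnj (\<psi> x)))"
        using *[THEN iffD1, OF \<open>has_weak_deriv f g\<close>, rule_format, OF \<psi>(1)]
          test_function_square_integrable[OF \<psi>(1)]
        unfolding F(2) G(2) by (simp add: Re F(1) G(1))
      then show "f \<bullet> abs_L2 (ddx \<phi>) = - (g \<bullet> abs_L2 \<phi>)" 

        by (simp add: \<psi>_def[abs_def] fun_cong[OF test_function_cnj(2)[OF \<phi>]])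
    qed
  next
    assume R: "\<forall>\<phi>. test_function \<phi> \<longrightarrow> f \<bullet> abs_L2 (ddx \<phi>) = - (g \<bullet> abs_L2 \<phi>)"
    have Re_eq: "Re (\<integral>x. F x * ddx \<phi> x \<partial>I0pi) = - Re (\<integral>x. G x * \<phi> x \<partial>I0pi)" if \<phi>: "test_function \<phi>" for \<phi>
      using R[rule_format, OF test_function_cnj(1)[OF \<phi>]] test_function_square_integrable[OF \<phi>]
        Re[OF F(1)] Re[OF G(1)]
      by (simp add: F(2) G(2) test_function_cnj(2)[OF \<phi>])
    show "has_weak_deriv f g"
      unfolding *
    proof (intro allI impI complex_eqI)
      fix \<phi> assume \<phi>: "test_function \<phi>"
      show "Re (\<integral>x. F x * ddx \<phi> x \<partial>I0pi) = Re (- (\<integral>x. G x * \<phi> x \<partial>I0pi))"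
        using Re_eq[OF \<phi>] by simp
      show "Im (\<integral>x. F x * ddx \<phi> x \<partial>I0pi) = Im (- (\<integral>x. G x * \<phi> x \<partial>I0pi))"
        using Re_eq[OF test_function_cmult(1)[OF \<phi>, of "\<i>"]]
        by (simp add: fun_cong[OF test_function_cmult(2)[OF \<phi>]] mult.left_commute[of _ \<i>])
    qed
  qed
qed

lemma has_weak_deriv_test_function:
  assumes "test_function \<phi>"
  shows "has_weak_deriv (abs_L2 \<phi>) (abs_L2 (ddx \<phi>))"
  unfolding has_weak_deriv_iff_inner
proof (intro allI impI)
  fix \<psi> assume \<psi>: "test_function \<psi>"
  note sq = test_function_square_integrable[OF assms] test_function_square_integrable[OF \<psi>]
  obtain a b where ab: "0 < a" "a \<le> b" "b < pi" "\<And>x. x \<notin> {a..b} \<Longrightarrow> \<phi> x = 0" "\<And>x. x \<notin> {a..b} \<Longrightarrow> ddx \<phi> x = 0"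
    "\<And>x. (\<phi> has_vector_derivative ddx \<phi> x) (at x)" "continuous_on UNIV (ddx \<phi>)" "continuous_on UNIV \<phi>"
    using test_functionE[OF assms] by metis
  have \<psi>d: "\<And>x. (\<psi> has_vector_derivative ddx \<psi> x) (at x)" "continuous_on UNIV (ddx \<psi>)" "continuous_on UNIV \<psi>"
    using test_functionE[OF \<psi>] by metis+
  have "(\<integral>x. \<phi> x \<bullet> ddx \<psi> x + ddx \<phi> x \<bullet> \<psi> x \<partial>I0pi) = 0"
  proof (rule integral_derivative_compact_support[OF _ _ ab(1-3)])
    show "((\<lambda>x. \<phi> x \<bullet> \<psi> x) has_vector_derivative \<phi> x \<bullet> ddx \<psi> x + ddx \<phi> x \<bullet> \<psi> x) (at x)" for x
      by (rule bounded_bilinear.has_vector_derivative[OF bounded_bilinear_inner ab(6) \<psi>d(1)])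
    show "continuous_on UNIV (\<lambda>x. \<phi> x \<bullet> ddx \<psi> x + ddx \<phi> x \<bullet> \<psi> x)"
      by (intro continuous_intros ab \<psi>d)
  qed (use ab in auto)
  then show "abs_L2 \<phi> \<bullet> abs_L2 (ddx \<psi>) = - (abs_L2 (ddx \<phi>) \<bullet> abs_L2 \<psi>)"
    using sq by (simp add: inner_abs_L2 square_integrable_inner)
qed


section \<open>Density of test functions in the space of square integrable functions\<close>

lemma cutoff_C1:
  assumes "0 < \<epsilon>"
  obtains \<eta> \<eta>' :: "real \<Rightarrow> real" and a b where "0 < a" "b < pi" "\<And>x. x \<notin> {a..b} \<Longrightarrow> \<eta> x = 0"
    "\<And>x. (\<eta> has_real_derivative \<eta>' x) (at x)" "continuous_on UNIV \<eta>'"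
    "\<And>x. \<bar>\<eta> x\<bar> \<le> 1" "\<And>x. \<eta> x = (max 0 (x * (pi - x) - \<epsilon>))\<^sup>2 / ((max 0 (x * (pi - x) - \<epsilon>))\<^sup>2 + \<epsilon>)"
proof -
  \<comment> \<open>Squaring the positive part makes it continuously differentiable; 0 is the only
    delicate point.\<close>
  have sq: "((\<lambda>t. (max 0 t)\<^sup>2) has_real_derivative 2 * max 0 t) (at t)" for t :: real
  proof (cases "t = 0")
    case True
    have "((\<lambda>h::real. (max 0 h)\<^sup>2 / h) \<longlongrightarrow> 0) (at 0)"
    proof (rule Lim_null_comparison)
      show "\<forall>\<^sub>F h::real in at 0. norm ((max 0 h)\<^sup>2 / h) \<le> \<bar>h\<bar>"
        by (rule always_eventually) (auto simp: max_def power2_eq_square)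
    qed (auto intro!: tendsto_eq_intros)
    then show ?thesis using True by (simp add: DERIV_def)
  next
    case False
    then consider "t > 0" | "t < 0" by linarith
    then show ?thesis
    proof cases
      case 1
      have "((\<lambda>t. t\<^sup>2) has_real_derivative 2 * t) (at t)" by (auto intro!: derivative_eq_intros)
      then have "((\<lambda>t. (max 0 t)\<^sup>2) has_real_derivative 2 * t) (at t)"
        by (rule has_field_derivative_transform_within_open[of _ _ _ "{0<..}"]) (use 1 in auto)
      then show ?thesis using 1 by simp
    next
      case 2
      have "((\<lambda>t. (max 0 t)\<^sup>2) has_real_derivative 0) (at t)"
        by (rule has_field_derivative_transform_within_open[OF DERIV_const open_lessThan[of 0]]) (use 2 in auto)
      then show ?thesis using 2 by simp
    qed
  qed
  define r where "r x = x * (pi - x) - \<epsilon>" for x :: real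
  define q where "q x = (max 0 (r x))\<^sup>2" for x
  define q' where "q' x = 2 * max 0 (r x) * (pi - 2 * x)" for x
  have r': "(r has_real_derivative (pi - 2 * x)) (at x)" for x
    unfolding r_def by (auto intro!: derivative_eq_intros)
  have q': "(q has_real_derivative q' x) (at x)" for x
    using DERIV_chain2[OF sq r'[of x]] unfolding q_def[abs_def] q'_def by simp
  have qpos: "q x + \<epsilon> > 0" for x using assms by (simp add: q_def add_nonneg_pos)
  have qnz: "q x + \<epsilon> \<noteq> 0" for x using qpos[of x] by simp
  have cr: "continuous_on UNIV r" unfolding r_def by (intro continuous_intros)
  have cq: "continuous_on UNIV q" unfolding q_def by (intro continuous_intros cr)
  show thesis
  \<comment> \<open>The parabola \<open>x * (pi - x)\<close> exceeds \<epsilon> only inside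
    \<open>{\<epsilon> / pi..pi - \<epsilon> / pi}\<close>, which confines the support. The quotient
    stays below 1 and tends to 1 at every interior point as \<epsilon> tends to 0.\<close>
  proof (rule that[of "\<epsilon> / pi" "pi - \<epsilon> / pi" "\<lambda>x. q x / (q x + \<epsilon>)" "\<lambda>x. (q' x * (q x + \<epsilon>) - q x * q' x) / (q x + \<epsilon>)\<^sup>2"])
    show "q x / (q x + \<epsilon>) = 0" if "x \<notin> {\<epsilon> / pi..pi - \<epsilon> / pi}" for x
    proof -
      have "x * (pi - x) \<le> \<epsilon>"
      proof (cases "0 \<le> x \<and> x \<le> pi")
        case True
        have "x * pi < \<epsilon> \<or> (pi - x) * pi < \<epsilon>" using that by (auto simp: field_simps not_le)
        moreover have "x * (pi - x) \<le> x * pi" "x * (pi - x) \<le> pi * (pi - x)"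
          using True by (auto intro: mult_left_mono mult_right_mono)
        ultimately show ?thesis by (auto simp: mult.commute)
      next
        case False
        then consider "x < 0" | "pi < x" by linarith
        then have "x * (pi - x) \<le> 0"
        proof cases
          case 1
          then have "0 \<le> pi - x" using pi_gt_zero by linarith
          then show ?thesis using 1 by (intro mult_nonpos_nonneg) auto
        next
          case 2
          then have "0 \<le> x" using pi_gt_zero by linarith
          then show ?thesis using 2 by (intro mult_nonneg_nonpos) auto
        qed
        then show ?thesis using assms by linarith
      qed
      then show ?thesis by (simp add: q_def r_def)
    qed
    show "((\<lambda>x. q x / (q x + \<epsilon>)) has_real_derivative (q' x * (q x + \<epsilon>) - q x * q' x) / (q x + \<epsilon>)\<^sup>2) (at x)" for x
      using qnz[of x] by (auto intro!: derivative_eq_intros q' simp: power2_eq_square)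
    show "continuous_on UNIV (\<lambda>x. (q' x * (q x + \<epsilon>) - q x * q' x) / (q x + \<epsilon>)\<^sup>2)"
      unfolding q'_def using qnz by (intro continuous_intros cq cr) auto
    show "\<bar>q x / (q x + \<epsilon>)\<bar> \<le> 1" for x
      using qpos[of x] assms by (simp add: q_def)
  qed (use assms in \<open>auto simp: q_def r_def\<close>)
qed

text \<open>A measurable function is almost everywhere a limit of continuous ones. These are clamped
  to the ball of radius B, replaced by polynomials to gain a derivative, and multiplied by cut-offs
  to gain compact support; thanks to the clamping, \<open>B + 1\<close> dominates all of
  them.\<close>

lemma bounded_in_closure_test_functions:
  assumes f: "f \<in> borel_measurable I0pi" and B: "\<And>x. norm (f x) \<le> B" "0 < B"
  shows "abs_L2 f \<in> closure (abs_L2 ` Collect test_function)"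
proof -
  have "f measurable_on {0<..<pi}" using f by (simp add: measurable_on_iff_borel_measurable)
  then obtain N g where N: "negligible N" and g: "\<And>n. continuous_on UNIV (g n)"
    and gf: "\<And>x. x \<notin> N \<Longrightarrow> (\<lambda>n. g n x) \<longlonglongrightarrow> (if x \<in> {0<..<pi} then f x else 0)"
    unfolding measurable_on_def by blast
  \<comment> \<open>The radial retraction onto the closed ball of radius B; it fixes the values of
    f.\<close>
  define \<tau> where "\<tau> z = (B / max B (norm z)) *\<^sub>R z" for z :: complex
  have \<tau>B: "norm (\<tau> z) \<le> B" for z
  proof -
    have "B * norm z \<le> B * max B (norm z)" using B(2) by (intro mult_left_mono) auto
    then show ?thesis using B(2) by (simp add: \<tau>_def divide_le_eq max_def)
  qed
  have \<tau>id: "\<tau> z = z" if "norm z \<le> B" for z using that B(2) by (simp add: \<tau>_def max_def)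
  have \<tau>c: "continuous_on UNIV \<tau>"
    unfolding \<tau>_def using B(2) by (intro continuous_intros) (auto simp: max_def)
  have "\<exists>p. polynomial_function p \<and> (\<forall>x\<in>{0..pi}. norm (\<tau> (g n x) - p x) < 1 / real (Suc n))" for n
    by (rule Stone_Weierstrass_polynomial_function)
      (auto intro!: continuous_on_compose2[OF \<tau>c] continuous_on_subset[OF g])
  then obtain p where p: "\<And>n. polynomial_function (p n)"
    "\<And>n x. x \<in> {0..pi} \<Longrightarrow> norm (\<tau> (g n x) - p n x) < 1 / real (Suc n)" by metis
  define \<eta> where "\<eta> n x = (max 0 (x * (pi - x) - 1 / real (Suc n)))\<^sup>2
      / ((max 0 (x * (pi - x) - 1 / real (Suc n)))\<^sup>2 + 1 / real (Suc n))" for n and x :: real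
  define \<phi> where "\<phi> n x = of_real (\<eta> n x) * p n x" for n x
  have \<eta>1: "\<bar>\<eta> n x\<bar> \<le> 1" for n x
    by (rule cutoff_C1[of "1 / real (Suc n)"]) (auto simp: \<eta>_def)
  have \<phi>: "test_function (\<phi> n)" for n
  proof -
    obtain h h' a b where h: "0 < a" "b < pi" "\<And>x. x \<notin> {a..b} \<Longrightarrow> h x = 0"
      "\<And>x. (h has_real_derivative h' x) (at x)" "continuous_on UNIV h'"
      "\<And>x. h x = \<eta> n x"
      unfolding \<eta>_def by (rule cutoff_C1[of "1 / real (Suc n)"]) auto
    obtain p' where p': "polynomial_function p'" "\<And>x. (p n has_vector_derivative p' x) (at x)"
      using has_vector_derivative_polynomial_function[OF p(1)] by metis
    have hc: "continuous_on UNIV h" using h(4) by (meson DERIV_isCont continuous_at_imp_continuous_on)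
    have "(\<phi> n has_vector_derivative of_real (h x) * p' x + of_real (h' x) * p n x) (at x)" for x
      unfolding \<phi>_def[abs_def] h(6)[symmetric]
      by (intro has_vector_derivative_mult p' bounded_linear.has_vector_derivative[OF bounded_linear_of_real])
        (use h(4) in \<open>simp add: has_real_derivative_iff_has_vector_derivative\<close>)
    moreover have "continuous_on UNIV (\<lambda>x. of_real (h x) * p' x + of_real (h' x) * p n x)"
      by (intro continuous_intros hc h continuous_on_polymonial_function p p')
    ultimately show ?thesis
      by (rule test_functionI(1)[OF _ _ h(1,2)]) (use h in \<open>simp add: \<phi>_def\<close>)
  qed
  have inv: "(\<lambda>n. 1 / real (Suc n)) \<longlonglongrightarrow> 0" by (rule LIMSEQ_Suc[OF lim_1_over_n])
  have lim: "(\<lambda>n. \<phi> n x) \<longlonglongrightarrow> f x" if x: "x \<in> {0<..<pi}" "x \<notin> N" for x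
  proof -
    have "(\<lambda>n. \<tau> (g n x)) \<longlonglongrightarrow> \<tau> (f x)"
      using gf[OF x(2)] x(1) \<tau>c by (intro isCont_tendsto_compose[of _ \<tau>]) (auto simp: continuous_on_eq_continuous_at)
    moreover have "(\<lambda>n. p n x - \<tau> (g n x)) \<longlonglongrightarrow> 0"
      by (rule Lim_null_comparison[OF always_eventually inv])
        (use p(2)[of x] x(1) in \<open>auto simp: norm_minus_commute less_imp_le\<close>)
    ultimately have "(\<lambda>n. (p n x - \<tau> (g n x)) + \<tau> (g n x)) \<longlonglongrightarrow> 0 + \<tau> (f x)"
      by (intro tendsto_add)
    then have px: "(\<lambda>n. p n x) \<longlonglongrightarrow> f x" using \<tau>id[OF B(1)] by simp
    have pos: "x * (pi - x) > 0" using x by simp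
    have "(\<lambda>n. \<eta> n x) \<longlonglongrightarrow> (max 0 (x * (pi - x) - 0))\<^sup>2 / ((max 0 (x * (pi - x) - 0))\<^sup>2 + 0)"
      unfolding \<eta>_def using pos by (intro tendsto_intros inv) auto
    then have "(\<lambda>n. \<eta> n x) \<longlonglongrightarrow> 1" using pos x by (simp split: if_splits)
    then have "(\<lambda>n. of_real (\<eta> n x) * p n x) \<longlonglongrightarrow> of_real 1 * f x"
      by (intro tendsto_mult tendsto_of_real px)
    then show ?thesis by (simp add: \<phi>_def)
  qed
  have \<phi>B: "norm (\<phi> n x) \<le> B + 1" if "x \<in> {0<..<pi}" for n x
  proof -
    have "norm (p n x) \<le> norm (\<tau> (g n x)) + norm (\<tau> (g n x) - p n x)"
      by (metis norm_minus_commute norm_triangle_sub)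
    also have "\<dots> \<le> B + 1 / real (Suc n)" using p(2)[of x n] that \<tau>B[of "g n x"] by auto
    also have "\<dots> \<le> B + 1" by simp
    finally have "norm (p n x) \<le> B + 1" .
    then have "\<bar>\<eta> n x\<bar> * norm (p n x) \<le> 1 * (B + 1)" by (intro mult_mono \<eta>1) auto
    then show ?thesis by (simp add: \<phi>_def norm_mult)
  qed
  \<comment> \<open>The dominated limit is stated for convergence at every point, so all functions
    are set to 0 on the null set N, which does not change their classes.\<close>
  define cut where "cut h x = (if x \<in> N then 0 else h x)" for h :: "real \<Rightarrow> complex" and x
  have N': "N \<in> sets lebesgue" "AE x in I0pi. x \<notin> N"
    using N by (auto simp: negligible_iff_null_sets AE_restrict_space_iff intro!: AE_not_in eventually_mono[OF AE_not_in[of N lebesgue]])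
  have cut_meas: "cut h \<in> borel_measurable I0pi" if "h \<in> borel_measurable I0pi" for h
    unfolding cut_def using that N'(1) by (intro measurable_If_set) (auto simp: sets_restrict_space)
  have cut_eq: "abs_L2 (cut h) = abs_L2 h" if "square_integrable h" "\<And>x. norm (cut h x) \<le> norm (h x)" for h
  proof (rule abs_L2_cong)
    show "AE x in I0pi. cut h x = h x" using N'(2) by eventually_elim (simp add: cut_def)
    show "square_integrable (cut h)"
      using that cut_meas[OF square_integrableD[OF that(1)]] unfolding square_integrable_def
      by (auto intro!: Bochner_Integration.integrable_bound[of I0pi "\<lambda>x. (norm (h x))\<^sup>2"] power_mono)
  qed (fact that)
  have sqf: "square_integrable f" using f B(1) by (rule square_integrable_bounded)
  have "(\<lambda>n. abs_L2 (cut (\<phi> n))) \<longlonglongrightarrow> abs_L2 (cut f)"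
  proof (rule abs_L2_dominated_limit[where h="\<lambda>x. of_real (B + 1)"])
    show "square_integrable (\<lambda>x. of_real (B + 1))"
      by (rule square_integrable_bounded[where B="\<bar>B + 1\<bar>"]) auto
    show "(\<lambda>n. cut (\<phi> n) x) \<longlonglongrightarrow> cut f x" if "x \<in> {0<..<pi}" for x
      using lim[OF that] by (auto simp: cut_def)
    show "norm (cut (\<phi> n) x) \<le> norm (complex_of_real (B + 1))" if "x \<in> {0<..<pi}" for n x
      using \<phi>B[OF that, of n] B(2) unfolding norm_of_real by (auto simp: cut_def)
  qed (intro cut_meas f square_integrableD test_function_square_integrable(1) \<phi>)+
  then have "(\<lambda>n. abs_L2 (\<phi> n)) \<longlonglongrightarrow> abs_L2 f"
    using sqf test_function_square_integrable(1)[OF \<phi>] by (simp add: cut_eq cut_def)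
  then show ?thesis
    unfolding closure_sequential using \<phi> by (intro exI[of _ "\<lambda>n. abs_L2 (\<phi> n)"]) auto
qed

lemma test_functions_dense: "closure (abs_L2 ` Collect test_function) = UNIV"
proof -
  have "F \<in> closure (abs_L2 ` Collect test_function)" for F
  proof (cases F rule: L2_cases)
    case (1 f)
    note [measurable] = square_integrableD[OF 1(1)]
    define g where "g n x = (if norm (f x) \<le> real n then f x else 0)" for n :: nat and x
    have g: "g n \<in> borel_measurable I0pi" for n unfolding g_def by measurable
    have "(\<lambda>n. abs_L2 (g n)) \<longlonglongrightarrow> abs_L2 f"
    proof (rule abs_L2_dominated_limit[OF g _ 1(1)])
      fix x
      obtain n0 where "norm (f x) \<le> real n0" using real_arch_simple by blast
      then have "\<forall>\<^sub>F n in sequentially. f x = g n x"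
        by (auto simp: g_def eventually_sequentially intro!: exI[of _ n0])
      then show "(\<lambda>n. g n x) \<longlonglongrightarrow> f x" by (rule Lim_transform_eventually[OF tendsto_const])
    qed (auto simp: g_def)
    \<comment> \<open>The bound \<open>real n + 1\<close> is positive also at n = 0.\<close>
    moreover have "abs_L2 (g n) \<in> closure (abs_L2 ` Collect test_function)" for n
      by (rule bounded_in_closure_test_functions[OF g, where B="real n + 1"]) (auto simp: g_def)
    ultimately show ?thesis
      unfolding 1(2) by (metis closed_closure closed_sequentially)
  qed
  then show ?thesis by blast
qed

section \<open>Uniqueness and closedness of the weak derivative\<close>

lemma dense_inner_eq_0:
  fixes g :: "'a::real_inner"
  assumes "closure D = UNIV" "\<And>x. x \<in> D \<Longrightarrow> g \<bullet> x = 0"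
  shows "g = 0"
proof -
  have "closure D \<subseteq> {x. g \<bullet> x = 0}"
    by (rule closure_minimal) (use assms(2) in \<open>auto intro!: closed_Collect_eq continuous_intros\<close>)
  then have "g \<bullet> g = 0" using assms(1) by blast
  then show ?thesis by simp
qed

lemma has_weak_deriv_unique:
  assumes "has_weak_deriv f g" "has_weak_deriv f h"
  shows "g = h"
proof -
  have "(g - h) \<bullet> x = 0" if "x \<in> abs_L2 ` Collect test_function" for x
    using assms that by (auto simp: has_weak_deriv_iff_inner inner_diff_left)
  then show ?thesis using dense_inner_eq_0[OF test_functions_dense] by fastforce
qed

lemma weak_deriv_eq: "has_weak_deriv f g \<Longrightarrow> weak_deriv f = g"
  unfolding weak_deriv_def using has_weak_deriv_unique by blast

lemma H1_I: "has_weak_deriv f g \<Longrightarrow> f \<in> H1"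
  by (auto simp: H1_def)

lemma has_weak_deriv_weak_deriv: "f \<in> H1 \<Longrightarrow> has_weak_deriv f (weak_deriv f)"
  using weak_deriv_eq by (auto simp: H1_def)

lemma has_weak_deriv_add:
  "has_weak_deriv f f' \<Longrightarrow> has_weak_deriv g g' \<Longrightarrow> has_weak_deriv (f + g) (f' + g')"
  by (auto simp: has_weak_deriv_iff_inner inner_add_left)

lemma has_weak_deriv_scaleR: "has_weak_deriv f f' \<Longrightarrow> has_weak_deriv (r *\<^sub>R f) (r *\<^sub>R f')"
  by (auto simp: has_weak_deriv_iff_inner)

text \<open>Each test function contributes an equation between continuous functions of the pair.
  This is what lets identities pass from test functions to limits.\<close>

lemma has_weak_deriv_closed: "closed {(f, g). has_weak_deriv f g}"
  unfolding has_weak_deriv_iff_inner case_prod_beta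
  by (intro closed_Collect_all closed_Collect_imp open_Collect_const closed_Collect_eq continuous_intros)

instance L2 :: perfect_space
proof
  fix x :: L2
  have "(\<integral>x. (1::complex) \<bullet> 1 \<partial>I0pi) = pi" by (simp add: measure_restrict_space)
  moreover have "square_integrable (\<lambda>x. 1)" by (rule square_integrable_bounded[where B=1]) auto
  ultimately have "abs_L2 (\<lambda>x. 1) \<bullet> abs_L2 (\<lambda>x. 1) = pi" by (simp add: inner_abs_L2)
  then have "abs_L2 (\<lambda>x. 1) \<noteq> 0" by auto
  then show "\<not> open {x}" by (rule not_open_singleton_normed)
qed

subsection \<open>Constants and means\<close>

text \<open>The inner product is real, so the complex constants form a plane with the orthogonal
  basis \<open>L2_one\<close>, \<open>L2_ii\<close>, and the complex mean amounts to two real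
  functionals.\<close>

definition L2_one :: L2 where "L2_one = abs_L2 (\<lambda>x. 1)"
definition L2_ii :: L2 where "L2_ii = abs_L2 (\<lambda>x. \<i>)"

lemma square_integrable_const: "square_integrable (\<lambda>x. c)"
  by (rule square_integrable_bounded[where B="norm c"]) auto

lemma inner_constants: "L2_one \<bullet> L2_one = pi" "L2_ii \<bullet> L2_ii = pi" "L2_one \<bullet> L2_ii = 0" "L2_ii \<bullet> L2_one = 0"
  by (simp_all add: L2_one_def L2_ii_def inner_abs_L2 square_integrable_const measure_restrict_space
      inner_complex_def)

lemma L2_integral_eq: "L2_integral f = Complex (f \<bullet> L2_one) (f \<bullet> L2_ii)"
proof (cases f rule: L2_cases)
  case (1 F)
  have "integrable I0pi (\<lambda>x. F x * 1)" by (rule square_integrable_mult[OF 1(1) square_integrable_const])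
  then have int: "integrable I0pi F" by simp
  have "L2_integral f = (\<integral>x. F x \<partial>I0pi)"
    unfolding 1(2) using 1(1) by (subst L2_integral.abs_eq) (auto simp: L2_rel_def)
  moreover have "f \<bullet> L2_one = Re (\<integral>x. F x \<partial>I0pi)"
    unfolding 1(2) L2_one_def using 1(1) int
    by (subst inner_abs_L2) (auto simp: square_integrable_const inner_complex_def)
  moreover have "f \<bullet> L2_ii = Im (\<integral>x. F x \<partial>I0pi)"
    unfolding 1(2) L2_ii_def using 1(1) int
    by (subst inner_abs_L2) (auto simp: square_integrable_const inner_complex_def)
  ultimately show ?thesis by (simp add: complex_eq_iff)
qed

lemma L2m_iff: "f \<in> L2m \<longleftrightarrow> f \<bullet> L2_one = 0 \<and> f \<bullet> L2_ii = 0"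
  by (simp add: L2m_def L2_integral_eq complex_eq_iff)

lemma L2_integral_abs: "square_integrable f \<Longrightarrow> L2_integral (abs_L2 f) = (\<integral>x. f x \<partial>I0pi)"
  by (subst L2_integral.abs_eq) (auto simp: L2_rel_def)

lemma integral_ddx: "test_function \<phi> \<Longrightarrow> (\<integral>x. ddx \<phi> x \<partial>I0pi) = 0"
  by (erule test_functionE) (rule integral_derivative_compact_support)

lemma ddx_mean_zero:
  assumes "test_function \<phi>"
  shows "abs_L2 (ddx \<phi>) \<in> L2m"
  using integral_ddx[OF assms]
  by (simp add: L2m_def L2_integral_abs test_function_square_integrable assms)

lemma has_weak_deriv_constants: "has_weak_deriv L2_one 0" "has_weak_deriv L2_ii 0"
  using ddx_mean_zero by (auto simp: has_weak_deriv_iff_inner L2m_iff inner_commute)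

text \<open>The orthogonal projection onto \<open>L2m\<close>; pi is the squared norm of both basis
  constants.\<close>

definition mean_free :: "L2 \<Rightarrow> L2" where
  "mean_free f = f - ((f \<bullet> L2_one) / pi) *\<^sub>R L2_one - ((f \<bullet> L2_ii) / pi) *\<^sub>R L2_ii"

lemma mean_free_linear: "bounded_linear mean_free"
  unfolding mean_free_def
  by (intro bounded_linear_sub bounded_linear_ident bounded_linear_scaleR_const
      bounded_linear_compose[OF bounded_linear_divide bounded_linear_inner_left])

lemma mean_free_in_L2m: "mean_free f \<in> L2m"
  by (simp add: L2m_iff mean_free_def inner_diff_left inner_constants)

lemma has_weak_deriv_mean_free: "has_weak_deriv f g \<Longrightarrow> has_weak_deriv (mean_free f) g"
  using has_weak_deriv_constants by (simp add: has_weak_deriv_iff_inner mean_free_def inner_diff_left)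

subsection \<open>The Volterra operator\<close>

text \<open>The integral from 0 to x over a fixed domain: the indicator gives it a meaning for every
  real x, namely 0 to the left of the interval and a constant to its right.\<close>

definition volterra_fun :: "(real \<Rightarrow> complex) \<Rightarrow> real \<Rightarrow> complex" where
  "volterra_fun f x = (\<integral>y. indicator {..x} y *\<^sub>R f y \<partial>I0pi)"

lemma square_integrable_integrable: "square_integrable f \<Longrightarrow> integrable I0pi f"
  using square_integrable_mult[OF _ square_integrable_const[of 1], of f] by simp

lemma volterra_fun_integrable:
  assumes "square_integrable f"
  shows "integrable I0pi (\<lambda>y. indicator {..x} y *\<^sub>R f y)"
proof (rule Bochner_Integration.integrable_bound[OF square_integrable_integrable[OF assms]])
  have [measurable]: "f \<in> borel_measurable I0pi" using assms by (rule square_integrableD)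
  have [measurable]: "indicat_real {..x} \<in> borel_measurable I0pi"
    by (intro measurable_restrict_space1 borel_measurable_indicator) auto
  then show "(\<lambda>y. indicator {..x} y *\<^sub>R f y) \<in> borel_measurable I0pi" by measurable
qed (auto split: split_indicator)

text \<open>Cauchy-Schwarz against the constant 1, whose norm is \<open>sqrt pi\<close>. Being
  uniform in x, the bound yields both square integrability and continuity of the operator.\<close>

lemma norm_volterra_fun:
  assumes f: "square_integrable f"
  shows "norm (volterra_fun f x) \<le> sqrt pi * norm (abs_L2 f)"
proof -
  note int = square_integrable_integrable[OF f]
  have nf: "square_integrable (\<lambda>x. of_real (norm (f x)))"
    using f by (auto simp: square_integrable_def)
  have "norm (volterra_fun f x) \<le> (\<integral>y. norm (indicator {..x} y *\<^sub>R f y) \<partial>I0pi)"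
    unfolding volterra_fun_def by (rule integral_norm_bound)
  also have "\<dots> \<le> (\<integral>y. norm (f y) \<partial>I0pi)"
    using int volterra_fun_integrable[OF f] by (intro integral_mono integrable_norm) (auto split: split_indicator)
  also have "\<dots> = abs_L2 (\<lambda>x. of_real (norm (f x))) \<bullet> L2_one"
    using nf by (simp add: L2_one_def inner_abs_L2 square_integrable_const inner_complex_def)
  also have "\<dots> \<le> norm (abs_L2 (\<lambda>x. complex_of_real (norm (f x)))) * norm L2_one"
    by (rule norm_cauchy_schwarz)
  also have "\<dots> = sqrt pi * norm (abs_L2 f)"
    using f nf by (simp add: norm_abs_L2 norm_eq_sqrt_inner[of L2_one] inner_constants)
  finally show ?thesis .
qed

lemma norm_abs_L2_le:
  assumes "f \<in> borel_measurable I0pi" "\<And>x. norm (f x) \<le> B"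
  shows "norm (abs_L2 f) \<le> sqrt pi * B"
proof -
  have sq: "square_integrable f" using assms by (rule square_integrable_bounded)
  interpret finite_measure I0pi by (rule finite_measure_I0pi)
  have "0 \<le> B" using assms(2)[of 0] norm_ge_zero order_trans by blast
  have "(\<integral>x. (norm (f x))\<^sup>2 \<partial>I0pi) \<le> (\<integral>x. B\<^sup>2 \<partial>I0pi)"
    using sq assms(2) by (intro integral_mono) (auto simp: square_integrable_def intro: power_mono)
  also have "\<dots> = pi * B\<^sup>2" by (simp add: measure_restrict_space)
  finally have "norm (abs_L2 f) \<le> sqrt (pi * B\<^sup>2)" using sq by (simp add: norm_abs_L2)
  then show ?thesis using \<open>0 \<le> B\<close> by (simp add: real_sqrt_mult)
qed

lemma volterra_fun_measurable:
  assumes "square_integrable f"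
  shows "volterra_fun f \<in> borel_measurable I0pi"
proof -
  interpret finite_measure I0pi by (rule finite_measure_I0pi)
  have [measurable]: "f \<in> borel_measurable I0pi" using assms by (rule square_integrableD)
  have id: "(\<lambda>x. x) \<in> borel_measurable I0pi" by (intro continuous_measurable_I0pi continuous_intros)
  have [measurable]: "fst \<in> borel_measurable (I0pi \<Otimes>\<^sub>M I0pi)" "snd \<in> borel_measurable (I0pi \<Otimes>\<^sub>M I0pi)"
    using measurable_compose[OF measurable_fst id] measurable_compose[OF measurable_snd id] by auto
  have "(\<lambda>p. if snd p \<le> fst p then f (snd p) else 0) \<in> borel_measurable (I0pi \<Otimes>\<^sub>M I0pi)"
    by measurable
  then have "(\<lambda>x. \<integral>y. (if y \<le> x then f y else 0) \<partial>I0pi) \<in> borel_measurable I0pi"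
    by (intro borel_measurable_lebesgue_integral) (simp add: case_prod_beta)
  moreover have "volterra_fun f = (\<lambda>x. \<integral>y. (if y \<le> x then f y else 0) \<partial>I0pi)"
    unfolding volterra_fun_def by (intro ext Bochner_Integration.integral_cong) (auto split: split_indicator)
  ultimately show ?thesis by simp
qed

lemma volterra_fun_square_integrable: "square_integrable f \<Longrightarrow> square_integrable (volterra_fun f)"
  using square_integrable_bounded volterra_fun_measurable norm_volterra_fun by blast

lift_definition volterra :: "L2 \<Rightarrow> L2" is volterra_fun
proof -
  fix f g assume fg: "L2_rel f g"
  have "volterra_fun f = volterra_fun g"
    unfolding volterra_fun_def
    by (intro ext integral_cong_AE borel_measurable_integrable volterra_fun_integrable)
      (use fg in \<open>auto simp: L2_rel_def\<close>)
  then show "L2_rel (volterra_fun f) (volterra_fun g)"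
    using fg volterra_fun_square_integrable by (auto simp: L2_rel_def)
qed

lemma volterra_abs: "square_integrable f \<Longrightarrow> volterra (abs_L2 f) = abs_L2 (volterra_fun f)"
  by (simp add: volterra.abs_eq L2_rel_def)

lemma volterra_linear: "bounded_linear volterra"
proof (rule bounded_linear_intro[where K=pi])
  fix f g :: L2 and r :: real
  obtain F where F: "square_integrable F" "f = abs_L2 F" by (rule L2_cases)
  obtain G where G: "square_integrable G" "g = abs_L2 G" by (rule L2_cases)
  have "volterra_fun (\<lambda>x. F x + G x) = (\<lambda>x. volterra_fun F x + volterra_fun G x)"
    unfolding volterra_fun_def scaleR_add_right
    by (intro ext Bochner_Integration.integral_add volterra_fun_integrable F G)
  then show "volterra (f + g) = volterra f + volterra g"
    using F G by (simp add: volterra_abs abs_L2_add square_integrable_add volterra_fun_square_integrable)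
  have "volterra_fun (\<lambda>x. r *\<^sub>R F x) = (\<lambda>x. r *\<^sub>R volterra_fun F x)"
    unfolding volterra_fun_def by (intro ext) (simp only: scaleR_left_commute[of _ r] integral_scaleR_right)
  then show "volterra (r *\<^sub>R f) = r *\<^sub>R volterra f"
    using F by (simp add: volterra_abs abs_L2_scaleR square_integrable_scaleR volterra_fun_square_integrable)
  have "norm (volterra f) \<le> sqrt pi * (sqrt pi * norm f)"
    unfolding F(2) volterra_abs[OF F(1)]
    by (rule norm_abs_L2_le[OF volterra_fun_measurable[OF F(1)] norm_volterra_fun[OF F(1)]])
  then show "norm (volterra f) \<le> norm f * pi" by (simp add: mult.commute flip: mult.assoc)
qed

lemma volterra_fun_continuous:
  assumes f: "continuous_on UNIV f" and ab: "0 < a" "b < pi" "\<And>x. x \<notin> {a..b} \<Longrightarrow> f x = 0"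
  shows "volterra_fun f x = integral {0..x} f" "(volterra_fun f has_vector_derivative f x) (at x)"
proof -
  have eq: "volterra_fun f x = integral {c..x} f" if "c \<le> 0" for x c
  proof -
    have "set_integrable lebesgue {c..x} f"
      by (rule set_integrable_continuous_lebesgue[OF continuous_on_subset[OF f]]) auto
    have "volterra_fun f x = (\<integral>y. indicator {0<..<pi} y *\<^sub>R indicator {..x} y *\<^sub>R f y \<partial>lebesgue)"
      unfolding volterra_fun_def by (rule integral_restrict_space) auto
    also have "\<dots> = (LINT y:{c..x}|lebesgue. f y)"
      unfolding set_lebesgue_integral_def
      by (intro Bochner_Integration.integral_cong) (use ab that in \<open>auto split: split_indicator\<close>)
    also have "\<dots> = integral {c..x} f"
      by (rule set_lebesgue_integral_eq_integral) fact
    finally show ?thesis .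
  qed
  show "volterra_fun f x = integral {0..x} f" by (rule eq) simp
  \<comment> \<open>All base points up to 0 give the same integral; this one is also to the left of
    x, so that x is interior and the derivative two-sided.\<close>
  define c where "c = min 0 x - 1"
  have "((\<lambda>u. integral {c..u} f) has_vector_derivative f x) (at x within {c..x + 1})"
    by (rule integral_has_vector_derivative[OF continuous_on_subset[OF f]]) (auto simp: c_def)
  moreover have "at x within {c..x + 1} = at x"
    by (rule at_within_interior) (auto simp: c_def)
  moreover have "volterra_fun f = (\<lambda>u. integral {c..u} f)"
    by (intro ext eq) (simp add: c_def)
  ultimately show "(volterra_fun f has_vector_derivative f x) (at x)" by simp
qed

lemma volterra_fun_ddx:
  assumes "test_function \<phi>"
  shows "volterra_fun (ddx \<phi>) = \<phi>"
proof
  fix x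
  obtain a b where ab: "0 < a" "b < pi" "\<And>x. x \<notin> {a..b} \<Longrightarrow> \<phi> x = 0" "\<And>x. x \<notin> {a..b} \<Longrightarrow> ddx \<phi> x = 0"
    "\<And>x. (\<phi> has_vector_derivative ddx \<phi> x) (at x)" "continuous_on UNIV (ddx \<phi>)"
    using test_functionE[OF assms] by metis
  show "volterra_fun (ddx \<phi>) x = \<phi> x"
  proof (cases "0 \<le> x")
    case True
    have "(ddx \<phi> has_integral \<phi> x - \<phi> 0) {0..x}"
      by (rule fundamental_theorem_of_calculus[OF True]) (blast intro: has_vector_derivative_at_within ab(5))
    then show ?thesis
      using volterra_fun_continuous(1)[OF ab(6,1,2,4), of x] ab(1) ab(3)[of 0] by (simp add: integral_unique)
  next
    case False
    then show ?thesis using volterra_fun_continuous(1)[OF ab(6,1,2,4), of x] ab(1) ab(3)[of x] by simp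
  qed
qed

lemma volterra_ddx: "test_function \<phi> \<Longrightarrow> volterra (abs_L2 (ddx \<phi>)) = abs_L2 \<phi>"
  by (simp add: volterra_abs test_function_square_integrable volterra_fun_ddx)

text \<open>For test functions this is classical integration by parts; the f that satisfy the
  relation form a closed set, so density finishes.\<close>

lemma has_weak_deriv_volterra: "has_weak_deriv (volterra f) f"
proof -
  have test: "has_weak_deriv (volterra (abs_L2 \<phi>)) (abs_L2 \<phi>)" if \<phi>: "test_function \<phi>" for \<phi>
    unfolding has_weak_deriv_iff_inner
  proof (intro allI impI)
    fix \<psi> assume \<psi>: "test_function \<psi>"
    note sq = test_function_square_integrable(1)[OF \<phi>] test_function_square_integrable[OF \<psi>]
    note sqv = volterra_fun_square_integrable[OF sq(1)]
    obtain a b where ab: "0 < a" "b < pi" "\<And>x. x \<notin> {a..b} \<Longrightarrow> \<phi> x = 0" "continuous_on UNIV \<phi>"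
      using test_functionE[OF \<phi>] by metis
    note d = volterra_fun_continuous(2)[OF ab(4,1,2,3)]
    have vc: "continuous_on UNIV (volterra_fun \<phi>)"
      using d by (meson continuous_at_imp_continuous_on has_vector_derivative_continuous)
    obtain a' b' where ab': "0 < a'" "a' \<le> b'" "b' < pi" "\<And>x. x \<notin> {a'..b'} \<Longrightarrow> \<psi> x = 0"
      "\<And>x. x \<notin> {a'..b'} \<Longrightarrow> ddx \<psi> x = 0" "\<And>x. (\<psi> has_vector_derivative ddx \<psi> x) (at x)"
      "continuous_on UNIV (ddx \<psi>)" "continuous_on UNIV \<psi>"
      using test_functionE[OF \<psi>] by metis
    have "(\<integral>x. volterra_fun \<phi> x \<bullet> ddx \<psi> x + \<phi> x \<bullet> \<psi> x \<partial>I0pi) = 0"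
    proof (rule integral_derivative_compact_support[OF _ _ ab'(1-3)])
      show "((\<lambda>x. volterra_fun \<phi> x \<bullet> \<psi> x) has_vector_derivative volterra_fun \<phi> x \<bullet> ddx \<psi> x + \<phi> x \<bullet> \<psi> x) (at x)" for x
        by (rule bounded_bilinear.has_vector_derivative[OF bounded_bilinear_inner d ab'(6)])
      show "continuous_on UNIV (\<lambda>x. volterra_fun \<phi> x \<bullet> ddx \<psi> x + \<phi> x \<bullet> \<psi> x)"
        by (intro continuous_intros ab' ab vc)
    qed (use ab' in auto)
    then show "volterra (abs_L2 \<phi>) \<bullet> abs_L2 (ddx \<psi>) = - (abs_L2 \<phi> \<bullet> abs_L2 \<psi>)"
      using sq sqv by (simp add: volterra_abs inner_abs_L2 square_integrable_inner)
  qed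
  have "closure (abs_L2 ` Collect test_function) \<subseteq> {f. has_weak_deriv (volterra f) f}"
  proof (rule closure_minimal)
    have "continuous_on UNIV (\<lambda>f. (volterra f, f))"
      by (intro continuous_intros linear_continuous_on volterra_linear)
    from closed_vimage[OF has_weak_deriv_closed this]
    show "closed {f. has_weak_deriv (volterra f) f}" by (simp add: vimage_def)
  qed (use test in auto)
  then show ?thesis by (auto simp: test_functions_dense)
qed

subsection \<open>The graph of the derivative on \<open>H\<^sup>1\<^sub>0\<close>\<close>

text \<open>Its closure is the graph of \<open>weak_deriv\<close> on \<open>H10\<close>. As a closed
  subspace of a Hilbert space it admits the orthogonal projection by which the resolvent equation is
  solved.\<close>

definition test_graph :: "(L2 \<times> L2) set" where
  "test_graph = (\<lambda>\<phi>. (abs_L2 \<phi>, abs_L2 (ddx \<phi>))) ` Collect test_function"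

lemma test_graph_has_weak_deriv: "(u, w) \<in> closure test_graph \<Longrightarrow> has_weak_deriv u w"
proof -
  have "closure test_graph \<subseteq> {(f, g). has_weak_deriv f g}"
    by (rule closure_minimal[OF _ has_weak_deriv_closed])
      (auto simp: test_graph_def has_weak_deriv_test_function)
  then show "(u, w) \<in> closure test_graph \<Longrightarrow> has_weak_deriv u w" by auto
qed

text \<open>The definition of \<open>H10\<close> presupposes a weak derivative; by closedness any
  limit of the graph provides one, as its second component.\<close>

lemma H10_iff: "u \<in> H10 \<longleftrightarrow> (\<exists>w. (u, w) \<in> closure test_graph)"
proof
  assume "u \<in> H10"
  then obtain \<phi> where \<phi>: "\<And>n. test_function (\<phi> n)" "(\<lambda>n. abs_L2 (\<phi> n)) \<longlonglongrightarrow> u"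
    "(\<lambda>n. abs_L2 (ddx (\<phi> n))) \<longlonglongrightarrow> weak_deriv u" by (auto simp: H10_def)
  have "(u, weak_deriv u) \<in> closure test_graph"
    unfolding closure_sequential using tendsto_Pair[OF \<phi>(2,3)] \<phi>(1)
    by (intro exI[of _ "\<lambda>n. (abs_L2 (\<phi> n), abs_L2 (ddx (\<phi> n)))"]) (auto simp: test_graph_def)
  then show "\<exists>w. (u, w) \<in> closure test_graph" by blast
next
  assume "\<exists>w. (u, w) \<in> closure test_graph"
  then obtain w where w: "(u, w) \<in> closure test_graph" by blast
  note d = test_graph_has_weak_deriv[OF w]
  obtain x where x: "\<And>n. x n \<in> test_graph" "x \<longlonglongrightarrow> (u, w)"
    using w unfolding closure_sequential by blast
  have "\<exists>\<phi>. test_function \<phi> \<and> x n = (abs_L2 \<phi>, abs_L2 (ddx \<phi>))" for n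
    using x(1)[of n] by (auto simp: test_graph_def)
  then obtain \<phi> where \<phi>: "\<And>n. test_function (\<phi> n)" "\<And>n. x n = (abs_L2 (\<phi> n), abs_L2 (ddx (\<phi> n)))"
    by metis
  have "(\<lambda>n. abs_L2 (\<phi> n)) \<longlonglongrightarrow> u" "(\<lambda>n. abs_L2 (ddx (\<phi> n))) \<longlonglongrightarrow> w"
    using tendsto_fst[OF x(2)] tendsto_snd[OF x(2)] by (simp_all add: \<phi>(2))
  then show "u \<in> H10"
    unfolding H10_def using H1_I[OF d] weak_deriv_eq[OF d] \<phi>(1) by auto
qed

lemma H10_closure: "u \<in> H10 \<Longrightarrow> (u, weak_deriv u) \<in> closure test_graph"
  using H10_iff test_graph_has_weak_deriv weak_deriv_eq by metis

lemma H10_I: "(u, w) \<in> closure test_graph \<Longrightarrow> u \<in> H10" "(u, w) \<in> closure test_graph \<Longrightarrow> weak_deriv u = w"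
  using H10_iff test_graph_has_weak_deriv weak_deriv_eq by blast+

lemma H10_test_function: "test_function \<phi> \<Longrightarrow> abs_L2 \<phi> \<in> H10"
  by (rule H10_I(1)[of _ "abs_L2 (ddx \<phi>)"]) (auto simp: test_graph_def intro: closure_subset[THEN subsetD])

lemma subspace_test_graph: "subspace test_graph"
  unfolding subspace_def
proof (intro conjI ballI allI)
  have z: "test_function (\<lambda>x. 0)" "ddx (\<lambda>x. 0) = (\<lambda>x. 0)"
    using test_functionI[of "\<lambda>x. 0" "\<lambda>x. 0" 1 1] pi_gt3 by auto
  have "(0::L2, 0::L2) = (abs_L2 (\<lambda>x. 0), abs_L2 (ddx (\<lambda>x. 0)))" unfolding z(2) by (simp add: abs_L2_zero)
  then show "0 \<in> test_graph" unfolding test_graph_def zero_prod_def using z(1) by blast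
  fix x y assume "x \<in> test_graph" "y \<in> test_graph"
  then obtain \<phi> \<psi> where *: "test_function \<phi>" "x = (abs_L2 \<phi>, abs_L2 (ddx \<phi>))"
    "test_function \<psi>" "y = (abs_L2 \<psi>, abs_L2 (ddx \<psi>))" by (auto simp: test_graph_def)
  show "x + y \<in> test_graph"
    unfolding test_graph_def using *
    by (intro image_eqI[of _ _ "\<lambda>x. \<phi> x + \<psi> x"])
      (auto simp: test_function_add abs_L2_add test_function_square_integrable)
next
  fix x c assume "x \<in> test_graph"
  then obtain \<phi> where *: "test_function \<phi>" "x = (abs_L2 \<phi>, abs_L2 (ddx \<phi>))" by (auto simp: test_graph_def)
  have "(\<lambda>x. c *\<^sub>R \<phi> x) = (\<lambda>x. of_real c * \<phi> x)" by (simp add: scaleR_conv_of_real)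
  then show "c *\<^sub>R x \<in> test_graph"
    unfolding test_graph_def using * test_function_cmult[OF *(1), of "of_real c"]
    by (intro image_eqI[of _ _ "\<lambda>x. of_real c * \<phi> x"])
      (auto simp: abs_L2_scaleR test_function_square_integrable scaleR_conv_of_real)
qed

lemma subspace_closure_normed:
  fixes S :: "'a::real_normed_vector set"
  assumes "subspace S"
  shows "subspace (closure S)"
  unfolding subspace_def
proof (intro conjI ballI allI)
  show "0 \<in> closure S" using subspace_0[OF assms] closure_subset by blast
  fix x y assume "x \<in> closure S" "y \<in> closure S"
  then obtain f g where "\<And>n. f n \<in> S" "f \<longlonglongrightarrow> x" "\<And>n. g n \<in> S" "g \<longlonglongrightarrow> y"
    unfolding closure_sequential by blast
  then show "x + y \<in> closure S"
    unfolding closure_sequential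
    by (intro exI[of _ "\<lambda>n. f n + g n"]) (auto intro: tendsto_add subspace_add[OF assms])
next
  fix x c assume "x \<in> closure S"
  then obtain f where "\<And>n. f n \<in> S" "f \<longlonglongrightarrow> x"
    unfolding closure_sequential by blast
  then show "c *\<^sub>R x \<in> closure S"
    unfolding closure_sequential
    by (intro exI[of _ "\<lambda>n. c *\<^sub>R f n"]) (auto intro: tendsto_scaleR subspace_scale[OF assms])
qed

lemma H10_0: "0 \<in> H10" "weak_deriv 0 = 0"
  using H10_I[of 0 0] subspace_0[OF subspace_closure_normed[OF subspace_test_graph]]
  by (auto simp: zero_prod_def)

lemma H10_add:
  assumes "u \<in> H10" "v \<in> H10"
  shows "u + v \<in> H10" "weak_deriv (u + v) = weak_deriv u + weak_deriv v"
  using H10_I[of "u + v" "weak_deriv u + weak_deriv v"]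
    subspace_add[OF subspace_closure_normed[OF subspace_test_graph] H10_closure[OF assms(1)] H10_closure[OF assms(2)]]
  by auto

lemma H10_scaleR:
  assumes "u \<in> H10"
  shows "c *\<^sub>R u \<in> H10" "weak_deriv (c *\<^sub>R u) = c *\<^sub>R weak_deriv u"
  using H10_I[of "c *\<^sub>R u" "c *\<^sub>R weak_deriv u"]
    subspace_scale[OF subspace_closure_normed[OF subspace_test_graph] H10_closure[OF assms], of c]
  by auto

text \<open>Integration by parts without boundary terms: u carries the boundary condition, f has
  none. The identity is continuous in the pair of u and its derivative, so it extends from
  \<open>test_graph\<close> to the closure.\<close>

lemma inner_weak_deriv_H10:
  assumes "u \<in> H10" "has_weak_deriv f g"
  shows "f \<bullet> weak_deriv u = - (g \<bullet> u)"
proof -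
  have "closed {(u, w). f \<bullet> w = - (g \<bullet> u)}"
    unfolding case_prod_beta by (intro closed_Collect_eq continuous_intros)
  then have "closure test_graph \<subseteq> {(u, w). f \<bullet> w = - (g \<bullet> u)}"
    using assms(2) by (intro closure_minimal) (auto simp: test_graph_def has_weak_deriv_iff_inner)
  then show ?thesis using H10_closure[OF assms(1)] by blast
qed

lemma weak_deriv_H10_in_L2m: "u \<in> H10 \<Longrightarrow> weak_deriv u \<in> L2m"
  using inner_weak_deriv_H10[OF _ has_weak_deriv_constants(1)] inner_weak_deriv_H10[OF _ has_weak_deriv_constants(2)]
  by (simp add: L2m_iff inner_commute)

text \<open>The boundary condition at 0 is what excludes an additive constant.\<close>

lemma volterra_weak_deriv_H10:
  assumes "u \<in> H10"
  shows "volterra (weak_deriv u) = u"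
proof -
  have "closed {(u, w). volterra w = u}"
    unfolding case_prod_beta
    by (intro closed_Collect_eq continuous_intros bounded_linear.continuous_on[OF volterra_linear])
  then have "closure test_graph \<subseteq> {(u, w). volterra w = u}"
    by (intro closure_minimal) (auto simp: test_graph_def volterra_ddx)
  then show ?thesis using H10_closure[OF assms] by blast
qed

lemma subspace_L2m: "subspace L2m"
  by (auto simp: subspace_def L2m_iff inner_add_left)

text \<open>Approximating test functions are made mean-free by subtracting multiples of a fixed one of integral 1; their primitives are then test functions.\<close>

lemma volterra_L2m:
  assumes "f \<in> L2m"
  shows "(volterra f, f) \<in> closure test_graph"
proof -
  \<comment> \<open>Otherwise \<open>L2_one\<close> would be orthogonal to a dense set.\<close>
  have "\<exists>\<psi>. test_function \<psi> \<and> (\<integral>x. \<psi> x \<partial>I0pi) \<noteq> 0"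
  proof (rule ccontr)
    assume "\<not> ?thesis"
    then have "L2_one \<bullet> x = 0" if "x \<in> abs_L2 ` Collect test_function" for x
      using that L2_integral_eq[of x]
      by (auto simp: L2_integral_abs test_function_square_integrable complex_eq_iff inner_commute)
    then have "L2_one = 0" by (rule dense_inner_eq_0[OF test_functions_dense])
    then show False using inner_constants(1) by simp
  qed
  then obtain \<psi>0 where \<psi>0: "test_function \<psi>0" "(\<integral>x. \<psi>0 x \<partial>I0pi) \<noteq> 0" by blast
  define \<psi> where "\<psi> x = (1 / (\<integral>x. \<psi>0 x \<partial>I0pi)) * \<psi>0 x" for x
  have \<psi>: "test_function \<psi>" "(\<integral>x. \<psi> x \<partial>I0pi) = 1"
    unfolding \<psi>_def[abs_def] by (rule test_function_cmult[OF \<psi>0(1)]) (use \<psi>0(2) in simp)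
  have mz: "(volterra (abs_L2 g), abs_L2 g) \<in> test_graph" if g: "test_function g" "abs_L2 g \<in> L2m" for g
  proof -
    have int0: "(\<integral>x. g x \<partial>I0pi) = 0"
      using g by (simp add: L2m_def L2_integral_abs test_function_square_integrable)
    obtain a b where ab: "0 < a" "a \<le> b" "b < pi" "\<And>x. x \<notin> {a..b} \<Longrightarrow> g x = 0" "continuous_on UNIV g"
      using test_functionE[OF g(1)] by metis
    \<comment> \<open>To the left of the support nothing has been integrated yet, to its right the
      whole integral, which is 0.\<close>
    have v: "volterra_fun g x = 0" if "x \<notin> {a..b}" for x
    proof (cases "x < a")
      case True
      then have "volterra_fun g x = (\<integral>y. 0 \<partial>I0pi)"
        unfolding volterra_fun_def using ab by (intro Bochner_Integration.integral_cong) (auto split: split_indicator)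
      then show ?thesis by simp
    next
      case False
      then have "volterra_fun g x = (\<integral>y. g y \<partial>I0pi)"
        unfolding volterra_fun_def using ab that by (intro Bochner_Integration.integral_cong) (auto split: split_indicator)
      then show ?thesis by (simp add: int0)
    qed
    note t = test_functionI[OF volterra_fun_continuous(2)[OF ab(5,1,3,4)] ab(5,1,3) v]
    show ?thesis
      unfolding test_graph_def using t g(1)
      by (intro image_eqI[of _ _ "volterra_fun g"]) (auto simp: volterra_abs test_function_square_integrable)
  qed
  obtain x where x: "\<And>n. x n \<in> abs_L2 ` Collect test_function" "x \<longlonglongrightarrow> f"
    using test_functions_dense closure_sequential[of f "abs_L2 ` Collect test_function"] by blast
  \<comment> \<open>Real and imaginary part of the mean are removed separately, by \<psi> and its
    multiple by \<i>; the corrections tend to 0 because f has mean zero.\<close>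
  define y where "y n = x n - (((x n \<bullet> L2_one) *\<^sub>R abs_L2 \<psi>) + ((x n \<bullet> L2_ii) *\<^sub>R abs_L2 (\<lambda>t. \<i> * \<psi> t)))" for n
  have \<psi>i: "test_function (\<lambda>t. \<i> * \<psi> t)" by (rule test_function_cmult[OF \<psi>(1)])
  have in1: "abs_L2 \<psi> \<bullet> L2_one = 1" "abs_L2 \<psi> \<bullet> L2_ii = 0"
    using L2_integral_eq[of "abs_L2 \<psi>"] \<psi> by (auto simp: L2_integral_abs test_function_square_integrable complex_eq_iff)
  have in2: "abs_L2 (\<lambda>t. \<i> * \<psi> t) \<bullet> L2_one = 0" "abs_L2 (\<lambda>t. \<i> * \<psi> t) \<bullet> L2_ii = 1"
    using L2_integral_eq[of "abs_L2 (\<lambda>t. \<i> * \<psi> t)"] \<psi> \<psi>i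
    by (auto simp: L2_integral_abs test_function_square_integrable complex_eq_iff)
  have yg: "(volterra (y n), y n) \<in> test_graph" for n
  proof -
    obtain \<phi> where \<phi>: "test_function \<phi>" "x n = abs_L2 \<phi>" using x(1)[of n] by auto
    have m: "y n \<in> L2m" by (simp add: L2m_iff y_def inner_diff_left inner_add_left in1 in2)
    define h where "h t = of_real (- (x n \<bullet> L2_one)) * \<psi> t + of_real (- (x n \<bullet> L2_ii)) * (\<i> * \<psi> t)" for t
    have h: "test_function h" unfolding h_def[abs_def]
      by (intro test_function_add test_function_cmult \<psi>)
    have t: "test_function (\<lambda>t. \<phi> t + h t)" by (intro test_function_add \<phi> h)
    have "abs_L2 h = - ((x n \<bullet> L2_one) *\<^sub>R abs_L2 \<psi> + (x n \<bullet> L2_ii) *\<^sub>R abs_L2 (\<lambda>t. \<i> * \<psi> t))"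
      unfolding h_def[abs_def] of_real_minus mult_minus_left
      using test_function_square_integrable(1)[OF \<psi>(1)] test_function_square_integrable(1)[OF \<psi>i]
      by (simp add: abs_L2_scaleR abs_L2_add square_integrable_scaleR square_integrable_add scaleR_conv_of_real
          uminus_L2.abs_eq L2_rel_def square_integrable_cmult flip: scaleR_minus_left)
    then have "y n = abs_L2 (\<lambda>t. \<phi> t + h t)"
      using \<phi> h by (simp add: y_def test_function_square_integrable flip: abs_L2_add)
    then show ?thesis using mz[OF t] m by simp
  qed
  have "y \<longlonglongrightarrow> f - (((f \<bullet> L2_one) *\<^sub>R abs_L2 \<psi>) + ((f \<bullet> L2_ii) *\<^sub>R abs_L2 (\<lambda>t. \<i> * \<psi> t)))"
    unfolding y_def by (intro tendsto_intros x)
  then have y: "y \<longlonglongrightarrow> f" using assms by (simp add: L2m_iff)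
  have "(\<lambda>n. (volterra (y n), y n)) \<longlonglongrightarrow> (volterra f, f)"
    by (intro tendsto_Pair y bounded_linear.tendsto[OF volterra_linear])
  then show ?thesis
    unfolding closure_sequential using yg by (intro exI[of _ "\<lambda>n. (volterra (y n), y n)"]) auto
qed

text \<open>A function h with zero derivative and zero mean vanishes: having mean zero, it is the
  derivative of \<open>volterra h\<close>, which lies in \<open>H10\<close>, so integration by parts
  gives \<open>h \<bullet> h = 0\<close>. Thus a primitive recovers the flux from its derivative up
  to the mean.\<close>

lemma mean_free_eq_volterra:
  assumes "has_weak_deriv f g"
  shows "mean_free f = mean_free (volterra g)"
proof -
  define h where "h = mean_free (f - volterra g)"
  have h: "h = mean_free f - mean_free (volterra g)"
    by (simp add: h_def linear_diff[OF bounded_linear.linear[OF mean_free_linear]])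
  have "has_weak_deriv h 0"
    using has_weak_deriv_mean_free[OF assms] has_weak_deriv_mean_free[OF has_weak_deriv_volterra, of g]
    by (simp add: h has_weak_deriv_iff_inner inner_diff_left)
  moreover have "h \<in> L2m" unfolding h_def by (rule mean_free_in_L2m)
  ultimately have "h \<bullet> h = 0"
    using inner_weak_deriv_H10[of "volterra h" h 0] H10_I[OF volterra_L2m[of h]] by simp
  then show ?thesis by (simp add: h)
qed

section \<open>Orthogonal projection\<close>

text \<open>The projection theorem: the parallelogram law makes a minimizing sequence Cauchy, and
  minimality of the limit p along each line through p is orthogonality.\<close>

lemma orthogonal_projection_exists:
  fixes x :: "'a::{real_inner, complete_space}"
  assumes "closed S" "subspace S"
  shows "\<exists>p\<in>S. \<forall>s\<in>S. (x - p) \<bullet> s = 0"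
proof -
  define \<delta> where "\<delta> = (INF s\<in>S. (norm (x - s))\<^sup>2)"
  have ne: "S \<noteq> {}" using subspace_0[OF assms(2)] by blast
  have bdd: "bdd_below ((\<lambda>s. (norm (x - s))\<^sup>2) ` S)" by (rule bdd_belowI[of _ 0]) auto
  have \<delta>: "\<delta> \<le> (norm (x - s))\<^sup>2" if "s \<in> S" for s
    unfolding \<delta>_def by (rule cINF_lower[OF bdd that])
  have "\<exists>s\<in>S. (norm (x - s))\<^sup>2 < \<delta> + 1 / real (Suc n)" for n
    using cINF_less_iff[OF ne bdd, of "\<delta> + 1 / real (Suc n)"] unfolding \<delta>_def by simp
  then obtain s where s: "\<And>n. s n \<in> S" "\<And>n. (norm (x - s n))\<^sup>2 < \<delta> + 1 / real (Suc n)" by metis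
  have le: "(norm (s m - s n))\<^sup>2 \<le> 4 / real (Suc N)" if "m \<ge> N" "n \<ge> N" for m n N
  proof -
    have "(1/2) *\<^sub>R (s m + s n) \<in> S" using s(1) assms(2) by (intro subspace_scale subspace_add)
    then have "\<delta> \<le> (norm (x - (1/2) *\<^sub>R (s m + s n)))\<^sup>2" by (rule \<delta>)
    moreover have "(norm (s m - s n))\<^sup>2 + 4 * (norm (x - (1/2) *\<^sub>R (s m + s n)))\<^sup>2
        = 2 * (norm (x - s m))\<^sup>2 + 2 * (norm (x - s n))\<^sup>2"
      by (simp add: power2_norm_eq_inner algebra_simps inner_commute)
    moreover have "1 / real (Suc m) \<le> 1 / real (Suc N)" "1 / real (Suc n) \<le> 1 / real (Suc N)"
      using that by (auto simp: frac_le)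
    ultimately show ?thesis using s(2)[of m] s(2)[of n] by simp
  qed
  have "Cauchy s"
  proof (rule metric_CauchyI)
    fix e :: real assume "e > 0"
    then obtain N where N: "1 / real (Suc N) < e\<^sup>2 / 4" using nat_approx_posE[of "e\<^sup>2 / 4"] by auto
    have "dist (s m) (s n) < e" if "m \<ge> N" "n \<ge> N" for m n
    proof (rule power_less_imp_less_base)
      show "(dist (s m) (s n))\<^sup>2 < e\<^sup>2" using le[OF that] N by (simp add: dist_norm)
    qed (use \<open>e > 0\<close> in simp)
    then show "\<exists>N. \<forall>m\<ge>N. \<forall>n\<ge>N. dist (s m) (s n) < e" by blast
  qed
  then obtain p where p: "s \<longlonglongrightarrow> p" by (meson Cauchy_convergent convergent_def)
  have pS: "p \<in> S" using closed_sequentially[OF assms(1)] s(1) p by blast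
  have "(\<lambda>n. (norm (x - s n))\<^sup>2) \<longlonglongrightarrow> (norm (x - p))\<^sup>2" by (intro tendsto_intros p)
  moreover have "(\<lambda>n. \<delta> + 1 / real (Suc n)) \<longlonglongrightarrow> \<delta> + 0"
    by (intro tendsto_intros LIMSEQ_Suc[OF lim_1_over_n])
  ultimately have "(norm (x - p))\<^sup>2 \<le> \<delta> + 0"
    by (rule LIMSEQ_le) (use s(2) in \<open>auto intro: less_imp_le\<close>)
  then have min: "(norm (x - p))\<^sup>2 \<le> (norm (x - q))\<^sup>2" if "q \<in> S" for q
    using \<delta>[OF that] by linarith
  have "(x - p) \<bullet> q = 0" if q: "q \<in> S" for q
  proof (cases "q = 0")
    case False
    \<comment> \<open>The minimizer of the quadratic polynomial
      \<open>(norm (x - p - t q))\<^sup>2\<close> in t.\<close>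
    define t where "t = ((x - p) \<bullet> q) / (q \<bullet> q)"
    have "p + t *\<^sub>R q \<in> S" using pS q assms(2) by (intro subspace_add subspace_scale)
    then have "(norm (x - p))\<^sup>2 \<le> (norm ((x - p) - t *\<^sub>R q))\<^sup>2" using min by (simp add: diff_diff_eq)
    also have "\<dots> = (norm (x - p))\<^sup>2 - 2 * t * ((x - p) \<bullet> q) + t * t * (q \<bullet> q)"
      unfolding power2_norm_eq_inner by (simp add: inner_diff_left inner_diff_right inner_commute algebra_simps)
    also have "\<dots> = (norm (x - p))\<^sup>2 - ((x - p) \<bullet> q)\<^sup>2 / (q \<bullet> q)"
      using False by (simp add: t_def power2_eq_square field_simps)
    finally have "((x - p) \<bullet> q)\<^sup>2 / (q \<bullet> q) \<le> 0" by simp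
    moreover have "0 < q \<bullet> q" using False by simp
    ultimately have "((x - p) \<bullet> q)\<^sup>2 \<le> 0" by (auto simp: divide_le_0_iff)
    then show ?thesis by simp
  qed simp
  then show ?thesis using pS by blast
qed

section \<open>Dissipative operators\<close>

text \<open>The operator is dissipative in the equivalent inner product pulled back along \<open>\<Lambda>\<close>; this yields
  a contraction semigroup for the pulled back norm and a bounded one for the original norm.\<close>

lemma dissipative_resolvent_family:
  fixes A :: "'a::{banach, perfect_space} \<Rightarrow> 'a" and \<Lambda> :: "'a \<Rightarrow> 'b::real_inner"
  assumes \<Lambda>: "linear \<Lambda>" "0 < m" "\<And>x. m * norm x \<le> norm (\<Lambda> x)" "\<And>x. norm (\<Lambda> x) \<le> M * norm x" "0 \<le> M"
    and D: "subspace D" "closure D = UNIV"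
    and A: "\<And>x y. x \<in> D \<Longrightarrow> y \<in> D \<Longrightarrow> A (x + y) = A x + A y" "\<And>c x. x \<in> D \<Longrightarrow> A (c *\<^sub>R x) = c *\<^sub>R A x"
    and dissipative: "\<And>x. x \<in> D \<Longrightarrow> \<Lambda> (A x) \<bullet> \<Lambda> x \<le> 0"
    and range: "\<And>l y. 0 < l \<Longrightarrow> \<exists>x\<in>D. l *\<^sub>R x - A x = y"
  shows "resolvent_family D A (\<lambda>l y. THE x. x \<in> D \<and> l *\<^sub>R x - A x = y) (M / m)"
proof -
  \<comment> \<open>Pairing \<open>l x - A x\<close> with x in the pulled back inner product can
    only gain from the dissipative term; Cauchy-Schwarz then cancels one norm of x.\<close>
  have est: "l * norm (\<Lambda> x) \<le> norm (\<Lambda> (l *\<^sub>R x - A x))" if "0 < l" "x \<in> D" for l x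
  proof (cases "norm (\<Lambda> x) = 0")
    case False
    have "l * norm (\<Lambda> x) * norm (\<Lambda> x) = (l *\<^sub>R \<Lambda> x) \<bullet> \<Lambda> x" by (simp add: power2_norm_eq_inner flip: power2_eq_square)
    also have "\<dots> \<le> (l *\<^sub>R \<Lambda> x - \<Lambda> (A x)) \<bullet> \<Lambda> x" using dissipative[OF that(2)] by (simp add: inner_diff_left)
    also have "\<dots> \<le> norm (l *\<^sub>R \<Lambda> x - \<Lambda> (A x)) * norm (\<Lambda> x)" by (rule norm_cauchy_schwarz)
    finally show ?thesis
      using False by (simp add: linear_diff[OF \<Lambda>(1)] linear_scale[OF \<Lambda>(1)])
  qed simp
  have A_diff: "A (x - y) = A x - A y" if "x \<in> D" "y \<in> D" for x y
    using A(1)[of x "-1 *\<^sub>R y"] A(2)[OF that(2), of "-1"] that D(1) by (simp add: subspace_neg)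
  have uniq: "x = y" if "0 < l" "x \<in> D" "y \<in> D" "l *\<^sub>R x - A x = l *\<^sub>R y - A y" for l x y
  proof -
    have "l *\<^sub>R (x - y) - A (x - y) = 0" using that by (simp add: A_diff algebra_simps)
    then have "l * norm (\<Lambda> (x - y)) \<le> norm (\<Lambda> 0)"
      using est[OF that(1) subspace_diff[OF D(1) that(2,3)]] by simp
    then have "norm (\<Lambda> (x - y)) \<le> 0" using that(1) linear_0[OF \<Lambda>(1)] by (simp add: mult_le_0_iff)
    then have "m * norm (x - y) \<le> 0" using \<Lambda>(3)[of "x - y"] by linarith
    then show ?thesis using \<Lambda>(2) by (simp add: mult_le_0_iff)
  qed
  define R where "R l y = (THE x. x \<in> D \<and> l *\<^sub>R x - A x = y)" for l y
  have R_eq: "R l (l *\<^sub>R x - A x) = x" if "0 < l" "x \<in> D" for l x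
    unfolding R_def using that uniq by (intro the_equality) auto
  have R: "R l y \<in> D" "l *\<^sub>R R l y - A (R l y) = y" if "0 < l" for l y
    using range[OF that, of y] R_eq[OF that] by auto
  have \<Lambda>R: "norm (\<Lambda> ((R l ^^ n) x)) \<le> norm (\<Lambda> x) / l ^ n" if "0 < l" for l n x
  proof (induction n)
    case (Suc n)
    have "l * norm (\<Lambda> (R l ((R l ^^ n) x))) \<le> norm (\<Lambda> ((R l ^^ n) x))"
      using est[OF that R(1)[OF that]] by (simp add: R(2)[OF that])
    with Suc have "l * norm (\<Lambda> (R l ((R l ^^ n) x))) \<le> norm (\<Lambda> x) / l ^ n" by linarith
    then show ?case using that by (simp add: field_simps)
  qed simp
  \<comment> \<open>The two norms are compared only once, after n steps in the pulled back norm, so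
    the constant does not grow with n.\<close>
  have bound: "norm ((R l ^^ n) x) \<le> (M / m) / l ^ n * norm x" if "0 < l" for l n x
  proof -
    have "m * norm ((R l ^^ n) x) \<le> norm (\<Lambda> x) / l ^ n" using \<Lambda>(3) \<Lambda>R[OF that] order_trans by blast
    also have "\<dots> \<le> (M * norm x) / l ^ n" using that by (intro divide_right_mono \<Lambda>) auto
    finally show ?thesis using \<Lambda>(2) that by (simp add: field_simps)
  qed
  have lin: "bounded_linear (R l)" if l: "0 < l" for l
    proof (rule bounded_linear_intro[where K="(M / m) / l"])
      fix y z c
      have "R l y + R l z \<in> D" using R(1)[OF l] by (rule subspace_add[OF D(1)]) (rule R(1)[OF l])
      moreover have "l *\<^sub>R (R l y + R l z) - A (R l y + R l z) = y + z"
        using R[OF l, of y] R[OF l, of z] by (simp add: A algebra_simps)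
      ultimately show "R l (y + z) = R l y + R l z" using R_eq[OF l] by metis
      have "c *\<^sub>R R l y \<in> D" using R(1)[OF l] by (rule subspace_scale[OF D(1)])
      moreover have "l *\<^sub>R (c *\<^sub>R R l y) - A (c *\<^sub>R R l y) = c *\<^sub>R y"
        unfolding A(2)[OF R(1)[OF l]] scaleR_left_commute[of l c] scaleR_diff_right[symmetric] R(2)[OF l] ..
      ultimately show "R l (c *\<^sub>R y) = c *\<^sub>R R l y" using R_eq[OF l] by metis
      show "norm (R l y) \<le> norm y * ((M / m) / l)" using bound[OF l, of 1 y] by (simp add: mult.commute)
    qed
  have "resolvent_family D A R (M / m)"
    unfolding resolvent_family_def using lin R R_eq bound \<Lambda>(2,5) D by auto
  then show ?thesis unfolding R_def[abs_def] .
qed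

lemma has_weak_deriv_diff:
  "has_weak_deriv f f' \<Longrightarrow> has_weak_deriv g g' \<Longrightarrow> has_weak_deriv (f - g) (f' - g')"
  by (auto simp: has_weak_deriv_iff_inner inner_diff_left)

lemma H1_add:
  assumes "f \<in> H1" "g \<in> H1"
  shows "f + g \<in> H1" "weak_deriv (f + g) = weak_deriv f + weak_deriv g"
  using has_weak_deriv_add[OF assms[THEN has_weak_deriv_weak_deriv]] by (auto intro: H1_I weak_deriv_eq)

lemma H1_scaleR:
  assumes "f \<in> H1"
  shows "c *\<^sub>R f \<in> H1" "weak_deriv (c *\<^sub>R f) = c *\<^sub>R weak_deriv f"
  using has_weak_deriv_scaleR[OF has_weak_deriv_weak_deriv[OF assms], of c]
  by (auto intro: H1_I weak_deriv_eq)

section \<open>The semigroup of the linearized system\<close>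

locale linearized_system =
  fixes a \<gamma> \<rho>s \<mu> \<kappa> :: real
  assumes a_pos: "a > 0" and \<gamma>_ge: "\<gamma> \<ge> 1" and \<rho>s_pos: "\<rho>s > 0" and \<mu>_pos: "\<mu> > 0" and \<kappa>_pos: "\<kappa> > 0"
begin

definition b :: real where "b = a * \<gamma> * \<rho>s powr (\<gamma> - 2)"

abbreviation "D \<equiv> op_dom a \<gamma> \<rho>s"
abbreviation "A \<equiv> op_A a \<gamma> \<rho>s \<mu> \<kappa>"
abbreviation "\<theta> \<equiv> flux a \<gamma> \<rho>s"

lemma b_pos: "b > 0"
  using a_pos \<gamma>_ge \<rho>s_pos by (simp add: b_def)

lemma flux_eq: "\<theta> \<rho> \<sigma> = (1 / \<rho>s) *\<^sub>R \<sigma> - b *\<^sub>R \<rho>"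
  by (simp add: flux_def b_def)

lemma mem_D: "(\<rho>, u, \<sigma>) \<in> D \<longleftrightarrow> u \<in> H10 \<and> \<theta> \<rho> \<sigma> \<in> H1"
  by (simp add: op_dom_def)

lemma A_eq: "A (\<rho>, u, \<sigma>) = (- (\<rho>s *\<^sub>R weak_deriv u), weak_deriv (\<theta> \<rho> \<sigma>),
    (\<mu> / \<kappa>) *\<^sub>R weak_deriv u - (1 / \<kappa>) *\<^sub>R \<sigma>)"
  by (simp add: op_A_def)

lemma flux_add: "\<theta> (\<rho> + \<rho>') (\<sigma> + \<sigma>') = \<theta> \<rho> \<sigma> + \<theta> \<rho>' \<sigma>'"
  and flux_scaleR: "\<theta> (c *\<^sub>R \<rho>) (c *\<^sub>R \<sigma>) = c *\<^sub>R \<theta> \<rho> \<sigma>"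
  by (simp_all add: flux_eq algebra_simps)

lemma A_add:
  assumes "x \<in> D" "y \<in> D"
  shows "x + y \<in> D" "A (x + y) = A x + A y"
  using assms by (cases x; cases y; simp add: mem_D A_eq flux_add H10_add H1_add algebra_simps)+

lemma A_scaleR:
  assumes "x \<in> D"
  shows "c *\<^sub>R x \<in> D" "A (c *\<^sub>R x) = c *\<^sub>R A x"
  using assms by (cases x; simp add: mem_D A_eq flux_scaleR H10_scaleR H1_scaleR algebra_simps)+

lemma subspace_D: "subspace D"
proof -
  have "\<theta> 0 0 \<in> H1" using H1_I[of 0 0] by (simp add: flux_eq has_weak_deriv_iff_inner)
  then have "0 \<in> D" by (simp add: mem_D H10_0 zero_prod_def)
  then show ?thesis by (simp add: subspace_def A_add A_scaleR)
qed

lemma op_dom_dense: "closure D = UNIV"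
proof -
  let ?T = "abs_L2 ` Collect test_function"
  have H1: "abs_L2 \<phi> \<in> H1" if "test_function \<phi>" for \<phi>
    using has_weak_deriv_test_function[OF that] by (rule H1_I)
  have "\<theta> \<rho> \<sigma> \<in> H1" if "\<rho> \<in> H1" "\<sigma> \<in> H1" for \<rho> \<sigma>
    using H1_add(1)[OF H1_scaleR(1)[OF that(2), of "1 / \<rho>s"] H1_scaleR(1)[OF that(1), of "- b"]]
    by (simp add: flux_eq)
  then have "?T \<times> ?T \<times> ?T \<subseteq> D"
    using H1 by (auto simp: mem_D H10_test_function)
  from closure_mono[OF this] show ?thesis by (auto simp: closure_Times test_functions_dense)
qed

text \<open>The weights make the first-order part of the operator skew-symmetric.\<close>

definition energy :: "L2 \<times> L2 \<times> L2 \<Rightarrow> L2 \<times> L2 \<times> L2" where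
  "energy = (\<lambda>(\<rho>, u, \<sigma>). (sqrt (b / \<rho>s) *\<^sub>R \<rho>, u, sqrt (\<kappa> / (\<mu> * \<rho>s)) *\<^sub>R \<sigma>))"

lemma energy_linear: "linear energy"
  by (rule linearI) (auto simp: energy_def algebra_simps)

lemma energy_inner: "energy (\<rho>, u, \<sigma>) \<bullet> energy (\<rho>', u', \<sigma>')
    = (b / \<rho>s) * (\<rho> \<bullet> \<rho>') + u \<bullet> u' + (\<kappa> / (\<mu> * \<rho>s)) * (\<sigma> \<bullet> \<sigma>')"
  using b_pos \<rho>s_pos \<mu>_pos \<kappa>_pos by (simp add: energy_def flip: mult.assoc real_sqrt_mult)

text \<open>Integration by parts turns the velocity term into \<open>b\<close> times the pairing of
  u' with \<rho> minus \<open>1 / \<rho>s\<close> times that with \<sigma>. The weights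
  \<open>b / \<rho>s\<close> and \<open>\<kappa> / (\<mu> * \<rho>s)\<close> produce exactly the
  opposite terms, and only the relaxation of the stress remains.\<close>

lemma energy_dissipative:
  assumes "x \<in> D"
  shows "energy (A x) \<bullet> energy x \<le> 0"
proof (cases x)
  case (fields \<rho> u \<sigma>)
  have u: "u \<in> H10" and t: "\<theta> \<rho> \<sigma> \<in> H1" using assms by (auto simp: fields mem_D)
  have "weak_deriv u \<bullet> \<theta> \<rho> \<sigma> = (1 / \<rho>s) * (weak_deriv u \<bullet> \<sigma>) - b * (weak_deriv u \<bullet> \<rho>)"
    by (simp add: flux_eq inner_diff_right)
  then have eq: "weak_deriv (\<theta> \<rho> \<sigma>) \<bullet> u = b * (weak_deriv u \<bullet> \<rho>) - (1 / \<rho>s) * (weak_deriv u \<bullet> \<sigma>)"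
    using inner_weak_deriv_H10[OF u has_weak_deriv_weak_deriv[OF t]] inner_commute[of "\<theta> \<rho> \<sigma>" "weak_deriv u"]
    by linarith
  have "energy (A x) \<bullet> energy x = - (\<sigma> \<bullet> \<sigma>) / (\<mu> * \<rho>s)"
    unfolding fields A_eq energy_inner eq using \<rho>s_pos \<mu>_pos \<kappa>_pos
    by (simp add: inner_diff_left field_simps)
  also have "\<dots> \<le> 0" using \<rho>s_pos \<mu>_pos by simp
  finally show ?thesis .
qed

text \<open>Eliminating \<open>\<rho>\<close> and \<open>\<sigma>\<close> leaves \<open>l u - (c2 u' + k)' = g\<close> with \<open>u\<close> in \<open>H\<^sup>1\<^sub>0\<close>. Its weak form states
  that the residual of \<open>(\<surd>l u, \<surd>c2 u')\<close> is orthogonal to the rescaled graph.\<close>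

lemma resolvent_equation:
  assumes l: "0 < l"
  shows "\<exists>x\<in>D. l *\<^sub>R x - A x = y"
proof (cases y)
  case (fields f g h)
  \<comment> \<open>With w for u', the density and stress equations give
    \<open>\<rho> = (f - \<rho>s w) / l\<close> and
    \<open>\<sigma> = (\<kappa> h + \<mu> w) / (\<kappa> l + 1)\<close>; \<open>c2\<close> is the
    coefficient of w and \<open>k\<close> the remainder in their flux.\<close>
  define c2 where "c2 = b * \<rho>s / l + \<mu> / (\<rho>s * (\<kappa> * l + 1))"
  define k where "k = (\<kappa> / (\<rho>s * (\<kappa> * l + 1))) *\<^sub>R h - (b / l) *\<^sub>R f"
  have kl: "\<kappa> * l + 1 > 0" using \<kappa>_pos l by (simp add: add_pos_pos)
  have "b * \<rho>s / l > 0" "\<mu> / (\<rho>s * (\<kappa> * l + 1)) > 0"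
    using b_pos \<rho>s_pos \<mu>_pos kl l by simp_all
  then have c2: "c2 > 0" unfolding c2_def by (rule add_pos_pos)
  \<comment> \<open>The image of the closed graph under
    \<open>(u, w) \<mapsto> (sqrt l u, sqrt c2 w)\<close>. On it the inner product becomes the form
    \<open>l (u \<bullet> \<phi>) + c2 (w \<bullet> \<phi>')\<close>, and the vector projected below
    represents the right-hand side \<open>g \<bullet> \<phi> - k \<bullet> \<phi>'\<close>.\<close>
  define S where "S = (\<lambda>p::L2\<times>L2. ((1 / sqrt l) *\<^sub>R fst p, (1 / sqrt c2) *\<^sub>R snd p)) -` closure test_graph"
  have "closed S" unfolding S_def
    by (intro closed_vimage continuous_intros closed_closure)
  moreover have "subspace S"
    unfolding S_def by (rule linear_subspace_vimage[rotated])
      (auto simp: subspace_closure_normed[OF subspace_test_graph] algebra_simps intro!: linearI)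
  ultimately obtain p where p: "p \<in> S" "\<And>s. s \<in> S \<Longrightarrow> (((1 / sqrt l) *\<^sub>R g, - ((1 / sqrt c2) *\<^sub>R k)) - p) \<bullet> s = 0"
    using orthogonal_projection_exists by metis
  define u where "u = (1 / sqrt l) *\<^sub>R fst p"
  define w where "w = (1 / sqrt c2) *\<^sub>R snd p"
  have uw: "(u, w) \<in> closure test_graph" using p(1) by (simp add: S_def u_def w_def)
  have pe: "fst p = sqrt l *\<^sub>R u" "snd p = sqrt c2 *\<^sub>R w" using l c2 by (auto simp: u_def w_def)
  have "has_weak_deriv (c2 *\<^sub>R w + k) (l *\<^sub>R u - g)"
    unfolding has_weak_deriv_iff_inner
  proof (intro allI impI)
    fix \<phi> assume "test_function \<phi>"
    then have "(abs_L2 \<phi>, abs_L2 (ddx \<phi>)) \<in> closure test_graph"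
      by (auto simp: test_graph_def intro: closure_subset[THEN subsetD])
    then have "(sqrt l *\<^sub>R abs_L2 \<phi>, sqrt c2 *\<^sub>R abs_L2 (ddx \<phi>)) \<in> S"
      using l c2 by (simp add: S_def)
    from p(2)[OF this] have "g \<bullet> abs_L2 \<phi> - l * (u \<bullet> abs_L2 \<phi>)
        - (k \<bullet> abs_L2 (ddx \<phi>)) - c2 * (w \<bullet> abs_L2 (ddx \<phi>)) = 0"
      using l c2 by (simp add: inner_prod_def pe inner_diff_left algebra_simps flip: mult.assoc)
    then show "(c2 *\<^sub>R w + k) \<bullet> abs_L2 (ddx \<phi>) = - ((l *\<^sub>R u - g) \<bullet> abs_L2 \<phi>)"
      by (simp add: inner_add_left inner_diff_left)
  qed
  moreover define \<rho> where "\<rho> = (1 / l) *\<^sub>R (f - \<rho>s *\<^sub>R w)"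
  moreover define \<sigma> where "\<sigma> = (1 / (\<kappa> * l + 1)) *\<^sub>R (\<kappa> *\<^sub>R h + \<mu> *\<^sub>R w)"
  moreover have fx: "\<theta> \<rho> \<sigma> = c2 *\<^sub>R w + k"
    unfolding flux_eq \<rho>_def \<sigma>_def c2_def k_def using l kl \<rho>s_pos
    by (simp add: algebra_simps)
  ultimately have t: "has_weak_deriv (\<theta> \<rho> \<sigma>) (l *\<^sub>R u - g)" by simp
  have "(\<rho>, u, \<sigma>) \<in> D" using H10_I(1)[OF uw] H1_I[OF t] by (simp add: mem_D)
  moreover have "l *\<^sub>R (\<rho>, u, \<sigma>) - A (\<rho>, u, \<sigma>) = y"
  proof -
    have "l *\<^sub>R \<sigma> + (1 / \<kappa>) *\<^sub>R \<sigma> = (1 / \<kappa>) *\<^sub>R ((\<kappa> * l + 1) *\<^sub>R \<sigma>)"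
      using \<kappa>_pos by (simp add: algebra_simps)
    also have "(\<kappa> * l + 1) *\<^sub>R \<sigma> = \<kappa> *\<^sub>R h + \<mu> *\<^sub>R w" using kl by (simp add: \<sigma>_def)
    finally have "l *\<^sub>R \<sigma> + (1 / \<kappa>) *\<^sub>R \<sigma> = h + (\<mu> / \<kappa>) *\<^sub>R w"
      using \<kappa>_pos by (simp add: algebra_simps)
    moreover have "l *\<^sub>R \<rho> = f - \<rho>s *\<^sub>R w" using l by (simp add: \<rho>_def)
    ultimately show ?thesis
      unfolding A_eq fields H10_I(2)[OF uw] weak_deriv_eq[OF t] by (simp add: algebra_simps)
  qed
  ultimately show ?thesis by blast
qed

definition res_fun :: "real \<Rightarrow> L2 \<times> L2 \<times> L2 \<Rightarrow> L2 \<times> L2 \<times> L2" where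
  "res_fun l y = (THE x. x \<in> D \<and> l *\<^sub>R x - A x = y)"

lemma resolvent_family_A: "\<exists>M. resolvent_family D A res_fun M"
proof -
  define c d where "c = sqrt (b / \<rho>s)" and "d = sqrt (\<kappa> / (\<mu> * \<rho>s))"
  define m M where "m = min c (min 1 d)" and "M = max c (max 1 d)"
  have pos: "c > 0" "d > 0" using b_pos \<rho>s_pos \<mu>_pos \<kappa>_pos by (auto simp: c_def d_def)
  then have m: "m > 0" "m \<le> c" "m \<le> 1" "m \<le> d" and M: "M > 0" "c \<le> M" "1 \<le> M" "d \<le> M"
    by (auto simp: m_def M_def)
  have n: "(norm (energy (\<rho>, u, \<sigma>)))\<^sup>2 = c\<^sup>2 * (norm \<rho>)\<^sup>2 + (norm u)\<^sup>2 + d\<^sup>2 * (norm \<sigma>)\<^sup>2" for \<rho> u \<sigma>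
    using pos by (simp add: energy_def norm_Pair power_mult_distrib flip: c_def d_def)
  have n': "(norm (\<rho>, u, \<sigma>))\<^sup>2 = (norm \<rho>)\<^sup>2 + (norm u)\<^sup>2 + (norm \<sigma>)\<^sup>2" for \<rho> u \<sigma> :: L2
    by (simp add: norm_Pair)
  have lower: "m * norm x \<le> norm (energy x)" for x
  proof (cases x)
    case (fields \<rho> u \<sigma>)
    have sq: "m\<^sup>2 \<le> c\<^sup>2" "m\<^sup>2 \<le> 1" "m\<^sup>2 \<le> d\<^sup>2"
      using m power_mono[OF m(2)] power_mono[OF m(4)] power_le_one[of m 2] by auto
    have "(m * norm x)\<^sup>2 \<le> (norm (energy x))\<^sup>2"
      unfolding fields n power_mult_distrib n' distrib_left
      using mult_right_mono[OF sq(1), of "(norm \<rho>)\<^sup>2"] mult_right_mono[OF sq(2), of "(norm u)\<^sup>2"]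
        mult_right_mono[OF sq(3), of "(norm \<sigma>)\<^sup>2"] by simp
    then show ?thesis by (rule power2_le_imp_le) simp
  qed
  have upper: "norm (energy x) \<le> M * norm x" for x
  proof (cases x)
    case (fields \<rho> u \<sigma>)
    have sq: "c\<^sup>2 \<le> M\<^sup>2" "1 \<le> M\<^sup>2" "d\<^sup>2 \<le> M\<^sup>2"
      using pos M by (auto intro: power_mono one_le_power)
    have "(norm (energy x))\<^sup>2 \<le> (M * norm x)\<^sup>2"
      unfolding fields n power_mult_distrib n' distrib_left
      using mult_right_mono[OF sq(1), of "(norm \<rho>)\<^sup>2"] mult_right_mono[OF sq(2), of "(norm u)\<^sup>2"]
        mult_right_mono[OF sq(3), of "(norm \<sigma>)\<^sup>2"] by simp
    then show ?thesis by (rule power2_le_imp_le) (use M in simp)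
  qed
  have "resolvent_family D A res_fun (M / m)"
    unfolding res_fun_def[abs_def]
    by (rule dissipative_resolvent_family[OF energy_linear m(1) lower upper _ subspace_D op_dom_dense
          A_add(2) A_scaleR(2) energy_dissipative resolvent_equation]) (use M in auto)
  then show ?thesis ..
qed

definition M_bound :: real where "M_bound = (SOME M. resolvent_family D A res_fun M)"

sublocale resolvent_family D A res_fun M_bound
  unfolding M_bound_def by (rule someI_ex[OF resolvent_family_A])

end

section \<open>The null control\<close>

context linearized_system
begin

text \<open>Of all primitives the mean-free one is chosen: applied to a derivative it returns the
  function up to its mean, with no boundary value involved.\<close>

definition primitive :: "L2 \<Rightarrow> L2" where "primitive f = mean_free (volterra f)"

text \<open>The coefficient of \<eta>'. Without a stress component, its velocity must be
  \<open>(\<kappa> / \<mu>) volterra \<sigma>\<close> for the stress components to cancel. Applying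
  this to the stress equation returns a second copy of u, whence the factor 2; the resulting
  \<open>2 u - (1 / \<mu>) volterra \<sigma>\<close> has to be the derivative of the flux, which is
  \<open>- b\<close> times the density.\<close>

definition correction1 :: "L2 \<times> L2 \<times> L2 \<Rightarrow> L2 \<times> L2 \<times> L2" where
  "correction1 = (\<lambda>(\<rho>, u, \<sigma>). (- ((1 / b) *\<^sub>R (2 *\<^sub>R primitive u - (1 / \<mu>) *\<^sub>R primitive (volterra \<sigma>))), (\<kappa> / \<mu>) *\<^sub>R volterra \<sigma>, 0))"

text \<open>The coefficient of \<eta>''. The derivative of its flux absorbs the velocity that
  \<open>correction1\<close> leaves behind.\<close>

definition correction2 :: "L2 \<times> L2 \<times> L2 \<Rightarrow> L2 \<times> L2 \<times> L2" where
  "correction2 = (\<lambda>(\<rho>, u, \<sigma>). (- ((1 / b) *\<^sub>R ((\<kappa> / \<mu>) *\<^sub>R primitive (volterra \<sigma>))), 0, 0))"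

text \<open>The density component of \<open>x - A (correction1 x) + correction1 (A x)\<close>, with
  all derivatives removed so that it becomes a bounded operator on the whole space;
  \<open>control2\<close> is obtained in the same way one order higher.\<close>

definition control1 :: "L2 \<times> L2 \<times> L2 \<Rightarrow> L2" where
  "control1 = (\<lambda>(\<rho>, u, \<sigma>). \<rho> + (\<rho>s * (\<kappa> / \<mu>)) *\<^sub>R \<sigma>
    - (1 / b) *\<^sub>R (2 *\<^sub>R mean_free (\<theta> \<rho> \<sigma>) - (1 / \<mu>) *\<^sub>R primitive ((\<mu> / \<kappa>) *\<^sub>R u - (1 / \<kappa>) *\<^sub>R volterra \<sigma>)))"

definition control2 :: "L2 \<times> L2 \<times> L2 \<Rightarrow> L2" where
  "control2 = (\<lambda>(\<rho>, u, \<sigma>). - ((1 / b) *\<^sub>R (2 *\<^sub>R primitive u - (1 / \<mu>) *\<^sub>R primitive (volterra \<sigma>)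
    + (\<kappa> / \<mu>) *\<^sub>R primitive ((\<mu> / \<kappa>) *\<^sub>R u - (1 / \<kappa>) *\<^sub>R volterra \<sigma>))))"

definition control3 :: "L2 \<times> L2 \<times> L2 \<Rightarrow> L2" where
  "control3 = (\<lambda>(\<rho>, u, \<sigma>). - ((1 / b) *\<^sub>R ((\<kappa> / \<mu>) *\<^sub>R primitive (volterra \<sigma>))))"

lemma primitive_linear: "bounded_linear primitive"
  unfolding primitive_def[abs_def] by (rule bounded_linear_compose[OF mean_free_linear volterra_linear])

lemmas control_linear_intros =
  bounded_linear_Pair bounded_linear_zero bounded_linear_add bounded_linear_sub bounded_linear_minus
  bounded_linear_const_scaleR bounded_linear_compose[OF primitive_linear] bounded_linear_compose[OF volterra_linear]
  bounded_linear_compose[OF mean_free_linear] bounded_linear_fst bounded_linear_compose[OF bounded_linear_fst bounded_linear_snd]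
  bounded_linear_compose[OF bounded_linear_snd bounded_linear_snd]

lemma correction1_linear: "bounded_linear correction1" and correction2_linear: "bounded_linear correction2"
  and control1_linear: "bounded_linear control1" and control2_linear: "bounded_linear control2" and control3_linear: "bounded_linear control3"
  unfolding correction1_def correction2_def control1_def control2_def control3_def case_prod_beta flux_eq
  by (intro control_linear_intros)+

lemma volterra_simps: "volterra (f + g) = volterra f + volterra g" "volterra (f - g) = volterra f - volterra g"
  "volterra (c *\<^sub>R f) = c *\<^sub>R volterra f"
  using bounded_linear.linear[OF volterra_linear] by (auto intro: linear_add linear_diff linear_scale)

lemma has_weak_deriv_primitive: "has_weak_deriv (primitive f) f"
  unfolding primitive_def by (rule has_weak_deriv_mean_free[OF has_weak_deriv_volterra])

text \<open>Mean zero of \<sigma> places \<open>volterra \<sigma>\<close> in \<open>H10\<close>. The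
  corrections carry no stress, so their flux is \<open>- b\<close> times the density, and
  differentiating it undoes \<open>primitive\<close>.\<close>

lemma
  assumes "\<sigma> \<in> L2m"
  shows correction1_in_D: "correction1 (\<rho>, u, \<sigma>) \<in> D"
    and A_correction1: "A (correction1 (\<rho>, u, \<sigma>)) = (- ((\<rho>s * (\<kappa> / \<mu>)) *\<^sub>R \<sigma>), 2 *\<^sub>R u - (1 / \<mu>) *\<^sub>R volterra \<sigma>, \<sigma>)"
    and correction2_in_D: "correction2 (\<rho>, u, \<sigma>) \<in> D"
    and A_correction2: "A (correction2 (\<rho>, u, \<sigma>)) = (0, (\<kappa> / \<mu>) *\<^sub>R volterra \<sigma>, 0)"
proof -
  have nz: "b \<noteq> 0" "\<mu> \<noteq> 0" "\<kappa> \<noteq> 0" using b_pos \<mu>_pos \<kappa>_pos by auto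
  have V: "volterra \<sigma> \<in> H10" "weak_deriv (volterra \<sigma>) = \<sigma>"
    using H10_I[OF volterra_L2m[OF assms]] by auto
  have f1: "\<theta> (- ((1 / b) *\<^sub>R g)) 0 = g" for g using nz by (simp add: flux_eq)
  have d1: "has_weak_deriv (2 *\<^sub>R primitive u - (1 / \<mu>) *\<^sub>R primitive (volterra \<sigma>)) (2 *\<^sub>R u - (1 / \<mu>) *\<^sub>R volterra \<sigma>)"
    by (intro has_weak_deriv_diff has_weak_deriv_scaleR has_weak_deriv_primitive)
  have d2: "has_weak_deriv ((\<kappa> / \<mu>) *\<^sub>R primitive (volterra \<sigma>)) ((\<kappa> / \<mu>) *\<^sub>R volterra \<sigma>)"
    by (intro has_weak_deriv_scaleR has_weak_deriv_primitive)
  show "correction1 (\<rho>, u, \<sigma>) \<in> D" "correction2 (\<rho>, u, \<sigma>) \<in> D"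
    unfolding correction1_def correction2_def prod.case mem_D f1
    using H1_I[OF d1] H1_I[OF d2] V by (auto simp: H10_scaleR H10_0)
  show "A (correction1 (\<rho>, u, \<sigma>)) = (- ((\<rho>s * (\<kappa> / \<mu>)) *\<^sub>R \<sigma>), 2 *\<^sub>R u - (1 / \<mu>) *\<^sub>R volterra \<sigma>, \<sigma>)"
    unfolding correction1_def prod.case A_eq f1 weak_deriv_eq[OF d1] using V nz by (simp add: H10_scaleR)
  show "A (correction2 (\<rho>, u, \<sigma>)) = (0, (\<kappa> / \<mu>) *\<^sub>R volterra \<sigma>, 0)"
    unfolding correction2_def prod.case A_eq f1 weak_deriv_eq[OF d2] by (simp add: H10_0)
qed

text \<open>These identities say that a cut-off of a free trajectory, corrected by \<^term>\<open>correction1\<close> and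
  \<^term>\<open>correction2\<close>, misses the equation only in its density component.\<close>

lemma
  assumes "x \<in> D" "snd (snd x) \<in> L2m"
  shows correction1_commutator: "x - A (correction1 x) + correction1 (A x) = (control1 x, 0, 0)"
    and correction2_commutator: "correction1 x - A (correction2 x) + correction2 (A x) = (control2 x, 0, 0)"
    and correction2_eq: "correction2 x = (control3 x, 0, 0)"
proof -
  obtain \<rho> u \<sigma> where x: "x = (\<rho>, u, \<sigma>)" by (cases x)
  have u: "u \<in> H10" and t: "\<theta> \<rho> \<sigma> \<in> H1" and m: "\<sigma> \<in> L2m" using assms by (auto simp: x mem_D)
  have nz: "b \<noteq> 0" "\<mu> \<noteq> 0" "\<kappa> \<noteq> 0" using b_pos \<mu>_pos \<kappa>_pos by auto
  \<comment> \<open>The derivative of the flux enters only through its primitive, which gives back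
    the flux without its mean; \<open>V'\<close> does the same for the derivative of u.\<close>
  have Kt: "primitive (weak_deriv (\<theta> \<rho> \<sigma>)) = mean_free (\<theta> \<rho> \<sigma>)"
    unfolding primitive_def using mean_free_eq_volterra[OF has_weak_deriv_weak_deriv[OF t]] by simp
  have V': "volterra ((\<mu> / \<kappa>) *\<^sub>R weak_deriv u - (1 / \<kappa>) *\<^sub>R \<sigma>) = (\<mu> / \<kappa>) *\<^sub>R u - (1 / \<kappa>) *\<^sub>R volterra \<sigma>"
    by (simp only: volterra_simps volterra_weak_deriv_H10[OF u])
  show "x - A (correction1 x) + correction1 (A x) = (control1 x, 0, 0)"
    unfolding x A_correction1[OF m] unfolding correction1_def control1_def A_eq prod.case Kt V'
    using nz by (simp add: algebra_simps scaleR_2)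
  show "correction1 x - A (correction2 x) + correction2 (A x) = (control2 x, 0, 0)"
    unfolding x A_correction2[OF m] unfolding correction1_def correction2_def control2_def A_eq prod.case V'
    using nz by (simp add: algebra_simps)
  show "correction2 x = (control3 x, 0, 0)" by (simp add: x correction2_def control3_def)
qed

text \<open>Here p, q, r, v stand for a cut-off and its first three derivatives. After the product
  rule the coefficients of q and r are the two commutators and that of v is
  \<open>correction2\<close>, all concentrated in the density.\<close>

lemma cutoff_trajectory:
  assumes x: "x s \<in> D" "snd (snd (x s)) \<in> L2m" "(x has_vector_derivative A (x s)) (at s within S)"
    and p: "(p has_real_derivative q s) (at s within S)" "(q has_real_derivative r s) (at s within S)"
      "(r has_real_derivative v s) (at s within S)"
  defines "w \<equiv> \<lambda>s. p s *\<^sub>R x s + q s *\<^sub>R correction1 (x s) + r s *\<^sub>R correction2 (x s)"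
  shows "w s \<in> D"
    and "(w has_vector_derivative A (w s) +
      (q s *\<^sub>R control1 (x s) + r s *\<^sub>R control2 (x s) + v s *\<^sub>R control3 (x s), 0, 0)) (at s within S)"
proof -
  obtain \<rho> u \<sigma> where xs: "x s = (\<rho>, u, \<sigma>)" by (cases "x s")
  have m: "\<sigma> \<in> L2m" using x(2) by (simp add: xs)
  have N: "correction1 (x s) \<in> D" "correction2 (x s) \<in> D" using correction1_in_D[OF m] correction2_in_D[OF m] by (auto simp: xs)
  show "w s \<in> D" unfolding w_def by (intro A_add A_scaleR N x)
  have Aw: "A (w s) = p s *\<^sub>R A (x s) + q s *\<^sub>R A (correction1 (x s)) + r s *\<^sub>R A (correction2 (x s))"
    unfolding w_def using N x by (simp add: A_add A_scaleR)
  have "(w has_vector_derivative (p s *\<^sub>R A (x s) + q s *\<^sub>R x s)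
      + (q s *\<^sub>R correction1 (A (x s)) + r s *\<^sub>R correction1 (x s))
      + (r s *\<^sub>R correction2 (A (x s)) + v s *\<^sub>R correction2 (x s))) (at s within S)"
    unfolding w_def
    by (intro has_vector_derivative_add has_vector_derivative_scaleR p x
        bounded_linear.has_vector_derivative[OF correction1_linear] bounded_linear.has_vector_derivative[OF correction2_linear])
  also have "(p s *\<^sub>R A (x s) + q s *\<^sub>R x s) + (q s *\<^sub>R correction1 (A (x s)) + r s *\<^sub>R correction1 (x s))
        + (r s *\<^sub>R correction2 (A (x s)) + v s *\<^sub>R correction2 (x s))
      = A (w s) + (q s *\<^sub>R (x s - A (correction1 (x s)) + correction1 (A (x s)))
        + r s *\<^sub>R (correction1 (x s) - A (correction2 (x s)) + correction2 (A (x s))) + v s *\<^sub>R correction2 (x s))"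
    unfolding Aw by (simp add: algebra_simps)
  also have "\<dots> = A (w s) + (q s *\<^sub>R control1 (x s) + r s *\<^sub>R control2 (x s) + v s *\<^sub>R control3 (x s), 0, 0)"
    unfolding correction1_commutator[OF x(1,2)] correction2_commutator[OF x(1,2)] unfolding correction2_eq[OF x(1,2)] by simp
  finally show "(w has_vector_derivative A (w s) +
      (q s *\<^sub>R control1 (x s) + r s *\<^sub>R control2 (x s) + v s *\<^sub>R control3 (x s), 0, 0)) (at s within S)" .
qed

subsection \<open>The mean of the stress\<close>

lemma closed_stress_mean: "closed {z :: L2 \<times> L2 \<times> L2. snd (snd z) \<in> L2m}"
  unfolding L2m_iff by (intro closed_Collect_conj closed_Collect_eq continuous_intros)

text \<open>Keeps regularized initial data admissible. In the stress equation
  \<open>(l + 1 / \<kappa>) \<sigma> = h + (\<mu> / \<kappa>) u'\<close> the last term has mean zero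
  because u lies in \<open>H10\<close>.\<close>

lemma res_fun_stress_mean:
  assumes "0 < l" "snd (snd z) \<in> L2m"
  shows "snd (snd (res_fun l z)) \<in> L2m"
proof -
  obtain \<rho> u \<sigma> where x: "res_fun l z = (\<rho>, u, \<sigma>)" by (cases "res_fun l z")
  have u: "u \<in> H10" using R_in[OF assms(1), of z] by (simp add: x mem_D)
  have "snd (snd z) = snd (snd (l *\<^sub>R res_fun l z - A (res_fun l z)))"
    using R_right[OF assms(1), of z] by simp
  also have "\<dots> = (l + 1 / \<kappa>) *\<^sub>R \<sigma> - (\<mu> / \<kappa>) *\<^sub>R weak_deriv u"
    by (simp add: x A_eq algebra_simps)
  finally have "(l + 1 / \<kappa>) *\<^sub>R \<sigma> = snd (snd z) + (\<mu> / \<kappa>) *\<^sub>R weak_deriv u" by simp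
  also have "\<dots> \<in> L2m"
    by (intro subspace_add subspace_scale subspace_L2m assms weak_deriv_H10_in_L2m u)
  finally have "(1 / (l + 1 / \<kappa>)) *\<^sub>R ((l + 1 / \<kappa>) *\<^sub>R \<sigma>) \<in> L2m" by (rule subspace_scale[OF subspace_L2m])
  moreover have "l + 1 / \<kappa> \<noteq> 0" using assms(1) \<kappa>_pos by (metis add_pos_pos less_numeral_extra(3) zero_less_divide_1_iff)
  ultimately show ?thesis by (simp add: x)
qed

lemma semi_stress_mean:
  assumes z: "z \<in> D" "snd (snd z) \<in> L2m" and t: "0 \<le> t"
  shows "snd (snd (semi t z)) \<in> L2m"
proof -
  have "snd (snd (semi t z)) \<bullet> e = 0" if e: "e = L2_one \<or> e = L2_ii" for e
  proof -
    \<comment> \<open>The derivative of the velocity has mean zero, so each real component m of the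
      mean stress solves \<open>m' = - m / \<kappa>\<close>; the weight is the integrating
      factor.\<close>
    define g where "g s = exp (s / \<kappa>) *\<^sub>R (snd (snd (semi s z)) \<bullet> e)" for s
    have "(g has_vector_derivative 0) (at s within {0..})" if s: "s \<in> {0..}" for s
    proof -
      obtain \<rho> u \<sigma> where x: "semi s z = (\<rho>, u, \<sigma>)" by (cases "semi s z")
      have u: "u \<in> H10" using semi_invariant(1)[OF z(1), of s] s by (simp add: x mem_D)
      have we: "weak_deriv u \<bullet> e = 0" using weak_deriv_H10_in_L2m[OF u] e by (auto simp: L2m_iff)
      have "((\<lambda>s. semi s z) has_vector_derivative A (semi s z)) (at s within {0..})"
        using semi_derivative[OF z(1), of s] semi_invariant(2)[OF z(1), of s] s by simp
      then have "((\<lambda>s. snd (snd (semi s z)) \<bullet> e) has_vector_derivative snd (snd (A (semi s z))) \<bullet> e) (at s within {0..})"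
        by (intro bounded_linear.has_vector_derivative[OF bounded_linear_inner_left]
            bounded_linear.has_vector_derivative[OF bounded_linear_snd])
      moreover have "((\<lambda>s. exp (s / \<kappa>)) has_real_derivative exp (s / \<kappa>) / \<kappa>) (at s within {0..})"
        using \<kappa>_pos by (auto intro!: derivative_eq_intros)
      ultimately have "(g has_vector_derivative exp (s / \<kappa>) *\<^sub>R (snd (snd (A (semi s z))) \<bullet> e)
          + (exp (s / \<kappa>) / \<kappa>) *\<^sub>R (snd (snd (semi s z)) \<bullet> e)) (at s within {0..})"
        unfolding g_def[abs_def] by (intro has_vector_derivative_scaleR)
      then show ?thesis by (simp add: x A_eq inner_diff_left we)
    qed
    then obtain c where c: "\<And>s. s \<in> {0..} \<Longrightarrow> g s = c"
      using has_vector_derivative_zero_constant[of "{0..}" g] convex_real_interval(1) by metis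
    have "g 0 = 0" using z(2) e by (auto simp: g_def semi_0 L2m_iff)
    then have "g t = 0" using c[of t] c[of 0] t by simp
    then show ?thesis by (simp add: g_def)
  qed
  then show ?thesis by (simp add: L2m_iff)
qed

end

section \<open>The cut-off in time and the admissibility of continuous controls\<close>

lemma smooth_cutoff:
  fixes T :: real
  assumes "0 < T"
  obtains \<eta> \<eta>1 \<eta>2 \<eta>3 :: "real \<Rightarrow> real"
  where "\<And>s. (\<eta> has_real_derivative \<eta>1 s) (at s)" "\<And>s. (\<eta>1 has_real_derivative \<eta>2 s) (at s)"
    "\<And>s. (\<eta>2 has_real_derivative \<eta>3 s) (at s)" "continuous_on UNIV \<eta>3"
    "\<eta> 0 = 1" "\<eta>1 0 = 0" "\<eta>2 0 = 0" "\<eta> T = 0" "\<eta>1 T = 0" "\<eta>2 T = 0"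
proof (rule that)
  \<comment> \<open>With x = s / T this is \<open>1 - 10 x^3 + 15 x^4 - 6 x^5\<close>, the Hermite
    interpolant of the six endpoint conditions; its derivative in x is
    \<open>- 30 x^2 (1 - x)^2\<close>.\<close>
  define r where "r = 1 / T"
  show "((\<lambda>s. 1 - 10 * (r * s) ^ 3 + 15 * (r * s) ^ 4 - 6 * (r * s) ^ 5) has_real_derivative
      r * (- 30 * (r * s) ^ 2 + 60 * (r * s) ^ 3 - 30 * (r * s) ^ 4)) (at s)" for s
    by (auto intro!: derivative_eq_intros simp: algebra_simps eval_nat_numeral)
  show "((\<lambda>s. r * (- 30 * (r * s) ^ 2 + 60 * (r * s) ^ 3 - 30 * (r * s) ^ 4)) has_real_derivative
      r * (r * (- 60 * (r * s) + 180 * (r * s) ^ 2 - 120 * (r * s) ^ 3))) (at s)" for s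
    by (auto intro!: derivative_eq_intros simp: algebra_simps eval_nat_numeral)
  show "((\<lambda>s. r * (r * (- 60 * (r * s) + 180 * (r * s) ^ 2 - 120 * (r * s) ^ 3))) has_real_derivative
      r * (r * (r * (- 60 + 360 * (r * s) - 360 * (r * s) ^ 2)))) (at s)" for s
    by (auto intro!: derivative_eq_intros simp: algebra_simps eval_nat_numeral)
  show "continuous_on UNIV (\<lambda>s. r * (r * (r * (- 60 + 360 * (r * s) - 360 * (r * s) ^ 2))))"
    by (intro continuous_intros)
qed (use assms in auto)

lemma bounded_time_multiple:
  fixes L :: "'a::real_normed_vector \<Rightarrow> 'b::real_normed_vector" and \<eta> :: "real \<Rightarrow> real"
  assumes "continuous_on {0..t} \<eta>" "bounded_linear L"
  shows "\<exists>C\<ge>0. \<forall>s\<in>{0..t}. \<forall>x. norm (\<eta> s *\<^sub>R L x) \<le> C * norm x"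
proof -
  obtain B where B: "\<And>s. s \<in> {0..t} \<Longrightarrow> \<bar>\<eta> s\<bar> \<le> B"
    using compact_imp_bounded[OF compact_continuous_image[OF assms(1) compact_Icc]]
    unfolding bounded_iff by (metis imageI real_norm_def)
  obtain k where k: "0 < k" "\<And>x. norm (L x) \<le> norm x * k"
    using bounded_linear.pos_bounded[OF assms(2)] by blast
  have "norm (\<eta> s *\<^sub>R L x) \<le> (max B 0 * k) * norm x" if "s \<in> {0..t}" for s x
  proof -
    have "\<bar>\<eta> s\<bar> * norm (L x) \<le> max B 0 * (norm x * k)"
      using B[OF that] k by (intro mult_mono) auto
    then show ?thesis by (simp add: mult_ac)
  qed
  then show ?thesis using k(1) by (intro exI[of _ "max B 0 * k"]) auto
qed

lemma continuous_in_L2_control: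
  assumes "continuous_on {0..T} f"
  shows "f \<in> L2_control T"
proof -
  have "integrable (lebesgue_on {0<..<T}) g" if "continuous_on {0..T} g"
    for g :: "real \<Rightarrow> 'a::{banach, second_countable_topology}"
  proof -
    have "set_integrable lebesgue {0<..<T} g"
      by (rule set_integrable_subset[OF set_integrable_continuous_lebesgue[OF that]]) auto
    then show ?thesis by (simp add: integrable_restrict_space set_integrable_def)
  qed
  note int = this
  have "continuous_on {0..T} (\<lambda>t. (norm (f t))\<^sup>2)" by (intro continuous_intros assms)
  from int[OF this] int[OF assms] show ?thesis
    by (auto simp: L2_control_def)
qed

section \<open>The controlled trajectory\<close>

context linearized_system
begin

lemma null_control:
  assumes T: "0 < T" and z0: "snd (snd z0) \<in> L2m"
  shows "\<exists>f\<in>L2_control T. \<exists>z. mild_solution D A T z0 (\<lambda>t. (f t, 0, 0)) z \<and>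
    continuous_on {0..T} z \<and> (\<forall>t\<in>{0..T}. z t \<in> UNIV \<times> UNIV \<times> L2m) \<and> z T = (0, 0, 0)"
proof -
  obtain \<eta> \<eta>1 \<eta>2 \<eta>3 :: "real \<Rightarrow> real"
    where \<eta>: "\<And>s. (\<eta> has_real_derivative \<eta>1 s) (at s)" "\<And>s. (\<eta>1 has_real_derivative \<eta>2 s) (at s)"
      "\<And>s. (\<eta>2 has_real_derivative \<eta>3 s) (at s)" "continuous_on UNIV \<eta>3"
      "\<eta> 0 = 1" "\<eta>1 0 = 0" "\<eta>2 0 = 0" "\<eta> T = 0" "\<eta>1 T = 0" "\<eta>2 T = 0"
    using smooth_cutoff[OF T] by metis
  have \<eta>c: "continuous_on S \<eta>" "continuous_on S \<eta>1" "continuous_on S \<eta>2" "continuous_on S \<eta>3" for S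
    using \<eta>(1-3) continuous_on_subset[OF \<eta>(4) subset_UNIV]
    by (blast intro: DERIV_isCont continuous_at_imp_continuous_on)+
  \<comment> \<open>\<open>F s\<close> sends the free state at time s to the control and
    \<open>N s\<close> sends it to the controlled state; both are bounded operators, hence
    meaningful for free trajectories outside the domain.\<close>
  define F where "F s x = \<eta>1 s *\<^sub>R control1 x + \<eta>2 s *\<^sub>R control2 x + \<eta>3 s *\<^sub>R control3 x" for s x
  define N where "N s x = \<eta> s *\<^sub>R x + \<eta>1 s *\<^sub>R correction1 x + \<eta>2 s *\<^sub>R correction2 x" for s x
  have F_lin: "bounded_linear (F s)" and N_lin: "bounded_linear (N s)" for s
    unfolding F_def N_def
    by (intro bounded_linear_add bounded_linear_const_scaleR bounded_linear_ident
        control1_linear control2_linear control3_linear correction1_linear correction2_linear)+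
  have orbit: "continuous_on {0..t} (\<lambda>s. semi s z)" for t z
    by (rule continuous_on_subset[OF semi_continuous]) auto
  have F_cont: "continuous_on {0..t} (\<lambda>s. F s (semi s z))" for t z
    unfolding F_def by (intro continuous_intros \<eta>c orbit control1_linear[THEN bounded_linear.continuous_on]
        control2_linear[THEN bounded_linear.continuous_on] control3_linear[THEN bounded_linear.continuous_on])
  have FP_cont: "continuous_on {0..t} (\<lambda>s. (F s (semi s z), 0::L2, 0::L2))" for t z
    by (intro continuous_on_Pair F_cont continuous_on_const)
  have N_cont: "continuous_on {0..t} (\<lambda>s. N s (semi s z))" for t z
    unfolding N_def by (intro continuous_intros \<eta>c orbit correction1_linear[THEN bounded_linear.continuous_on]
        correction2_linear[THEN bounded_linear.continuous_on])
  \<comment> \<open>Regularized data: in the domain, with mean-zero stress, and convergent to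
    \<open>z0\<close>.\<close>
  define zn where "zn n = real (Suc n) *\<^sub>R res_fun (real (Suc n)) z0" for n
  have zn_lim: "zn \<longlonglongrightarrow> z0" unfolding zn_def by (rule R_tendsto_id)
  have zn_D: "zn n \<in> D" for n unfolding zn_def by (intro A_scaleR R_in) simp
  have zn_m: "snd (snd (zn n)) \<in> L2m" for n
    using res_fun_stress_mean[OF _ z0, of "real (Suc n)"] subspace_scale[OF subspace_L2m]
    by (simp add: zn_def del: of_nat_Suc)
  have formula_n: "N t (semi t (zn n)) = semi t (zn n)
      + (LINT s:{0..t}|lebesgue. semi (t - s) (F s (semi s (zn n)), 0, 0))" if t: "0 \<le> t" for t n
  proof -
    have "N t (semi t (zn n)) = semi t (N 0 (semi 0 (zn n)))
        + (LINT s:{0..t}|lebesgue. semi (t - s) (F s (semi s (zn n)), 0, 0))"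
    proof (rule duhamel_formula[OF resolvent_family_axioms t])
      fix s assume s: "s \<in> {0..t}"
      have x: "semi s (zn n) \<in> D" "snd (snd (semi s (zn n))) \<in> L2m"
        using semi_invariant(1)[OF zn_D] semi_stress_mean[OF zn_D zn_m] s by auto
      have "((\<lambda>s. semi s (zn n)) has_vector_derivative A (semi s (zn n))) (at s within {0..})"
        using semi_derivative[OF zn_D, of s] semi_invariant(2)[OF zn_D, of s] s by simp
      then have d: "((\<lambda>s. semi s (zn n)) has_vector_derivative A (semi s (zn n))) (at s within {0..t})"
        by (rule has_vector_derivative_within_subset) auto
      note \<eta>' = \<eta>(1-3)[THEN has_field_derivative_at_within]
      show "N s (semi s (zn n)) \<in> D"
        and "((\<lambda>s. N s (semi s (zn n))) has_vector_derivative
          A (N s (semi s (zn n))) + (F s (semi s (zn n)), 0, 0)) (at s within {0..t})"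
        using cutoff_trajectory[where x="\<lambda>s. semi s (zn n)" and p=\<eta> and q=\<eta>1 and r=\<eta>2
            and v=\<eta>3, OF x d \<eta>'] by (simp_all add: N_def F_def)
    qed (rule FP_cont)
    \<comment> \<open>\<open>N 0\<close> is the identity, as \<eta> is 1 and its first two
      derivatives are 0 at time 0.\<close>
    then show ?thesis by (simp add: N_def \<eta> semi_0)
  qed
  \<comment> \<open>The trajectory of \<open>z0\<close> need not be differentiable, but the
    integrated equation involves only quantities that depend continuously on the initial
    datum.\<close>
  have formula: "N t (semi t z0) = semi t z0
      + (LINT s:{0..t}|lebesgue. semi (t - s) (F s (semi s z0), 0, 0))" if t: "0 \<le> t" for t
  proof -
    obtain Z where Z: "\<And>n. norm (zn n) \<le> Z"
      using convergent_imp_Bseq[of zn] zn_lim unfolding convergent_def Bseq_def by blast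
    obtain C1 where C1: "\<And>s x. s \<in> {0..t} \<Longrightarrow> norm (\<eta>1 s *\<^sub>R control1 x) \<le> C1 * norm x" "0 \<le> C1"
      using bounded_time_multiple[OF \<eta>c(2) control1_linear] by metis
    obtain C2 where C2: "\<And>s x. s \<in> {0..t} \<Longrightarrow> norm (\<eta>2 s *\<^sub>R control2 x) \<le> C2 * norm x" "0 \<le> C2"
      using bounded_time_multiple[OF \<eta>c(3) control2_linear] by metis
    obtain C3 where C3: "\<And>s x. s \<in> {0..t} \<Longrightarrow> norm (\<eta>3 s *\<^sub>R control3 x) \<le> C3 * norm x" "0 \<le> C3"
      using bounded_time_multiple[OF \<eta>c(4) control3_linear] by metis
    have F_bound: "norm (F s (semi s (zn n))) \<le> (C1 + C2 + C3) * (M_bound * Z)" if s: "s \<in> {0..t}" for s n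
    proof -
      have "norm (F s x) \<le> (C1 + C2 + C3) * norm x" for x
        unfolding F_def distrib_right
        by (intro order_trans[OF norm_triangle_ineq] add_mono C1 C2 C3 s)
      moreover have "norm (semi s (zn n)) \<le> M_bound * Z"
        using s Z by (intro order_trans[OF norm_semi] mult_left_mono M_nonneg) auto
      ultimately show ?thesis
        using C1(2) C2(2) C3(2) by (meson add_nonneg_nonneg mult_left_mono order_trans)
    qed
    show ?thesis
    proof (rule duhamel_formula_limit[OF resolvent_family_axioms t FP_cont FP_cont _ _ formula_n[OF t] _ zn_lim])
      have S: "(\<lambda>n. semi s (zn n)) \<longlonglongrightarrow> semi s z0" if "0 \<le> s" for s
        by (rule bounded_linear.tendsto[OF semi_linear[OF that] zn_lim])
      show "(\<lambda>n. (F s (semi s (zn n)), 0::L2, 0::L2)) \<longlonglongrightarrow> (F s (semi s z0), 0, 0)" if "s \<in> {0..t}" for s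
        using S[of s] that by (intro tendsto_Pair tendsto_const bounded_linear.tendsto[OF F_lin]) auto
      show "(\<lambda>n. N t (semi t (zn n))) \<longlonglongrightarrow> N t (semi t z0)"
        by (rule bounded_linear.tendsto[OF N_lin S[OF t]])
      show "norm (F s (semi s (zn n)), 0::L2, 0::L2) \<le> (C1 + C2 + C3) * (M_bound * Z)" if "s \<in> {0..t}" for s n
        using F_bound[OF that, of n] by (simp add: norm_Pair)
    qed
  qed
  have mean: "snd (snd (semi t z0)) \<in> L2m" if "0 \<le> t" for t
    using closed_sequentially[OF closed_stress_mean, of "\<lambda>n. semi t (zn n)"]
      bounded_linear.tendsto[OF semi_linear[OF that] zn_lim] semi_stress_mean[OF zn_D zn_m that] by auto
  show ?thesis
  proof (intro bexI exI conjI ballI)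
    show "(\<lambda>t. F t (semi t z0)) \<in> L2_control T" by (rule continuous_in_L2_control[OF F_cont])
    show "mild_solution D A T z0 (\<lambda>t. (F t (semi t z0), 0, 0)) (\<lambda>t. N t (semi t z0))"
      unfolding mild_solution_def
    proof (intro exI[of _ semi] conjI ballI C0_semigroup_semi is_generator_semi)
      fix t assume t: "t \<in> {0..T}"
      show "set_integrable lebesgue {0..t} (\<lambda>s. semi (t - s) (F s (semi s z0), 0, 0))"
        by (intro set_integrable_continuous_lebesgue semi_continuous_on FP_cont continuous_intros) auto
      show "N t (semi t z0) = semi t z0 + (LINT s:{0..t}|lebesgue. semi (t - s) (F s (semi s z0), 0, 0))"
        using t by (intro formula) auto
    qed
    show "continuous_on {0..T} (\<lambda>t. N t (semi t z0))" by (rule N_cont)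
    show "N t (semi t z0) \<in> UNIV \<times> UNIV \<times> L2m" if "t \<in> {0..T}" for t
    proof -
      \<comment> \<open>The corrections have no stress component, so mean zero is inherited from the
        free stress.\<close>
      have "snd (snd (N t x)) = \<eta> t *\<^sub>R snd (snd x)" for x
        by (cases x) (simp add: N_def correction1_def correction2_def)
      then have "snd (snd (N t (semi t z0))) \<in> L2m"
        using mean[of t] that subspace_scale[OF subspace_L2m] by simp
      then show ?thesis by (cases "N t (semi t z0)") simp
    qed
    show "N T (semi T z0) = (0, 0, 0)" by (simp add: N_def \<eta> zero_prod_def)
  qed
qed

end

theorem theorem1p6:
  fixes a \<gamma> \<rho>s \<mu> \<kappa> T :: real and \<rho>0 u0 S0 :: L2
  assumes "a > 0" "\<gamma> \<ge> 1" "\<rho>s > 0" "\<mu> > 0" "\<kappa> > 0"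
    and "T > 0"
    and "S0 \<in> L2m"
  shows "\<exists>f1 \<in> L2_control T. \<exists>z.
    mild_solution (op_dom a \<gamma> \<rho>s) (op_A a \<gamma> \<rho>s \<mu> \<kappa>) T (\<rho>0, u0, S0) (\<lambda>t. (f1 t, 0, 0)) z \<and>
    continuous_on {0..T} z \<and>
    (\<forall>t\<in>{0..T}. z t \<in> UNIV \<times> UNIV \<times> L2m) \<and>
    z T = (0, 0, 0)"
proof -
  interpret linearized_system a \<gamma> \<rho>s \<mu> \<kappa> by standard (use assms in auto)
  show ?thesis using assms by (intro null_control) auto
qed

end
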